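(* Let $\mathcal A$ and $\mathcal B$ be finite tensor categories and $\mathcal M$ an $\mathcal A$-$\mathcal B$-bimodule category. Then the endofunctor $\mathrm N^{\rm l}_{\mathcal M}=\int_{m\in\mathcal M}\mathrm{Hom}_{\mathcal M}(m,-)\otimes m$ of the category $\mathcal M$ has a natural structure of a bimodule functor $$\mathrm N^{\rm l}_{\mathcal M}:\ \mathcal M\to{}^{\rm rr}\mathcal M^{\rm ll},$$ i.e. there are coherent isomorphisms $$\mathrm N^{\rm l}_{\mathcal M}(a.m.b)\;\cong\;a^{\vee\vee}.\,\mathrm N^{\rm l}_{\mathcal M}(m)\,.\,{}^{\vee\vee}b$$ for all $m\in\mathcal M$, $a\in\mathcal A$ and $b\in\mathcal B$.
   Context: $\Bbbk$ is an algebraically closed field; all categories and functors are $\Bbbk$-linear. A finite linear category is one equivalent to the category of finite-dimensional modules over a finite-dimensional $\Bbbk$-algebra. A finite tensor category is a finite linear category that is rigid monoidal with bilinear tensor product and $\mathrm{End}(\mathbf 1)\cong\Bbbk$. The right dual $c^\vee$ of $c$ comes with $c^\vee\otimes c\to\mathbf 1$ and $\mathbf 1\to c\otimes c^\vee$; the left dual ${}^\vee c$ comes with $c\otimes{}^\vee c\to\mathbf 1$ and $\mathbf 1\to{}^\vee c\otimes c$. A left $\mathcal A$-module category is a finite linear category $\mathcal M$ with a bilinear action functor $\mathcal A\times\mathcal M\to\mathcal M$, $(a,m)\mapsto a.m$, exact in the $\mathcal A$-variable, and natural associativity and unit isomorphisms satisfying pentagon and triangle axioms; right module categories and bimodule categories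 are defined analogously. ${}^{\rm rr}\mathcal M^{\rm ll}$ is the $\mathcal A$-$\mathcal B$-bimodule category that equals $\mathcal M$ as a linear category, with $a$ acting from the left as $a^{\vee\vee}$ does on $\mathcal M$ and $b$ acting from the right as ${}^{\vee\vee}b$ does on $\mathcal M$. "Coherent" means that the natural isomorphisms satisfy the axioms of a bimodule functor (compatibility with the associativity and unit constraints of both actions). $v\otimes m$ for finite-dimensional $v$ is the object with $\mathrm{Hom}_{\mathcal M}(-,v\otimes m)\cong v\otimes_{\Bbbk}\mathrm{Hom}_{\mathcal M}(-,m)$, and $\int_m$ is an end. *)

theory Defs
  imports
    "HOL-Computational_Algebra.Polynomial"
    "HOL-Library.Poly_Mapping"
    "Jordan_Normal_Form.Matrix"
begin

section \<open>Linear categories\<close>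

text \<open>
  The hom-spaces of a linear category are subspaces of one ambient vector space, the type of
  morphisms, and two different hom-spaces share only the zero vector. Every linear category whose
  objects form a set is isomorphic to one of this form: take the direct sum of all hom-spaces as
  ambient space. This is the linear version of the convention that hom-sets are disjoint; since all
  operations on morphisms are linear in each variable, they need not mention source and target.
\<close>

record ('o, 'm, 'k) lincat =
  Obj :: "'o set"
  Hom :: "'o \<Rightarrow> 'o \<Rightarrow> 'm set"
  Idn :: "'o \<Rightarrow> 'm"
  Comp :: "'m \<Rightarrow> 'm \<Rightarrow> 'm"  (infixr \<open>\<cdot>\<index>\<close> 66)
  Scale :: "'k \<Rightarrow> 'm \<Rightarrow> 'm"

locale linear_category =
  fixes C :: "('o, 'm::ab_group_add, 'k::field, 'z) lincat_scheme" (structure)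
  assumes vector_space_mor: "vector_space (Scale C)"
    and hom_subspace: "\<lbrakk>x \<in> Obj C; y \<in> Obj C\<rbrakk> \<Longrightarrow> module.subspace (Scale C) (Hom C x y)"
    and hom_disjoint: "\<lbrakk>x \<in> Obj C; y \<in> Obj C; x' \<in> Obj C; y' \<in> Obj C;
          f \<in> Hom C x y; f \<in> Hom C x' y'; f \<noteq> 0\<rbrakk> \<Longrightarrow> x = x' \<and> y = y'"
    and id_hom: "x \<in> Obj C \<Longrightarrow> Idn C x \<in> Hom C x x"
    and comp_hom: "\<lbrakk>x \<in> Obj C; y \<in> Obj C; z \<in> Obj C; f \<in> Hom C x y; g \<in> Hom C y z\<rbrakk>
          \<Longrightarrow> g \<cdot> f \<in> Hom C x z"
    and comp_id_left: "\<lbrakk>x \<in> Obj C; y \<in> Obj C; f \<in> Hom C x y\<rbrakk> \<Longrightarrow> Idn C y \<cdot> f = f"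
    and comp_id_right: "\<lbrakk>x \<in> Obj C; y \<in> Obj C; f \<in> Hom C x y\<rbrakk> \<Longrightarrow> f \<cdot> Idn C x = f"
    and comp_assoc: "\<lbrakk>w \<in> Obj C; x \<in> Obj C; y \<in> Obj C; z \<in> Obj C;
          f \<in> Hom C w x; g \<in> Hom C x y; h \<in> Hom C y z\<rbrakk> \<Longrightarrow> (h \<cdot> g) \<cdot> f = h \<cdot> (g \<cdot> f)"
    and comp_add_left: "\<lbrakk>x \<in> Obj C; y \<in> Obj C; z \<in> Obj C;
          f \<in> Hom C x y; g \<in> Hom C y z; g' \<in> Hom C y z\<rbrakk> \<Longrightarrow> (g + g') \<cdot> f = g \<cdot> f + g' \<cdot> f"
    and comp_add_right: "\<lbrakk>x \<in> Obj C; y \<in> Obj C; z \<in> Obj C;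
          f \<in> Hom C x y; f' \<in> Hom C x y; g \<in> Hom C y z\<rbrakk> \<Longrightarrow> g \<cdot> (f + f') = g \<cdot> f + g \<cdot> f'"
    and comp_scale_left: "\<lbrakk>x \<in> Obj C; y \<in> Obj C; z \<in> Obj C; f \<in> Hom C x y; g \<in> Hom C y z\<rbrakk>
          \<Longrightarrow> Scale C r g \<cdot> f = Scale C r (g \<cdot> f)"
    and comp_scale_right: "\<lbrakk>x \<in> Obj C; y \<in> Obj C; z \<in> Obj C; f \<in> Hom C x y; g \<in> Hom C y z\<rbrakk>
          \<Longrightarrow> g \<cdot> Scale C r f = Scale C r (g \<cdot> f)"

definition is_inverse ::
  "('o, 'm::ab_group_add, 'k, 'z) lincat_scheme \<Rightarrow> 'o \<Rightarrow> 'o \<Rightarrow> 'm \<Rightarrow> 'm \<Rightarrow> bool" where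
  "is_inverse C x y f g \<longleftrightarrow> f \<in> Hom C x y \<and> g \<in> Hom C y x
     \<and> g \<cdot>\<^bsub>C\<^esub> f = Idn C x \<and> f \<cdot>\<^bsub>C\<^esub> g = Idn C y"

definition is_iso ::
  "('o, 'm::ab_group_add, 'k, 'z) lincat_scheme \<Rightarrow> 'o \<Rightarrow> 'o \<Rightarrow> 'm \<Rightarrow> bool" where
  "is_iso C x y f \<longleftrightarrow> (\<exists>g. is_inverse C x y f g)"

definition inv_mor :: "('o, 'm::ab_group_add, 'k, 'z) lincat_scheme \<Rightarrow> 'm \<Rightarrow> 'm" where
  "inv_mor C f = (THE g. \<exists>x\<in>Obj C. \<exists>y\<in>Obj C. is_inverse C x y f g)"

definition linear_functor ::
  "('o, 'm::ab_group_add, 'k, 'z) lincat_scheme \<Rightarrow> ('p, 'n::ab_group_add, 'k, 'y) lincat_scheme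
    \<Rightarrow> ('o \<Rightarrow> 'p) \<Rightarrow> ('m \<Rightarrow> 'n) \<Rightarrow> bool" where
  "linear_functor C D Fo Fm \<longleftrightarrow>
     (\<forall>x\<in>Obj C. Fo x \<in> Obj D) \<and>
     (\<forall>x\<in>Obj C. \<forall>y\<in>Obj C. \<forall>f\<in>Hom C x y. Fm f \<in> Hom D (Fo x) (Fo y)) \<and>
     (\<forall>x\<in>Obj C. Fm (Idn C x) = Idn D (Fo x)) \<and>
     (\<forall>x\<in>Obj C. \<forall>y\<in>Obj C. \<forall>z\<in>Obj C. \<forall>f\<in>Hom C x y. \<forall>g\<in>Hom C y z.
        Fm (g \<cdot>\<^bsub>C\<^esub> f) = Fm g \<cdot>\<^bsub>D\<^esub> Fm f) \<and>
     (\<forall>x\<in>Obj C. \<forall>y\<in>Obj C. \<forall>f\<in>Hom C x y. \<forall>f'\<in>Hom C x y. Fm (f + f') = Fm f + Fm f') \<and>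
     (\<forall>x\<in>Obj C. \<forall>y\<in>Obj C. \<forall>f\<in>Hom C x y. \<forall>r. Fm (Scale C r f) = Scale D r (Fm f))"

definition bilinear_functor ::
  "('o, 'm::ab_group_add, 'k, 'z) lincat_scheme \<Rightarrow> ('p, 'n::ab_group_add, 'k, 'y) lincat_scheme
    \<Rightarrow> ('q, 'l::ab_group_add, 'k, 'x) lincat_scheme
    \<Rightarrow> ('o \<Rightarrow> 'p \<Rightarrow> 'q) \<Rightarrow> ('m \<Rightarrow> 'n \<Rightarrow> 'l) \<Rightarrow> bool" where
  "bilinear_functor C D E Fo Fm \<longleftrightarrow>
     (\<forall>x\<in>Obj C. \<forall>y\<in>Obj D. Fo x y \<in> Obj E) \<and>
     (\<forall>x\<in>Obj C. \<forall>x'\<in>Obj C. \<forall>f\<in>Hom C x x'. \<forall>y\<in>Obj D. \<forall>y'\<in>Obj D. \<forall>g\<in>Hom D y y'.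
        Fm f g \<in> Hom E (Fo x y) (Fo x' y')) \<and>
     (\<forall>x\<in>Obj C. \<forall>y\<in>Obj D. Fm (Idn C x) (Idn D y) = Idn E (Fo x y)) \<and>
     (\<forall>x\<in>Obj C. \<forall>x'\<in>Obj C. \<forall>x''\<in>Obj C. \<forall>f\<in>Hom C x x'. \<forall>f'\<in>Hom C x' x''.
      \<forall>y\<in>Obj D. \<forall>y'\<in>Obj D. \<forall>y''\<in>Obj D. \<forall>g\<in>Hom D y y'. \<forall>g'\<in>Hom D y' y''.
        Fm (f' \<cdot>\<^bsub>C\<^esub> f) (g' \<cdot>\<^bsub>D\<^esub> g) = Fm f' g' \<cdot>\<^bsub>E\<^esub> Fm f g) \<and>
     (\<forall>x\<in>Obj C. \<forall>x'\<in>Obj C. \<forall>f\<in>Hom C x x'. \<forall>f'\<in>Hom C x x'.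
      \<forall>y\<in>Obj D. \<forall>y'\<in>Obj D. \<forall>g\<in>Hom D y y'. Fm (f + f') g = Fm f g + Fm f' g) \<and>
     (\<forall>x\<in>Obj C. \<forall>x'\<in>Obj C. \<forall>f\<in>Hom C x x'.
      \<forall>y\<in>Obj D. \<forall>y'\<in>Obj D. \<forall>g\<in>Hom D y y'. \<forall>g'\<in>Hom D y y'. Fm f (g + g') = Fm f g + Fm f g') \<and>
     (\<forall>x\<in>Obj C. \<forall>x'\<in>Obj C. \<forall>f\<in>Hom C x x'. \<forall>y\<in>Obj D. \<forall>y'\<in>Obj D. \<forall>g\<in>Hom D y y'. \<forall>r.
        Fm (Scale C r f) g = Scale E r (Fm f g) \<and> Fm f (Scale D r g) = Scale E r (Fm f g))"

definition is_kernel ::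
  "('o, 'm::ab_group_add, 'k, 'z) lincat_scheme \<Rightarrow> 'o \<Rightarrow> 'o \<Rightarrow> 'o \<Rightarrow> 'm \<Rightarrow> 'm \<Rightarrow> bool" where
  "is_kernel C x y z f g \<longleftrightarrow> f \<in> Hom C x y \<and> g \<in> Hom C y z \<and> g \<cdot>\<^bsub>C\<^esub> f = 0 \<and>
     (\<forall>w\<in>Obj C. \<forall>h\<in>Hom C w y. g \<cdot>\<^bsub>C\<^esub> h = 0 \<longrightarrow> (\<exists>!u. u \<in> Hom C w x \<and> f \<cdot>\<^bsub>C\<^esub> u = h))"

definition is_cokernel ::
  "('o, 'm::ab_group_add, 'k, 'z) lincat_scheme \<Rightarrow> 'o \<Rightarrow> 'o \<Rightarrow> 'o \<Rightarrow> 'm \<Rightarrow> 'm \<Rightarrow> bool" where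
  "is_cokernel C x y z f g \<longleftrightarrow> f \<in> Hom C x y \<and> g \<in> Hom C y z \<and> g \<cdot>\<^bsub>C\<^esub> f = 0 \<and>
     (\<forall>w\<in>Obj C. \<forall>h\<in>Hom C y w. h \<cdot>\<^bsub>C\<^esub> f = 0 \<longrightarrow> (\<exists>!u. u \<in> Hom C z w \<and> u \<cdot>\<^bsub>C\<^esub> g = h))"

definition short_exact ::
  "('o, 'm::ab_group_add, 'k, 'z) lincat_scheme \<Rightarrow> 'o \<Rightarrow> 'o \<Rightarrow> 'o \<Rightarrow> 'm \<Rightarrow> 'm \<Rightarrow> bool" where
  "short_exact C x y z f g \<longleftrightarrow> is_kernel C x y z f g \<and> is_cokernel C x y z f g"

definition exact_functor ::
  "('o, 'm::ab_group_add, 'k, 'z) lincat_scheme \<Rightarrow> ('p, 'n::ab_group_add, 'k, 'y) lincat_scheme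
    \<Rightarrow> ('o \<Rightarrow> 'p) \<Rightarrow> ('m \<Rightarrow> 'n) \<Rightarrow> bool" where
  "exact_functor C D Fo Fm \<longleftrightarrow>
     (\<forall>x\<in>Obj C. \<forall>y\<in>Obj C. \<forall>z\<in>Obj C. \<forall>f g. short_exact C x y z f g \<longrightarrow>
        short_exact D (Fo x) (Fo y) (Fo z) (Fm f) (Fm g))"


section \<open>Finite linear categories\<close>

text \<open>
  A finite-dimensional algebra is realised on the space of column vectors of some length, a
  finite-dimensional left module over it as a matrix representation; every finite-dimensional
  algebra and module is isomorphic to one of this form.
\<close>

definition fd_algebra :: "nat \<Rightarrow> ('k::field vec \<Rightarrow> 'k vec \<Rightarrow> 'k vec) \<Rightarrow> 'k vec \<Rightarrow> bool" where
  "fd_algebra d mul e \<longleftrightarrow> e \<in> carrier_vec d \<and>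
     (\<forall>a\<in>carrier_vec d. \<forall>b\<in>carrier_vec d. mul a b \<in> carrier_vec d) \<and>
     (\<forall>a\<in>carrier_vec d. \<forall>a'\<in>carrier_vec d. \<forall>b\<in>carrier_vec d.
        mul (a + a') b = mul a b + mul a' b \<and> mul b (a + a') = mul b a + mul b a') \<and>
     (\<forall>a\<in>carrier_vec d. \<forall>b\<in>carrier_vec d. \<forall>r.
        mul (r \<cdot>\<^sub>v a) b = r \<cdot>\<^sub>v mul a b \<and> mul a (r \<cdot>\<^sub>v b) = r \<cdot>\<^sub>v mul a b) \<and>
     (\<forall>a\<in>carrier_vec d. \<forall>b\<in>carrier_vec d. \<forall>c\<in>carrier_vec d. mul (mul a b) c = mul a (mul b c)) \<and>
     (\<forall>a\<in>carrier_vec d. mul e a = a \<and> mul a e = a)"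

definition fd_module ::
  "nat \<Rightarrow> ('k::field vec \<Rightarrow> 'k vec \<Rightarrow> 'k vec) \<Rightarrow> 'k vec \<Rightarrow> nat \<Rightarrow> ('k vec \<Rightarrow> 'k mat) \<Rightarrow> bool" where
  "fd_module d mul e n \<rho> \<longleftrightarrow>
     (\<forall>a\<in>carrier_vec d. \<rho> a \<in> carrier_mat n n) \<and>
     (\<forall>a\<in>carrier_vec d. \<forall>b\<in>carrier_vec d. \<rho> (a + b) = \<rho> a + \<rho> b) \<and>
     (\<forall>a\<in>carrier_vec d. \<forall>r. \<rho> (r \<cdot>\<^sub>v a) = r \<cdot>\<^sub>m \<rho> a) \<and>
     (\<forall>a\<in>carrier_vec d. \<forall>b\<in>carrier_vec d. \<rho> (mul a b) = \<rho> a * \<rho> b) \<and>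
     \<rho> e = 1\<^sub>m n"

definition module_homs ::
  "nat \<Rightarrow> nat \<Rightarrow> ('k::field vec \<Rightarrow> 'k mat) \<Rightarrow> nat \<Rightarrow> ('k vec \<Rightarrow> 'k mat) \<Rightarrow> 'k mat set" where
  "module_homs d n \<rho> n' \<rho>' =
     {X \<in> carrier_mat n' n. \<forall>a\<in>carrier_vec d. X * \<rho> a = \<rho>' a * X}"

text \<open>
  The functor below, given by \<open>dm\<close>, \<open>rep\<close> on objects and by \<open>F x y\<close> on morphisms from \<open>x\<close> to \<open>y\<close>,
  is linear, fully faithful and essentially surjective.
\<close>

definition equivalent_to_modules ::
  "('o, 'm::ab_group_add, 'k::field, 'z) lincat_scheme
    \<Rightarrow> nat \<Rightarrow> ('k vec \<Rightarrow> 'k vec \<Rightarrow> 'k vec) \<Rightarrow> 'k vec \<Rightarrow> bool" where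
  "equivalent_to_modules C d mul e \<longleftrightarrow>
     (\<exists>(dm :: 'o \<Rightarrow> nat) (rep :: 'o \<Rightarrow> 'k vec \<Rightarrow> 'k mat) (F :: 'o \<Rightarrow> 'o \<Rightarrow> 'm \<Rightarrow> 'k mat).
        (\<forall>x\<in>Obj C. fd_module d mul e (dm x) (rep x)) \<and>
        (\<forall>x\<in>Obj C. F x x (Idn C x) = 1\<^sub>m (dm x)) \<and>
        (\<forall>x\<in>Obj C. \<forall>y\<in>Obj C. \<forall>z\<in>Obj C. \<forall>f\<in>Hom C x y. \<forall>g\<in>Hom C y z.
           F x z (g \<cdot>\<^bsub>C\<^esub> f) = F y z g * F x y f) \<and>
        (\<forall>x\<in>Obj C. \<forall>y\<in>Obj C. \<forall>f\<in>Hom C x y. \<forall>g\<in>Hom C x y. F x y (f + g) = F x y f + F x y g) \<and>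
        (\<forall>x\<in>Obj C. \<forall>y\<in>Obj C. \<forall>f\<in>Hom C x y. \<forall>r. F x y (Scale C r f) = r \<cdot>\<^sub>m F x y f) \<and>
        (\<forall>x\<in>Obj C. \<forall>y\<in>Obj C.
           bij_betw (F x y) (Hom C x y) (module_homs d (dm x) (rep x) (dm y) (rep y))) \<and>
        (\<forall>n \<rho>. fd_module d mul e n \<rho> \<longrightarrow>
           (\<exists>x\<in>Obj C. \<exists>P\<in>module_homs d (dm x) (rep x) n \<rho>. \<exists>Q\<in>module_homs d n \<rho> (dm x) (rep x).
              Q * P = 1\<^sub>m (dm x) \<and> P * Q = 1\<^sub>m n)))"

locale finite_linear_category = linear_category C
  for C :: "('o, 'm::ab_group_add, 'k::field, 'z) lincat_scheme" (structure) +
  assumes finite_linear: "\<exists>d mul e. fd_algebra d mul e \<and> equivalent_to_modules C d mul e"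


section \<open>Finite tensor categories\<close>

text \<open>
  \<open>assoc a b c\<close> goes from \<open>(a \<otimes> b) \<otimes> c\<close> to \<open>a \<otimes> (b \<otimes> c)\<close>, \<open>lunit a\<close> from \<open>1 \<otimes> a\<close> to \<open>a\<close> and
  \<open>runit a\<close> from \<open>a \<otimes> 1\<close> to \<open>a\<close>. A choice of right and left duals is part of the data of a rigid
  category.
\<close>

record ('o, 'm, 'k) moncat = "('o, 'm, 'k) lincat" +
  tenso :: "'o \<Rightarrow> 'o \<Rightarrow> 'o"  (infixr \<open>\<otimes>\<^sub>o\<index>\<close> 70)
  tensm :: "'m \<Rightarrow> 'm \<Rightarrow> 'm"  (infixr \<open>\<otimes>\<^sub>m\<index>\<close> 70)
  Unit :: "'o"
  assoc :: "'o \<Rightarrow> 'o \<Rightarrow> 'o \<Rightarrow> 'm"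
  lunit :: "'o \<Rightarrow> 'm"
  runit :: "'o \<Rightarrow> 'm"

record ('o, 'm, 'k) rigidcat = "('o, 'm, 'k) moncat" +
  rdual :: "'o \<Rightarrow> 'o"
  rev :: "'o \<Rightarrow> 'm"
  rcoev :: "'o \<Rightarrow> 'm"
  ldual :: "'o \<Rightarrow> 'o"
  lev :: "'o \<Rightarrow> 'm"
  lcoev :: "'o \<Rightarrow> 'm"

locale linear_monoidal_category = linear_category A
  for A :: "('a, 'f::ab_group_add, 'k::field, 'z) moncat_scheme" (structure) +
  assumes tensor_bilinear: "bilinear_functor A A A (tenso A) (tensm A)"
    and unit_obj: "Unit A \<in> Obj A"
    and assoc_iso: "\<lbrakk>a \<in> Obj A; b \<in> Obj A; c \<in> Obj A\<rbrakk>
          \<Longrightarrow> is_iso A ((a \<otimes>\<^sub>o b) \<otimes>\<^sub>o c) (a \<otimes>\<^sub>o (b \<otimes>\<^sub>o c)) (assoc A a b c)"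
    and assoc_natural: "\<lbrakk>a \<in> Obj A; b \<in> Obj A; c \<in> Obj A; a' \<in> Obj A; b' \<in> Obj A; c' \<in> Obj A;
          f \<in> Hom A a a'; g \<in> Hom A b b'; h \<in> Hom A c c'\<rbrakk>
          \<Longrightarrow> assoc A a' b' c' \<cdot> ((f \<otimes>\<^sub>m g) \<otimes>\<^sub>m h) = (f \<otimes>\<^sub>m (g \<otimes>\<^sub>m h)) \<cdot> assoc A a b c"
    and lunit_iso: "a \<in> Obj A \<Longrightarrow> is_iso A (Unit A \<otimes>\<^sub>o a) a (lunit A a)"
    and lunit_natural: "\<lbrakk>a \<in> Obj A; a' \<in> Obj A; f \<in> Hom A a a'\<rbrakk>
          \<Longrightarrow> lunit A a' \<cdot> (Idn A (Unit A) \<otimes>\<^sub>m f) = f \<cdot> lunit A a"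
    and runit_iso: "a \<in> Obj A \<Longrightarrow> is_iso A (a \<otimes>\<^sub>o Unit A) a (runit A a)"
    and runit_natural: "\<lbrakk>a \<in> Obj A; a' \<in> Obj A; f \<in> Hom A a a'\<rbrakk>
          \<Longrightarrow> runit A a' \<cdot> (f \<otimes>\<^sub>m Idn A (Unit A)) = f \<cdot> runit A a"
    and pentagon: "\<lbrakk>a \<in> Obj A; b \<in> Obj A; c \<in> Obj A; d \<in> Obj A\<rbrakk>
          \<Longrightarrow> (Idn A a \<otimes>\<^sub>m assoc A b c d) \<cdot> assoc A a (b \<otimes>\<^sub>o c) d \<cdot> (assoc A a b c \<otimes>\<^sub>m Idn A d)
            = assoc A a b (c \<otimes>\<^sub>o d) \<cdot> assoc A (a \<otimes>\<^sub>o b) c d"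
    and triangle: "\<lbrakk>a \<in> Obj A; b \<in> Obj A\<rbrakk>
          \<Longrightarrow> (Idn A a \<otimes>\<^sub>m lunit A b) \<cdot> assoc A a (Unit A) b = runit A a \<otimes>\<^sub>m Idn A b"

text \<open>
  \<open>dual_pair A c X e h\<close>: the morphisms \<open>e\<close> from \<open>X \<otimes> c\<close> to \<open>1\<close> and \<open>h\<close> from \<open>1\<close> to \<open>c \<otimes> X\<close> make \<open>X\<close>
  a right dual of \<open>c\<close>, equivalently \<open>c\<close> a left dual of \<open>X\<close>.
\<close>

definition dual_pair ::
  "('a, 'f::ab_group_add, 'k, 'z) moncat_scheme \<Rightarrow> 'a \<Rightarrow> 'a \<Rightarrow> 'f \<Rightarrow> 'f \<Rightarrow> bool" where
  "dual_pair A c X e h \<longleftrightarrow>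
     X \<in> Obj A \<and> c \<in> Obj A \<and>
     e \<in> Hom A (X \<otimes>\<^sub>o\<^bsub>A\<^esub> c) (Unit A) \<and> h \<in> Hom A (Unit A) (c \<otimes>\<^sub>o\<^bsub>A\<^esub> X) \<and>
     runit A c \<cdot>\<^bsub>A\<^esub> (Idn A c \<otimes>\<^sub>m\<^bsub>A\<^esub> e) \<cdot>\<^bsub>A\<^esub> assoc A c X c \<cdot>\<^bsub>A\<^esub> (h \<otimes>\<^sub>m\<^bsub>A\<^esub> Idn A c)
       \<cdot>\<^bsub>A\<^esub> inv_mor A (lunit A c) = Idn A c \<and>
     lunit A X \<cdot>\<^bsub>A\<^esub> (e \<otimes>\<^sub>m\<^bsub>A\<^esub> Idn A X) \<cdot>\<^bsub>A\<^esub> inv_mor A (assoc A X c X) \<cdot>\<^bsub>A\<^esub> (Idn A X \<otimes>\<^sub>m\<^bsub>A\<^esub> h)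
       \<cdot>\<^bsub>A\<^esub> inv_mor A (runit A X) = Idn A X"

locale finite_tensor_category =
  finite_linear_category A + linear_monoidal_category A
  for A :: "('a, 'f::ab_group_add, 'k::field, 'z) rigidcat_scheme" (structure) +
  assumes right_dual: "c \<in> Obj A \<Longrightarrow> dual_pair A c (rdual A c) (rev A c) (rcoev A c)"
    and left_dual: "c \<in> Obj A \<Longrightarrow> dual_pair A (ldual A c) c (lev A c) (lcoev A c)"
    and end_unit: "bij_betw (\<lambda>r. Scale A r (Idn A (Unit A))) UNIV (Hom A (Unit A) (Unit A))"


section \<open>The double dual functors\<close>

text \<open>
  For \<open>f\<close> from \<open>c\<close> to \<open>d\<close>, a coevaluation \<open>h\<close> from \<open>1\<close> to \<open>c \<otimes> X\<close> and an evaluation \<open>e\<close> from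
  \<open>Y \<otimes> d\<close> to \<open>1\<close>, the transposed morphism from \<open>Y\<close> to \<open>X\<close>; and its mirror image, with \<open>h\<close> from \<open>1\<close>
  to \<open>X \<otimes> c\<close> and \<open>e\<close> from \<open>d \<otimes> Y\<close> to \<open>1\<close>.
\<close>

definition rmate ::
  "('a, 'f::ab_group_add, 'k, 'z) moncat_scheme \<Rightarrow> 'a \<Rightarrow> 'a \<Rightarrow> 'a \<Rightarrow> 'f \<Rightarrow> 'f \<Rightarrow> 'f \<Rightarrow> 'f" where
  "rmate A d X Y e h f =
     lunit A X \<cdot>\<^bsub>A\<^esub> (e \<otimes>\<^sub>m\<^bsub>A\<^esub> Idn A X) \<cdot>\<^bsub>A\<^esub> inv_mor A (assoc A Y d X)
       \<cdot>\<^bsub>A\<^esub> (Idn A Y \<otimes>\<^sub>m\<^bsub>A\<^esub> (f \<otimes>\<^sub>m\<^bsub>A\<^esub> Idn A X)) \<cdot>\<^bsub>A\<^esub> (Idn A Y \<otimes>\<^sub>m\<^bsub>A\<^esub> h)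
       \<cdot>\<^bsub>A\<^esub> inv_mor A (runit A Y)"

definition lmate ::
  "('a, 'f::ab_group_add, 'k, 'z) moncat_scheme \<Rightarrow> 'a \<Rightarrow> 'a \<Rightarrow> 'a \<Rightarrow> 'f \<Rightarrow> 'f \<Rightarrow> 'f \<Rightarrow> 'f" where
  "lmate A d X Y e h f =
     runit A X \<cdot>\<^bsub>A\<^esub> (Idn A X \<otimes>\<^sub>m\<^bsub>A\<^esub> e) \<cdot>\<^bsub>A\<^esub> assoc A X d Y
       \<cdot>\<^bsub>A\<^esub> ((Idn A X \<otimes>\<^sub>m\<^bsub>A\<^esub> f) \<otimes>\<^sub>m\<^bsub>A\<^esub> Idn A Y) \<cdot>\<^bsub>A\<^esub> (h \<otimes>\<^sub>m\<^bsub>A\<^esub> Idn A Y)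
       \<cdot>\<^bsub>A\<^esub> inv_mor A (lunit A Y)"

definition rdualm :: "('a, 'f::ab_group_add, 'k, 'z) rigidcat_scheme \<Rightarrow> 'f \<Rightarrow> 'f" where
  "rdualm A f = (THE g. \<exists>c\<in>Obj A. \<exists>d\<in>Obj A. f \<in> Hom A c d \<and>
     g = rmate A d (rdual A c) (rdual A d) (rev A d) (rcoev A c) f)"

definition ldualm :: "('a, 'f::ab_group_add, 'k, 'z) rigidcat_scheme \<Rightarrow> 'f \<Rightarrow> 'f" where
  "ldualm A f = (THE g. \<exists>c\<in>Obj A. \<exists>d\<in>Obj A. f \<in> Hom A c d \<and>
     g = lmate A d (ldual A c) (ldual A d) (lev A d) (lcoev A c) f)"

text \<open>
  If \<open>X\<close> and \<open>Y\<close> are right duals of \<open>a\<close> and \<open>b\<close>, then \<open>Y \<otimes> X\<close> is a right dual of \<open>a \<otimes> b\<close> by the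
  following morphisms from \<open>(Y \<otimes> X) \<otimes> (a \<otimes> b)\<close> to \<open>1\<close> and from \<open>1\<close> to \<open>(a \<otimes> b) \<otimes> (Y \<otimes> X)\<close>.
\<close>

definition tens_ev ::
  "('a, 'f::ab_group_add, 'k, 'z) moncat_scheme \<Rightarrow> 'a \<Rightarrow> 'a \<Rightarrow> 'a \<Rightarrow> 'a \<Rightarrow> 'f \<Rightarrow> 'f \<Rightarrow> 'f" where
  "tens_ev A a b X Y eX eY =
     eY \<cdot>\<^bsub>A\<^esub> (Idn A Y \<otimes>\<^sub>m\<^bsub>A\<^esub> lunit A b) \<cdot>\<^bsub>A\<^esub> (Idn A Y \<otimes>\<^sub>m\<^bsub>A\<^esub> (eX \<otimes>\<^sub>m\<^bsub>A\<^esub> Idn A b))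
       \<cdot>\<^bsub>A\<^esub> (Idn A Y \<otimes>\<^sub>m\<^bsub>A\<^esub> inv_mor A (assoc A X a b)) \<cdot>\<^bsub>A\<^esub> assoc A Y X (a \<otimes>\<^sub>o\<^bsub>A\<^esub> b)"

definition tens_coev ::
  "('a, 'f::ab_group_add, 'k, 'z) moncat_scheme \<Rightarrow> 'a \<Rightarrow> 'a \<Rightarrow> 'a \<Rightarrow> 'a \<Rightarrow> 'f \<Rightarrow> 'f \<Rightarrow> 'f" where
  "tens_coev A a b X Y hX hY =
     inv_mor A (assoc A a b (Y \<otimes>\<^sub>o\<^bsub>A\<^esub> X)) \<cdot>\<^bsub>A\<^esub> (Idn A a \<otimes>\<^sub>m\<^bsub>A\<^esub> assoc A b Y X)
       \<cdot>\<^bsub>A\<^esub> (Idn A a \<otimes>\<^sub>m\<^bsub>A\<^esub> (hY \<otimes>\<^sub>m\<^bsub>A\<^esub> Idn A X)) \<cdot>\<^bsub>A\<^esub> (Idn A a \<otimes>\<^sub>m\<^bsub>A\<^esub> inv_mor A (lunit A X))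
       \<cdot>\<^bsub>A\<^esub> hX"

text \<open>
  Comparison isomorphisms given by the uniqueness of duals, first from \<open>b* \<otimes> a*\<close> to \<open>(a \<otimes> b)*\<close> and
  from \<open>1\<close> to \<open>1*\<close>, then the resulting monoidal structures of the double duals, from \<open>(a \<otimes> b)**\<close>
  to \<open>a** \<otimes> b**\<close> and from \<open>1**\<close> to \<open>1\<close>; here \<open>*\<close> is the right dual in the definitions whose names
  begin with \<open>r\<close> and the left dual in those whose names begin with \<open>l\<close>.
\<close>

definition rdual_tens :: "('a, 'f::ab_group_add, 'k, 'z) rigidcat_scheme \<Rightarrow> 'a \<Rightarrow> 'a \<Rightarrow> 'f" where
  "rdual_tens A a b =
     rmate A (a \<otimes>\<^sub>o\<^bsub>A\<^esub> b) (rdual A (a \<otimes>\<^sub>o\<^bsub>A\<^esub> b)) (rdual A b \<otimes>\<^sub>o\<^bsub>A\<^esub> rdual A a)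
       (tens_ev A a b (rdual A a) (rdual A b) (rev A a) (rev A b)) (rcoev A (a \<otimes>\<^sub>o\<^bsub>A\<^esub> b))
       (Idn A (a \<otimes>\<^sub>o\<^bsub>A\<^esub> b))"

definition rr_tens :: "('a, 'f::ab_group_add, 'k, 'z) rigidcat_scheme \<Rightarrow> 'a \<Rightarrow> 'a \<Rightarrow> 'f" where
  "rr_tens A a b =
     rmate A (rdual A (a \<otimes>\<^sub>o\<^bsub>A\<^esub> b))
       (rdual A (rdual A a) \<otimes>\<^sub>o\<^bsub>A\<^esub> rdual A (rdual A b)) (rdual A (rdual A (a \<otimes>\<^sub>o\<^bsub>A\<^esub> b)))
       (rev A (rdual A (a \<otimes>\<^sub>o\<^bsub>A\<^esub> b)))
       (tens_coev A (rdual A b) (rdual A a) (rdual A (rdual A b)) (rdual A (rdual A a))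
          (rcoev A (rdual A b)) (rcoev A (rdual A a)))
       (rdual_tens A a b)"

definition rdual_unit :: "('a, 'f::ab_group_add, 'k, 'z) rigidcat_scheme \<Rightarrow> 'f" where
  "rdual_unit A = rmate A (Unit A) (rdual A (Unit A)) (Unit A)
     (lunit A (Unit A)) (rcoev A (Unit A)) (Idn A (Unit A))"

definition rr_unit :: "('a, 'f::ab_group_add, 'k, 'z) rigidcat_scheme \<Rightarrow> 'f" where
  "rr_unit A = rmate A (rdual A (Unit A)) (Unit A) (rdual A (rdual A (Unit A)))
     (rev A (rdual A (Unit A))) (inv_mor A (lunit A (Unit A))) (rdual_unit A)"

definition ldual_tens :: "('a, 'f::ab_group_add, 'k, 'z) rigidcat_scheme \<Rightarrow> 'a \<Rightarrow> 'a \<Rightarrow> 'f" where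
  "ldual_tens A a b =
     lmate A (a \<otimes>\<^sub>o\<^bsub>A\<^esub> b) (ldual A (a \<otimes>\<^sub>o\<^bsub>A\<^esub> b)) (ldual A b \<otimes>\<^sub>o\<^bsub>A\<^esub> ldual A a)
       (tens_ev A (ldual A b) (ldual A a) b a (lev A b) (lev A a)) (lcoev A (a \<otimes>\<^sub>o\<^bsub>A\<^esub> b))
       (Idn A (a \<otimes>\<^sub>o\<^bsub>A\<^esub> b))"

definition ll_tens :: "('a, 'f::ab_group_add, 'k, 'z) rigidcat_scheme \<Rightarrow> 'a \<Rightarrow> 'a \<Rightarrow> 'f" where
  "ll_tens A a b =
     lmate A (ldual A (a \<otimes>\<^sub>o\<^bsub>A\<^esub> b))
       (ldual A (ldual A a) \<otimes>\<^sub>o\<^bsub>A\<^esub> ldual A (ldual A b)) (ldual A (ldual A (a \<otimes>\<^sub>o\<^bsub>A\<^esub> b)))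
       (lev A (ldual A (a \<otimes>\<^sub>o\<^bsub>A\<^esub> b)))
       (tens_coev A (ldual A (ldual A a)) (ldual A (ldual A b)) (ldual A a) (ldual A b)
          (lcoev A (ldual A a)) (lcoev A (ldual A b)))
       (ldual_tens A a b)"

definition ldual_unit :: "('a, 'f::ab_group_add, 'k, 'z) rigidcat_scheme \<Rightarrow> 'f" where
  "ldual_unit A = lmate A (Unit A) (ldual A (Unit A)) (Unit A)
     (lunit A (Unit A)) (lcoev A (Unit A)) (Idn A (Unit A))"

definition ll_unit :: "('a, 'f::ab_group_add, 'k, 'z) rigidcat_scheme \<Rightarrow> 'f" where
  "ll_unit A = lmate A (ldual A (Unit A)) (Unit A) (ldual A (ldual A (Unit A)))
     (lev A (ldual A (Unit A))) (inv_mor A (lunit A (Unit A))) (ldual_unit A)"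


section \<open>Bimodule categories\<close>

text \<open>
  \<open>lassoc a a' m\<close> goes from \<open>(a \<otimes> a').m\<close> to \<open>a.(a'.m)\<close>, \<open>lunitor m\<close> from \<open>1.m\<close> to \<open>m\<close>,
  \<open>rassoc m b b'\<close> from \<open>m.(b \<otimes> b')\<close> to \<open>(m.b).b'\<close>, \<open>runitor m\<close> from \<open>m.1\<close> to \<open>m\<close>, and
  \<open>middle a m b\<close> from \<open>(a.m).b\<close> to \<open>a.(m.b)\<close>.
\<close>

record ('o, 'm, 'k, 'a, 'f, 'b, 'g) bimodcat = "('o, 'm, 'k) lincat" +
  lacto :: "'a \<Rightarrow> 'o \<Rightarrow> 'o"  (infixr \<open>\<rhd>\<^sub>o\<index>\<close> 70)
  lactm :: "'f \<Rightarrow> 'm \<Rightarrow> 'm"  (infixr \<open>\<rhd>\<^sub>m\<index>\<close> 70)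
  lassoc :: "'a \<Rightarrow> 'a \<Rightarrow> 'o \<Rightarrow> 'm"
  lunitor :: "'o \<Rightarrow> 'm"
  racto :: "'o \<Rightarrow> 'b \<Rightarrow> 'o"  (infixl \<open>\<lhd>\<^sub>o\<index>\<close> 70)
  ractm :: "'m \<Rightarrow> 'g \<Rightarrow> 'm"  (infixl \<open>\<lhd>\<^sub>m\<index>\<close> 70)
  rassoc :: "'o \<Rightarrow> 'b \<Rightarrow> 'b \<Rightarrow> 'm"
  runitor :: "'o \<Rightarrow> 'm"
  middle :: "'a \<Rightarrow> 'o \<Rightarrow> 'b \<Rightarrow> 'm"

locale left_module_category =
  A: finite_tensor_category A + finite_linear_category M
  for A :: "('a, 'f::ab_group_add, 'k::field, 'z) rigidcat_scheme"
    and M :: "('o, 'm::ab_group_add, 'k, 'a, 'f, 'b, 'g, 'y) bimodcat_scheme" (structure) +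
  assumes lact_bilinear: "bilinear_functor A M M (lacto M) (lactm M)"
    and lact_exact: "m \<in> Obj M \<Longrightarrow> exact_functor A M (\<lambda>a. a \<rhd>\<^sub>o m) (\<lambda>f. f \<rhd>\<^sub>m Idn M m)"
    and lassoc_iso: "\<lbrakk>a \<in> Obj A; a' \<in> Obj A; m \<in> Obj M\<rbrakk>
          \<Longrightarrow> is_iso M ((a \<otimes>\<^sub>o\<^bsub>A\<^esub> a') \<rhd>\<^sub>o m) (a \<rhd>\<^sub>o (a' \<rhd>\<^sub>o m)) (lassoc M a a' m)"
    and lassoc_natural: "\<lbrakk>a \<in> Obj A; a' \<in> Obj A; m \<in> Obj M; c \<in> Obj A; c' \<in> Obj A; n \<in> Obj M;
          f \<in> Hom A a c; f' \<in> Hom A a' c'; h \<in> Hom M m n\<rbrakk>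
          \<Longrightarrow> lassoc M c c' n \<cdot> ((f \<otimes>\<^sub>m\<^bsub>A\<^esub> f') \<rhd>\<^sub>m h) = (f \<rhd>\<^sub>m (f' \<rhd>\<^sub>m h)) \<cdot> lassoc M a a' m"
    and lunitor_iso: "m \<in> Obj M \<Longrightarrow> is_iso M (Unit A \<rhd>\<^sub>o m) m (lunitor M m)"
    and lunitor_natural: "\<lbrakk>m \<in> Obj M; n \<in> Obj M; h \<in> Hom M m n\<rbrakk>
          \<Longrightarrow> lunitor M n \<cdot> (Idn A (Unit A) \<rhd>\<^sub>m h) = h \<cdot> lunitor M m"
    and lact_pentagon: "\<lbrakk>a \<in> Obj A; b \<in> Obj A; c \<in> Obj A; m \<in> Obj M\<rbrakk>
          \<Longrightarrow> (Idn A a \<rhd>\<^sub>m lassoc M b c m) \<cdot> lassoc M a (b \<otimes>\<^sub>o\<^bsub>A\<^esub> c) m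
                \<cdot> (assoc A a b c \<rhd>\<^sub>m Idn M m)
            = lassoc M a b (c \<rhd>\<^sub>o m) \<cdot> lassoc M (a \<otimes>\<^sub>o\<^bsub>A\<^esub> b) c m"
    and lact_triangle: "\<lbrakk>a \<in> Obj A; m \<in> Obj M\<rbrakk>
          \<Longrightarrow> (Idn A a \<rhd>\<^sub>m lunitor M m) \<cdot> lassoc M a (Unit A) m = runit A a \<rhd>\<^sub>m Idn M m"

locale right_module_category =
  B: finite_tensor_category B + finite_linear_category M
  for B :: "('b, 'g::ab_group_add, 'k::field, 'z) rigidcat_scheme"
    and M :: "('o, 'm::ab_group_add, 'k, 'a, 'f, 'b, 'g, 'y) bimodcat_scheme" (structure) +
  assumes ract_bilinear: "bilinear_functor M B M (racto M) (ractm M)"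
    and ract_exact: "m \<in> Obj M \<Longrightarrow> exact_functor B M (\<lambda>b. m \<lhd>\<^sub>o b) (\<lambda>g. Idn M m \<lhd>\<^sub>m g)"
    and rassoc_iso: "\<lbrakk>m \<in> Obj M; b \<in> Obj B; b' \<in> Obj B\<rbrakk>
          \<Longrightarrow> is_iso M (m \<lhd>\<^sub>o (b \<otimes>\<^sub>o\<^bsub>B\<^esub> b')) ((m \<lhd>\<^sub>o b) \<lhd>\<^sub>o b') (rassoc M m b b')"
    and rassoc_natural: "\<lbrakk>m \<in> Obj M; b \<in> Obj B; b' \<in> Obj B; n \<in> Obj M; c \<in> Obj B; c' \<in> Obj B;
          h \<in> Hom M m n; g \<in> Hom B b c; g' \<in> Hom B b' c'\<rbrakk>
          \<Longrightarrow> rassoc M n c c' \<cdot> (h \<lhd>\<^sub>m (g \<otimes>\<^sub>m\<^bsub>B\<^esub> g')) = ((h \<lhd>\<^sub>m g) \<lhd>\<^sub>m g') \<cdot> rassoc M m b b'"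
    and runitor_iso: "m \<in> Obj M \<Longrightarrow> is_iso M (m \<lhd>\<^sub>o Unit B) m (runitor M m)"
    and runitor_natural: "\<lbrakk>m \<in> Obj M; n \<in> Obj M; h \<in> Hom M m n\<rbrakk>
          \<Longrightarrow> runitor M n \<cdot> (h \<lhd>\<^sub>m Idn B (Unit B)) = h \<cdot> runitor M m"
    and ract_pentagon: "\<lbrakk>m \<in> Obj M; a \<in> Obj B; b \<in> Obj B; c \<in> Obj B\<rbrakk>
          \<Longrightarrow> rassoc M (m \<lhd>\<^sub>o a) b c \<cdot> rassoc M m a (b \<otimes>\<^sub>o\<^bsub>B\<^esub> c) \<cdot> (Idn M m \<lhd>\<^sub>m assoc B a b c)
            = (rassoc M m a b \<lhd>\<^sub>m Idn B c) \<cdot> rassoc M m (a \<otimes>\<^sub>o\<^bsub>B\<^esub> b) c"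
    and ract_triangle: "\<lbrakk>m \<in> Obj M; b \<in> Obj B\<rbrakk>
          \<Longrightarrow> (runitor M m \<lhd>\<^sub>m Idn B b) \<cdot> rassoc M m (Unit B) b = Idn M m \<lhd>\<^sub>m lunit B b"

locale bimodule_category = left_module_category A M + right_module_category B M
  for A :: "('a, 'f::ab_group_add, 'k::field, 'z) rigidcat_scheme"
    and B :: "('b, 'g::ab_group_add, 'k, 'x) rigidcat_scheme"
    and M :: "('o, 'm::ab_group_add, 'k, 'a, 'f, 'b, 'g, 'y) bimodcat_scheme" (structure) +
  assumes middle_iso: "\<lbrakk>a \<in> Obj A; m \<in> Obj M; b \<in> Obj B\<rbrakk>
          \<Longrightarrow> is_iso M ((a \<rhd>\<^sub>o m) \<lhd>\<^sub>o b) (a \<rhd>\<^sub>o (m \<lhd>\<^sub>o b)) (middle M a m b)"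
    and middle_natural: "\<lbrakk>a \<in> Obj A; m \<in> Obj M; b \<in> Obj B; a' \<in> Obj A; m' \<in> Obj M; b' \<in> Obj B;
          f \<in> Hom A a a'; h \<in> Hom M m m'; g \<in> Hom B b b'\<rbrakk>
          \<Longrightarrow> middle M a' m' b' \<cdot> ((f \<rhd>\<^sub>m h) \<lhd>\<^sub>m g) = (f \<rhd>\<^sub>m (h \<lhd>\<^sub>m g)) \<cdot> middle M a m b"
    and middle_pentagon_left: "\<lbrakk>a \<in> Obj A; a' \<in> Obj A; m \<in> Obj M; b \<in> Obj B\<rbrakk>
          \<Longrightarrow> (Idn A a \<rhd>\<^sub>m middle M a' m b) \<cdot> middle M a (a' \<rhd>\<^sub>o m) b \<cdot> (lassoc M a a' m \<lhd>\<^sub>m Idn B b)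
            = lassoc M a a' (m \<lhd>\<^sub>o b) \<cdot> middle M (a \<otimes>\<^sub>o\<^bsub>A\<^esub> a') m b"
    and middle_pentagon_right: "\<lbrakk>a \<in> Obj A; m \<in> Obj M; b \<in> Obj B; b' \<in> Obj B\<rbrakk>
          \<Longrightarrow> middle M a (m \<lhd>\<^sub>o b) b' \<cdot> (middle M a m b \<lhd>\<^sub>m Idn B b') \<cdot> rassoc M (a \<rhd>\<^sub>o m) b b'
            = (Idn A a \<rhd>\<^sub>m rassoc M m b b') \<cdot> middle M a m (b \<otimes>\<^sub>o\<^bsub>B\<^esub> b')"
    and middle_unit_left: "\<lbrakk>m \<in> Obj M; b \<in> Obj B\<rbrakk>
          \<Longrightarrow> lunitor M (m \<lhd>\<^sub>o b) \<cdot> middle M (Unit A) m b = lunitor M m \<lhd>\<^sub>m Idn B b"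
    and middle_unit_right: "\<lbrakk>a \<in> Obj A; m \<in> Obj M\<rbrakk>
          \<Longrightarrow> (Idn A a \<rhd>\<^sub>m runitor M m) \<cdot> middle M a m (Unit B) = runitor M (a \<rhd>\<^sub>o m)"

definition rr_ll ::
  "('a, 'f::ab_group_add, 'k, 'z) rigidcat_scheme \<Rightarrow> ('b, 'g::ab_group_add, 'k, 'x) rigidcat_scheme
    \<Rightarrow> ('o, 'm::ab_group_add, 'k, 'a, 'f, 'b, 'g, 'y) bimodcat_scheme
    \<Rightarrow> ('o, 'm, 'k, 'a, 'f, 'b, 'g, 'y) bimodcat_scheme" where
  "rr_ll A B M = M
     \<lparr> lacto := (\<lambda>a m. rdual A (rdual A a) \<rhd>\<^sub>o\<^bsub>M\<^esub> m),
       lactm := (\<lambda>f h. rdualm A (rdualm A f) \<rhd>\<^sub>m\<^bsub>M\<^esub> h),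
       lassoc := (\<lambda>a a' m. lassoc M (rdual A (rdual A a)) (rdual A (rdual A a')) m
                    \<cdot>\<^bsub>M\<^esub> (rr_tens A a a' \<rhd>\<^sub>m\<^bsub>M\<^esub> Idn M m)),
       lunitor := (\<lambda>m. lunitor M m \<cdot>\<^bsub>M\<^esub> (rr_unit A \<rhd>\<^sub>m\<^bsub>M\<^esub> Idn M m)),
       racto := (\<lambda>m b. m \<lhd>\<^sub>o\<^bsub>M\<^esub> ldual B (ldual B b)),
       ractm := (\<lambda>h g. h \<lhd>\<^sub>m\<^bsub>M\<^esub> ldualm B (ldualm B g)),
       rassoc := (\<lambda>m b b'. rassoc M m (ldual B (ldual B b)) (ldual B (ldual B b'))
                    \<cdot>\<^bsub>M\<^esub> (Idn M m \<lhd>\<^sub>m\<^bsub>M\<^esub> ll_tens B b b')),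
       runitor := (\<lambda>m. runitor M m \<cdot>\<^bsub>M\<^esub> (Idn M m \<lhd>\<^sub>m\<^bsub>M\<^esub> ll_unit B)),
       middle := (\<lambda>a m b. middle M (rdual A (rdual A a)) m (ldual B (ldual B b))) \<rparr>"

text \<open>
  A structure of bimodule functor on \<open>F\<close> consists of isomorphisms \<open>sl a m\<close> from \<open>F (a.m)\<close> to
  \<open>a.F m\<close> and \<open>sr m b\<close> from \<open>F (m.b)\<close> to \<open>F m.b\<close>.
\<close>

definition bimodule_functor ::
  "('a, 'f::ab_group_add, 'k, 'z) rigidcat_scheme \<Rightarrow> ('b, 'g::ab_group_add, 'k, 'x) rigidcat_scheme
    \<Rightarrow> ('o, 'm::ab_group_add, 'k, 'a, 'f, 'b, 'g, 'y) bimodcat_scheme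
    \<Rightarrow> ('p, 'n::ab_group_add, 'k, 'a, 'f, 'b, 'g, 'w) bimodcat_scheme
    \<Rightarrow> ('o \<Rightarrow> 'p) \<Rightarrow> ('m \<Rightarrow> 'n) \<Rightarrow> ('a \<Rightarrow> 'o \<Rightarrow> 'n) \<Rightarrow> ('o \<Rightarrow> 'b \<Rightarrow> 'n) \<Rightarrow> bool" where
  "bimodule_functor A B M N Fo Fm sl sr \<longleftrightarrow>
     linear_functor M N Fo Fm \<and>
     \<comment> \<open>left module functor\<close>
     (\<forall>a\<in>Obj A. \<forall>m\<in>Obj M. is_iso N (Fo (a \<rhd>\<^sub>o\<^bsub>M\<^esub> m)) (a \<rhd>\<^sub>o\<^bsub>N\<^esub> Fo m) (sl a m)) \<and>
     (\<forall>a\<in>Obj A. \<forall>a'\<in>Obj A. \<forall>f\<in>Hom A a a'. \<forall>m\<in>Obj M. \<forall>m'\<in>Obj M. \<forall>h\<in>Hom M m m'.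
        sl a' m' \<cdot>\<^bsub>N\<^esub> Fm (f \<rhd>\<^sub>m\<^bsub>M\<^esub> h) = (f \<rhd>\<^sub>m\<^bsub>N\<^esub> Fm h) \<cdot>\<^bsub>N\<^esub> sl a m) \<and>
     (\<forall>a\<in>Obj A. \<forall>a'\<in>Obj A. \<forall>m\<in>Obj M.
        (Idn A a \<rhd>\<^sub>m\<^bsub>N\<^esub> sl a' m) \<cdot>\<^bsub>N\<^esub> sl a (a' \<rhd>\<^sub>o\<^bsub>M\<^esub> m) \<cdot>\<^bsub>N\<^esub> Fm (lassoc M a a' m)
          = lassoc N a a' (Fo m) \<cdot>\<^bsub>N\<^esub> sl (a \<otimes>\<^sub>o\<^bsub>A\<^esub> a') m) \<and>
     (\<forall>m\<in>Obj M. lunitor N (Fo m) \<cdot>\<^bsub>N\<^esub> sl (Unit A) m = Fm (lunitor M m)) \<and>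
     \<comment> \<open>right module functor\<close>
     (\<forall>m\<in>Obj M. \<forall>b\<in>Obj B. is_iso N (Fo (m \<lhd>\<^sub>o\<^bsub>M\<^esub> b)) (Fo m \<lhd>\<^sub>o\<^bsub>N\<^esub> b) (sr m b)) \<and>
     (\<forall>m\<in>Obj M. \<forall>m'\<in>Obj M. \<forall>h\<in>Hom M m m'. \<forall>b\<in>Obj B. \<forall>b'\<in>Obj B. \<forall>g\<in>Hom B b b'.
        sr m' b' \<cdot>\<^bsub>N\<^esub> Fm (h \<lhd>\<^sub>m\<^bsub>M\<^esub> g) = (Fm h \<lhd>\<^sub>m\<^bsub>N\<^esub> g) \<cdot>\<^bsub>N\<^esub> sr m b) \<and>
     (\<forall>m\<in>Obj M. \<forall>b\<in>Obj B. \<forall>b'\<in>Obj B.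
        (sr m b \<lhd>\<^sub>m\<^bsub>N\<^esub> Idn B b') \<cdot>\<^bsub>N\<^esub> sr (m \<lhd>\<^sub>o\<^bsub>M\<^esub> b) b' \<cdot>\<^bsub>N\<^esub> Fm (rassoc M m b b')
          = rassoc N (Fo m) b b' \<cdot>\<^bsub>N\<^esub> sr m (b \<otimes>\<^sub>o\<^bsub>B\<^esub> b')) \<and>
     (\<forall>m\<in>Obj M. runitor N (Fo m) \<cdot>\<^bsub>N\<^esub> sr m (Unit B) = Fm (runitor M m)) \<and>
     \<comment> \<open>compatibility of the two structures\<close>
     (\<forall>a\<in>Obj A. \<forall>m\<in>Obj M. \<forall>b\<in>Obj B.
        middle N a (Fo m) b \<cdot>\<^bsub>N\<^esub> (sl a m \<lhd>\<^sub>m\<^bsub>N\<^esub> Idn B b) \<cdot>\<^bsub>N\<^esub> sr (a \<rhd>\<^sub>o\<^bsub>M\<^esub> m) b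
          = (Idn A a \<rhd>\<^sub>m\<^bsub>N\<^esub> sr m b) \<cdot>\<^bsub>N\<^esub> sl a (m \<lhd>\<^sub>o\<^bsub>M\<^esub> b) \<cdot>\<^bsub>N\<^esub> Fm (middle M a m b))"


section \<open>The Nakayama functor\<close>

text \<open>
  \<open>T\<close> with \<open>\<beta>\<close> is the tensor product of the vector spaces \<open>V\<close> and \<open>W\<close>: the linear map induced by
  \<open>\<beta>\<close> on the free vector space on \<open>V \<times> W\<close> is onto \<open>T\<close>, and its kernel is spanned by the bilinearity
  relations.
\<close>

definition bilinearity_relations ::
  "('k::field \<Rightarrow> 'v::ab_group_add \<Rightarrow> 'v) \<Rightarrow> 'v set \<Rightarrow> ('k \<Rightarrow> 'w::ab_group_add \<Rightarrow> 'w) \<Rightarrow> 'w set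
    \<Rightarrow> (('v \<times> 'w) \<Rightarrow>\<^sub>0 'k) set" where
  "bilinearity_relations sV V sW W =
     {Poly_Mapping.single (v + v', w) 1 - Poly_Mapping.single (v, w) 1 - Poly_Mapping.single (v', w) 1
        | v v' w. v \<in> V \<and> v' \<in> V \<and> w \<in> W}
   \<union> {Poly_Mapping.single (v, w + w') 1 - Poly_Mapping.single (v, w) 1 - Poly_Mapping.single (v, w') 1
        | v w w'. v \<in> V \<and> w \<in> W \<and> w' \<in> W}
   \<union> {Poly_Mapping.single (sV r v, w) 1 - Poly_Mapping.single (v, w) r | r v w. v \<in> V \<and> w \<in> W}
   \<union> {Poly_Mapping.single (v, sW r w) 1 - Poly_Mapping.single (v, w) r | r v w. v \<in> V \<and> w \<in> W}"

definition free_extension ::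
  "('k::field \<Rightarrow> 't::ab_group_add \<Rightarrow> 't) \<Rightarrow> ('v \<Rightarrow> 'w \<Rightarrow> 't) \<Rightarrow> (('v \<times> 'w) \<Rightarrow>\<^sub>0 'k) \<Rightarrow> 't" where
  "free_extension sT \<beta> p = (\<Sum>q\<in>Poly_Mapping.keys p. sT (Poly_Mapping.lookup p q) (\<beta> (fst q) (snd q)))"

definition is_tensor_product ::
  "('k::field \<Rightarrow> 'v::ab_group_add \<Rightarrow> 'v) \<Rightarrow> 'v set \<Rightarrow> ('k \<Rightarrow> 'w::ab_group_add \<Rightarrow> 'w) \<Rightarrow> 'w set
    \<Rightarrow> ('k \<Rightarrow> 't::ab_group_add \<Rightarrow> 't) \<Rightarrow> 't set \<Rightarrow> ('v \<Rightarrow> 'w \<Rightarrow> 't) \<Rightarrow> bool" where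
  "is_tensor_product sV V sW W sT T \<beta> \<longleftrightarrow>
     free_extension sT \<beta> ` {p. Poly_Mapping.keys p \<subseteq> V \<times> W} = T \<and>
     {p. Poly_Mapping.keys p \<subseteq> V \<times> W \<and> free_extension sT \<beta> p = 0}
       = module.span (\<lambda>r. Poly_Mapping.map ((*) r)) (bilinearity_relations sV V sW W)"

text \<open>
  \<open>t\<close> is the object \<open>V \<otimes> m\<close>; the natural isomorphism from \<open>V \<otimes> Hom n m\<close> to \<open>Hom n t\<close> sends
  \<open>v \<otimes> f\<close> to \<open>\<beta> v f\<close>.
\<close>

definition is_copower ::
  "('o, 'm::ab_group_add, 'k::field, 'z) lincat_scheme
    \<Rightarrow> ('k \<Rightarrow> 'v::ab_group_add \<Rightarrow> 'v) \<Rightarrow> 'v set \<Rightarrow> 'o \<Rightarrow> 'o \<Rightarrow> ('v \<Rightarrow> 'm \<Rightarrow> 'm) \<Rightarrow> bool" where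
  "is_copower C sV V m t \<beta> \<longleftrightarrow> t \<in> Obj C \<and>
     (\<forall>n\<in>Obj C. is_tensor_product sV V (Scale C) (Hom C n m) (Scale C) (Hom C n t) \<beta>) \<and>
     (\<forall>n\<in>Obj C. \<forall>n'\<in>Obj C. \<forall>h\<in>Hom C n' n. \<forall>f\<in>Hom C n m. \<forall>v\<in>V. \<beta> v (f \<cdot>\<^bsub>C\<^esub> h) = \<beta> v f \<cdot>\<^bsub>C\<^esub> h)"

text \<open>
  A choice of the objects \<open>Hom n x \<otimes> m\<close>: \<open>cpo V m\<close> is \<open>V \<otimes> m\<close> and \<open>cpb V m\<close> its structure map.
\<close>

definition copower_choice ::
  "('o, 'm::ab_group_add, 'k::field, 'z) lincat_scheme
    \<Rightarrow> ('m set \<Rightarrow> 'o \<Rightarrow> 'o) \<Rightarrow> ('m set \<Rightarrow> 'o \<Rightarrow> 'm \<Rightarrow> 'm \<Rightarrow> 'm) \<Rightarrow> bool" where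
  "copower_choice C cpo cpb \<longleftrightarrow>
     (\<forall>n\<in>Obj C. \<forall>x\<in>Obj C. \<forall>m\<in>Obj C.
        is_copower C (Scale C) (Hom C n x) m (cpo (Hom C n x) m) (cpb (Hom C n x) m))"

text \<open>
  The morphism \<open>u \<otimes> g\<close> from \<open>V \<otimes> m\<close> to \<open>V' \<otimes> m'\<close>, for \<open>u\<close> linear from \<open>V\<close> to \<open>V'\<close> and \<open>g\<close> from \<open>m\<close>
  to \<open>m'\<close>: the one that induces \<open>v \<otimes> f \<mapsto> u v \<otimes> g \<cdot> f\<close> under the natural isomorphisms.
\<close>

definition copower_map ::
  "('o, 'm::ab_group_add, 'k::field, 'z) lincat_scheme
    \<Rightarrow> ('m set \<Rightarrow> 'o \<Rightarrow> 'o) \<Rightarrow> ('m set \<Rightarrow> 'o \<Rightarrow> 'm \<Rightarrow> 'm \<Rightarrow> 'm)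
    \<Rightarrow> 'm set \<Rightarrow> 'o \<Rightarrow> 'm set \<Rightarrow> 'o \<Rightarrow> ('m \<Rightarrow> 'm) \<Rightarrow> 'm \<Rightarrow> 'm" where
  "copower_map C cpo cpb V m V' m' u g =
     (THE t. t \<in> Hom C (cpo V m) (cpo V' m') \<and>
        (\<forall>n\<in>Obj C. \<forall>f\<in>Hom C n m. \<forall>v\<in>V.
           t \<cdot>\<^bsub>C\<^esub> cpb V m v f = cpb V' m' (u v) (g \<cdot>\<^bsub>C\<^esub> f)))"

text \<open>
  Wedges and ends of a functor \<open>G\<close> that is contravariant in its first and covariant in its second
  argument; \<open>Gm n n' m m' f g\<close> is the value of \<open>G\<close>, from \<open>Go n m\<close> to \<open>Go n' m'\<close>, on \<open>f\<close> from \<open>n'\<close>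
  to \<open>n\<close> and \<open>g\<close> from \<open>m\<close> to \<open>m'\<close>.
\<close>

definition is_wedge ::
  "('o, 'm::ab_group_add, 'k, 'z) lincat_scheme \<Rightarrow> ('p, 'n::ab_group_add, 'k, 'y) lincat_scheme
    \<Rightarrow> ('o \<Rightarrow> 'o \<Rightarrow> 'p) \<Rightarrow> ('o \<Rightarrow> 'o \<Rightarrow> 'o \<Rightarrow> 'o \<Rightarrow> 'm \<Rightarrow> 'm \<Rightarrow> 'n) \<Rightarrow> 'p \<Rightarrow> ('o \<Rightarrow> 'n) \<Rightarrow> bool" where
  "is_wedge C D Go Gm w \<omega> \<longleftrightarrow> w \<in> Obj D \<and> (\<forall>m\<in>Obj C. \<omega> m \<in> Hom D w (Go m m)) \<and>
     (\<forall>n\<in>Obj C. \<forall>m\<in>Obj C. \<forall>f\<in>Hom C n m.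
        Gm m n m m f (Idn C m) \<cdot>\<^bsub>D\<^esub> \<omega> m = Gm n n n m (Idn C n) f \<cdot>\<^bsub>D\<^esub> \<omega> n)"

definition is_end ::
  "('o, 'm::ab_group_add, 'k, 'z) lincat_scheme \<Rightarrow> ('p, 'n::ab_group_add, 'k, 'y) lincat_scheme
    \<Rightarrow> ('o \<Rightarrow> 'o \<Rightarrow> 'p) \<Rightarrow> ('o \<Rightarrow> 'o \<Rightarrow> 'o \<Rightarrow> 'o \<Rightarrow> 'm \<Rightarrow> 'm \<Rightarrow> 'n) \<Rightarrow> 'p \<Rightarrow> ('o \<Rightarrow> 'n) \<Rightarrow> bool" where
  "is_end C D Go Gm e \<pi> \<longleftrightarrow> is_wedge C D Go Gm e \<pi> \<and>
     (\<forall>w \<omega>. is_wedge C D Go Gm w \<omega> \<longrightarrow>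
        (\<exists>!h. h \<in> Hom D w e \<and> (\<forall>m\<in>Obj C. \<pi> m \<cdot>\<^bsub>D\<^esub> h = \<omega> m)))"

text \<open>
  \<open>No\<close>, \<open>Nm\<close> is the functor sending \<open>x\<close> to the end over \<open>m\<close> of \<open>Hom m x \<otimes> m\<close>, with structure
  morphisms \<open>\<pi> x m\<close> from \<open>No x\<close> to \<open>Hom m x \<otimes> m\<close>. Its value on \<open>h\<close> from \<open>x\<close> to \<open>y\<close> is induced by
  postcomposition with \<open>h\<close>.
\<close>

definition is_left_nakayama ::
  "('o, 'm::ab_group_add, 'k::field, 'z) lincat_scheme
    \<Rightarrow> ('m set \<Rightarrow> 'o \<Rightarrow> 'o) \<Rightarrow> ('m set \<Rightarrow> 'o \<Rightarrow> 'm \<Rightarrow> 'm \<Rightarrow> 'm)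
    \<Rightarrow> ('o \<Rightarrow> 'o) \<Rightarrow> ('m \<Rightarrow> 'm) \<Rightarrow> ('o \<Rightarrow> 'o \<Rightarrow> 'm) \<Rightarrow> bool" where
  "is_left_nakayama C cpo cpb No Nm \<pi> \<longleftrightarrow>
     (\<forall>x\<in>Obj C. is_end C C (\<lambda>n m. cpo (Hom C n x) m)
        (\<lambda>n n' m m' f g. copower_map C cpo cpb (Hom C n x) m (Hom C n' x) m' (\<lambda>\<phi>. \<phi> \<cdot>\<^bsub>C\<^esub> f) g)
        (No x) (\<pi> x)) \<and>
     (\<forall>x\<in>Obj C. \<forall>y\<in>Obj C. \<forall>h\<in>Hom C x y. Nm h \<in> Hom C (No x) (No y) \<and>
        (\<forall>m\<in>Obj C. \<pi> y m \<cdot>\<^bsub>C\<^esub> Nm h =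
           copower_map C cpo cpb (Hom C m x) m (Hom C m y) m (\<lambda>\<phi>. h \<cdot>\<^bsub>C\<^esub> \<phi>) (Idn C m) \<cdot>\<^bsub>C\<^esub> \<pi> x m))"

end

theory Submission
  imports Defs
begin

text \<open>
  An action of a rigid category turns an object \<open>a\<close> into an endofunctor \<open>a.\<close> of \<open>M\<close> with a chain of
  adjoints \<open>a\<^sup>\<or>\<^sup>\<or>. \<stileturn> a\<^sup>\<or>. \<stileturn> a.\<close> Reindexing the end defining \<open>N (a.x)\<close> along this chain gives a
  canonical map \<open>\<tau> : a\<^sup>\<or>\<^sup>\<or>. N x \<rightarrow> N (a.x)\<close>, which exists for every triple of endofunctors \<open>G, F, A\<close> with
  \<open>1 \<rightarrow> A F\<close>, \<open>G F \<rightarrow> 1\<close> and \<open>G\<close> left adjoint to \<open>F\<close>. It is natural in the triple and compatible with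
  composition of triples, and this yields all coherence conditions at once. Since \<open>a\<close> has duals of
  all orders, a lax structure is automatically invertible: the inverse of \<open>\<tau>\<close> for \<open>a\<close> is built from
  \<open>\<tau>\<close> for \<open>a\<^sup>\<or>\<close>. A right action is a left action of the reversed monoidal category.
\<close>

section \<open>Arrows\<close>

text \<open>The bijection between \<open>Hom (md n) x\<close> and \<open>Hom n (rt x)\<close> is
  used as a map only, \<open>\<phi> \<mapsto> rt \<phi> \<star> cou n\<close>, and has to be carried
  through a copower and an end. Maps into an end and maps out of a copower are easy to define, so
  \<tau> runs from \<open>lf (No x)\<close> to \<open>No (rt x)\<close>, and \<open>lf\<close> must
  preserve copowers; this is where its being a left adjoint enters. The structure in the theorem
  points the other way and is the inverse of \<tau>.

  The monoidal structure of the double dual is prescribed by formulas in \<open>A\<close>, while the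
  triple of \<open>a \<otimes> b\<close> and the composite of the triples of \<open>a\<close> and
  \<open>b\<close> are only isomorphic. A comparison of triples has one transformation for each
  functor, and here those for \<open>md\<close> and \<open>lf\<close> are the single and the double
  transpose of that for \<open>rt\<close>. So a coherence axiom for one action amounts to this: the
  prescribed morphism of double duals acts as the double transpose of the corresponding constraint.
  Such identities are checked after acting on \<open>M\<close>, where the constraints of
  \<open>A\<close> turn into constraints of the action.\<close>

text \<open>
  Morphisms of a \<open>lincat\<close> do not determine their source and target when they are zero. Arrows record
  both; with \<open>Null\<close> as the composite of non-composable arrows, composition is associative without
  side conditions.
\<close>

datatype ('o, 'm) arrow = Null | Arr (src: 'o) (mor: 'm) (tgt: 'o)

definition arr :: "('o, 'm, 'k, 'z) lincat_scheme \<Rightarrow> ('o, 'm) arrow \<Rightarrow> bool" where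
  "arr C f \<longleftrightarrow> f \<noteq> Null \<and> src f \<in> Obj C \<and> tgt f \<in> Obj C \<and> mor f \<in> Hom C (src f) (tgt f)"

definition cmp :: "('o, 'm, 'k, 'z) lincat_scheme \<Rightarrow> ('o, 'm) arrow \<Rightarrow> ('o, 'm) arrow \<Rightarrow> ('o, 'm) arrow"
    (infixr \<open>\<star>\<index>\<close> 65) where
  "cmp C g f = (if arr C f \<and> arr C g \<and> src g = tgt f then Arr (src f) (mor g \<cdot>\<^bsub>C\<^esub> mor f) (tgt g) else Null)"

definition idt :: "('o, 'm, 'k, 'z) lincat_scheme \<Rightarrow> 'o \<Rightarrow> ('o, 'm) arrow" where
  "idt C x = Arr x (Idn C x) x"

definition homs :: "('o, 'm, 'k, 'z) lincat_scheme \<Rightarrow> 'o \<Rightarrow> 'o \<Rightarrow> ('o, 'm) arrow set" where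
  "homs C x y = {f. arr C f \<and> src f = x \<and> tgt f = y}"

definition plus_arr :: "('o, 'm::plus) arrow \<Rightarrow> ('o, 'm) arrow \<Rightarrow> ('o, 'm) arrow"  (infixl \<open>\<boxplus>\<close> 64) where
  "f \<boxplus> g = Arr (src f) (mor f + mor g) (tgt f)"

definition scale_arr :: "('o, 'm, 'k, 'z) lincat_scheme \<Rightarrow> 'k \<Rightarrow> ('o, 'm) arrow \<Rightarrow> ('o, 'm) arrow" where
  "scale_arr C r f = Arr (src f) (Scale C r (mor f)) (tgt f)"

lemma not_arr_Null [simp]: "\<not> arr C Null"
  by (simp add: arr_def)

lemma arr_Arr [simp]: "arr C (Arr x f y) \<longleftrightarrow> x \<in> Obj C \<and> y \<in> Obj C \<and> f \<in> Hom C x y"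
  by (simp add: arr_def)

lemma arr_src [simp]: "arr C f \<Longrightarrow> src f \<in> Obj C"
  and arr_tgt [simp]: "arr C f \<Longrightarrow> tgt f \<in> Obj C"
  and arr_mor: "arr C f \<Longrightarrow> mor f \<in> Hom C (src f) (tgt f)"
  by (simp_all add: arr_def)

lemma arr_collapse: "arr C f \<Longrightarrow> Arr (src f) (mor f) (tgt f) = f"
  by (cases f) auto

lemma arr_eqI: "arr C f \<Longrightarrow> arr C g \<Longrightarrow> src f = src g \<Longrightarrow> tgt f = tgt g \<Longrightarrow> mor f = mor g \<Longrightarrow> f = g"
  by (metis arr_collapse)

lemma src_idt [simp]: "src (idt C x) = x"
  and tgt_idt [simp]: "tgt (idt C x) = x"
  and mor_idt [simp]: "mor (idt C x) = Idn C x"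
  by (simp_all add: idt_def)

lemma homsD: "f \<in> homs C x y \<Longrightarrow> arr C f" "f \<in> homs C x y \<Longrightarrow> src f = x" "f \<in> homs C x y \<Longrightarrow> tgt f = y"
  by (simp_all add: homs_def)

context linear_category
begin

lemma hom_add: "x \<in> Obj C \<Longrightarrow> y \<in> Obj C \<Longrightarrow> f \<in> Hom C x y \<Longrightarrow> g \<in> Hom C x y \<Longrightarrow> f + g \<in> Hom C x y"
  using hom_subspace vector_space_mor module.subspace_def[of "Scale C"]
  by (metis module_iff_vector_space)

lemma hom_scale: "x \<in> Obj C \<Longrightarrow> y \<in> Obj C \<Longrightarrow> f \<in> Hom C x y \<Longrightarrow> Scale C r f \<in> Hom C x y"
  using hom_subspace vector_space_mor module.subspace_def[of "Scale C"]
  by (metis module_iff_vector_space)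

lemma hom_zero: "x \<in> Obj C \<Longrightarrow> y \<in> Obj C \<Longrightarrow> 0 \<in> Hom C x y"
  using hom_subspace vector_space_mor module.subspace_def[of "Scale C"]
  by (metis module_iff_vector_space)

lemma arr_cmp [simp]: "arr C (g \<star> f) \<longleftrightarrow> arr C f \<and> arr C g \<and> src g = tgt f"
  unfolding cmp_def by (auto intro!: comp_hom[of _ "tgt f"] dest: arr_mor)

lemma src_cmp [simp]: "arr C f \<Longrightarrow> arr C g \<Longrightarrow> src g = tgt f \<Longrightarrow> src (g \<star> f) = src f"
  and tgt_cmp [simp]: "arr C f \<Longrightarrow> arr C g \<Longrightarrow> src g = tgt f \<Longrightarrow> tgt (g \<star> f) = tgt g"
  and mor_cmp: "arr C f \<Longrightarrow> arr C g \<Longrightarrow> src g = tgt f \<Longrightarrow> mor (g \<star> f) = mor g \<cdot> mor f"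
  by (simp_all add: cmp_def)

lemma cmp_assoc [simp]: "(h \<star> g) \<star> f = h \<star> (g \<star> f)"
proof (cases "arr C f \<and> arr C g \<and> arr C h \<and> src g = tgt f \<and> src h = tgt g")
  case True
  then show ?thesis
    by (intro arr_eqI[of C]) (auto simp: mor_cmp intro!: comp_assoc dest: arr_mor)
next
  case False
  have "h \<star> g \<star> f = Null"
    using False by (auto simp: cmp_def[of C h])
  moreover have "(h \<star> g) \<star> f = Null"
    using False by (auto simp: cmp_def[of C _ f])
  ultimately show ?thesis by simp
qed

text \<open>Composites are kept right-nested, so an equation for two factors does not match inside a
  longer composite. With a trailing factor \<open>z\<close> it becomes a usable rewrite rule; hence
  the frequent \<open>THEN cmp_reassoc\<close>.\<close>

lemma cmp_reassoc: "f \<star> g = w \<Longrightarrow> f \<star> (g \<star> z) = w \<star> z"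
  by (metis cmp_assoc)

lemma arr_idt [simp]: "arr C (idt C x) \<longleftrightarrow> x \<in> Obj C"
  by (auto simp: idt_def id_hom)

lemma cmp_idt_left [simp]: "arr C f \<Longrightarrow> tgt f = x \<Longrightarrow> idt C x \<star> f = f"
  by (intro arr_eqI[of C]) (auto simp: mor_cmp comp_id_left[OF _ _ arr_mor])

lemma cmp_idt_right [simp]: "arr C f \<Longrightarrow> src f = x \<Longrightarrow> f \<star> idt C x = f"
  by (intro arr_eqI[of C]) (auto simp: mor_cmp comp_id_right[OF _ _ arr_mor])

lemma cmp_idt_left2 [simp]: "arr C f \<Longrightarrow> tgt f = x \<Longrightarrow> idt C x \<star> f \<star> g = f \<star> g"
  by (metis cmp_idt_left cmp_assoc)

lemma plus_arr_simps [simp]: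
  "arr C f \<Longrightarrow> arr C g \<Longrightarrow> src g = src f \<Longrightarrow> tgt g = tgt f \<Longrightarrow> arr C (f \<boxplus> g)"
  "src (f \<boxplus> g) = src f" "tgt (f \<boxplus> g) = tgt f"
  by (auto simp: plus_arr_def intro!: hom_add dest: arr_mor)

lemma scale_arr_simps [simp]:
  "arr C f \<Longrightarrow> arr C (scale_arr C r f)"
  "src (scale_arr C r f) = src f" "tgt (scale_arr C r f) = tgt f"
  by (auto simp: scale_arr_def intro!: hom_scale dest: arr_mor)

lemma mor_plus: "mor (f \<boxplus> g) = mor f + mor g"
  and mor_scale: "mor (scale_arr C r f) = Scale C r (mor f)"
  by (simp_all add: plus_arr_def scale_arr_def)

lemma cmp_plus_left:
  assumes "arr C f" "arr C g" "arr C g'" "src g = tgt f" "src g' = tgt f" "tgt g' = tgt g"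
  shows "(g \<boxplus> g') \<star> f = g \<star> f \<boxplus> g' \<star> f"
  using assms comp_add_left[of "src f" "tgt f" "tgt g"] arr_mor[of C f] arr_mor[of C g] arr_mor[of C g']
  by (intro arr_eqI[of C]) (auto simp: mor_cmp mor_plus)

lemma cmp_plus_right:
  assumes "arr C f" "arr C f'" "arr C g" "src g = tgt f" "src f' = src f" "tgt f' = tgt f"
  shows "g \<star> (f \<boxplus> f') = g \<star> f \<boxplus> g \<star> f'"
  using assms comp_add_right[of "src f" "tgt f" "tgt g"] arr_mor[of C f] arr_mor[of C g] arr_mor[of C f']
  by (intro arr_eqI[of C]) (auto simp: mor_cmp mor_plus)

lemma cmp_scale_left:
  assumes "arr C f" "arr C g" "src g = tgt f"
  shows "scale_arr C r g \<star> f = scale_arr C r (g \<star> f)"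
  using assms comp_scale_left[of "src f" "tgt f" "tgt g"] arr_mor[of C f] arr_mor[of C g]
  by (intro arr_eqI[of C]) (auto simp: mor_cmp mor_scale)

lemma cmp_scale_right:
  assumes "arr C f" "arr C g" "src g = tgt f"
  shows "g \<star> scale_arr C r f = scale_arr C r (g \<star> f)"
  using assms comp_scale_right[of "src f" "tgt f" "tgt g"] arr_mor[of C f] arr_mor[of C g]
  by (intro arr_eqI[of C]) (auto simp: mor_cmp mor_scale)

lemma is_inverseD:
  assumes "is_inverse C x y f g" "x \<in> Obj C" "y \<in> Obj C"
  shows "Arr x f y \<in> homs C x y" "Arr y g x \<in> homs C y x"
    "Arr y g x \<star> Arr x f y = idt C x" "Arr x f y \<star> Arr y g x = idt C y"
  using assms by (auto simp: is_inverse_def homs_def cmp_def idt_def)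

lemma is_isoI:
  assumes "f \<in> homs C x y" "g \<in> homs C y x" "g \<star> f = idt C x" "f \<star> g = idt C y"
  shows "is_iso C x y (mor f)"
  unfolding is_iso_def is_inverse_def
  using assms by (intro exI[of _ "mor g"])
    (auto simp: homs_def dest: arr_mor, metis mor_cmp mor_idt, metis mor_cmp mor_idt)

lemma inverse_unique:
  assumes "f \<in> homs C x y" "g \<in> homs C y x" "g' \<in> homs C y x" "g \<star> f = idt C x" "f \<star> g' = idt C y"
  shows "g = g'"
proof -
  have "g = g \<star> (f \<star> g')" using assms by (auto simp: homs_def)
  also have "\<dots> = (g \<star> f) \<star> g'" by (simp only: cmp_assoc)
  also have "\<dots> = g'" using assms by (auto simp: homs_def)
  finally show ?thesis .
qed

text \<open>\<open>inv_mor\<close> quantifies over all ends, which a bare morphism determines only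
  when it is nonzero. A zero isomorphism has zero identities at its ends, so every inverse of it is
  zero and the description still denotes one morphism.\<close>

lemma is_inverse_inv_mor:
  assumes xy: "x \<in> Obj C" "y \<in> Obj C" and iso: "is_iso C x y f"
  shows "is_inverse C x y f (inv_mor C f)"
proof -
  obtain g where g: "is_inverse C x y f g" using iso by (auto simp: is_iso_def)
  have "g' = g" if "x' \<in> Obj C" "y' \<in> Obj C" "is_inverse C x' y' f g'" for x' y' g'
  proof (cases "f = 0")
    case False
    then have "x' = x" "y' = y"
      using hom_disjoint[of x' y' x y f] that g xy by (auto simp: is_inverse_def)
    then show ?thesis
      using inverse_unique[of "Arr x f y" x y "Arr y g' x" "Arr y g x"]
        is_inverseD[OF g xy] is_inverseD[OF that(3,1,2)] by auto
  next
    case True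
    have zero_comp: "h \<cdot> 0 = 0" "0 \<cdot> h' = 0"
      if "u \<in> Obj C" "v \<in> Obj C" "w \<in> Obj C" "h \<in> Hom C v w" "h' \<in> Hom C u v" for u v w h h'
      using comp_add_right[of u v w 0 0 h] comp_add_left[of u v w h' 0 0] that
      by (auto simp: hom_zero)
    have "h = 0" if "is_inverse C u v 0 h" "u \<in> Obj C" "v \<in> Obj C" for u v h
    proof -
      have "Idn C u = 0"
        using that zero_comp[of u v u h] by (auto simp: is_inverse_def)
      then have "h = 0 \<cdot> h"
        using that comp_id_left[of v u h] by (auto simp: is_inverse_def)
      then show ?thesis
        using that zero_comp(2)[of v u u "0" h] by (auto simp: is_inverse_def hom_zero)
    qed
    then show ?thesis using that g xy True by blast
  qed
  then have "inv_mor C f = g"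
    unfolding inv_mor_def using g xy by (intro the_equality) blast+
  then show ?thesis using g by simp
qed

lemma iso_arrows:
  assumes "is_iso C x y f" "x \<in> Obj C" "y \<in> Obj C"
  shows "arr C (Arr x f y)" "arr C (Arr y (inv_mor C f) x)"
    "Arr y (inv_mor C f) x \<star> Arr x f y = idt C x" "Arr x f y \<star> Arr y (inv_mor C f) x = idt C y"
  using is_inverseD[OF is_inverse_inv_mor[OF assms(2,3,1)] assms(2,3)] by (simp_all add: homs_def)

end

section \<open>Endofunctors\<close>

text \<open>The second component acts on arrows rather than bare morphisms, so ends stay visible
  even for zero morphisms. Plain functions make composition of functors strictly associative and
  unital.\<close>

datatype ('o, 'm) endo = Endo (ob: "'o \<Rightarrow> 'o") (mp: "('o, 'm) arrow \<Rightarrow> ('o, 'm) arrow")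

definition endofunctor :: "('o, 'm::ab_group_add, 'k, 'z) lincat_scheme \<Rightarrow> ('o, 'm) endo \<Rightarrow> bool" where
  "endofunctor C F \<longleftrightarrow>
     (\<forall>x\<in>Obj C. ob F x \<in> Obj C) \<and>
     (\<forall>f. arr C f \<longrightarrow> mp F f \<in> homs C (ob F (src f)) (ob F (tgt f))) \<and>
     (\<forall>x\<in>Obj C. mp F (idt C x) = idt C (ob F x)) \<and>
     (\<forall>f g. arr C f \<and> arr C g \<and> src g = tgt f \<longrightarrow> mp F (g \<star>\<^bsub>C\<^esub> f) = mp F g \<star>\<^bsub>C\<^esub> mp F f) \<and>
     (\<forall>f g. arr C f \<and> arr C g \<and> src g = src f \<and> tgt g = tgt f \<longrightarrow> mp F (f \<boxplus> g) = mp F f \<boxplus> mp F g) \<and>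
     (\<forall>f r. arr C f \<longrightarrow> mp F (scale_arr C r f) = scale_arr C r (mp F f))"

definition endo_id :: "('o, 'm) endo" where
  "endo_id = Endo (\<lambda>x. x) (\<lambda>f. f)"

definition endo_comp :: "('o, 'm) endo \<Rightarrow> ('o, 'm) endo \<Rightarrow> ('o, 'm) endo" where
  "endo_comp F G = Endo (\<lambda>x. ob F (ob G x)) (\<lambda>f. mp F (mp G f))"

definition nat_tr :: "('o, 'm::ab_group_add, 'k, 'z) lincat_scheme \<Rightarrow> ('o, 'm) endo \<Rightarrow> ('o, 'm) endo
    \<Rightarrow> ('o \<Rightarrow> ('o, 'm) arrow) \<Rightarrow> bool" where
  "nat_tr C F G \<eta> \<longleftrightarrow> (\<forall>x\<in>Obj C. \<eta> x \<in> homs C (ob F x) (ob G x)) \<and>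
     (\<forall>f. arr C f \<longrightarrow> \<eta> (tgt f) \<star>\<^bsub>C\<^esub> mp F f = mp G f \<star>\<^bsub>C\<^esub> \<eta> (src f))"

text \<open>
  In the main example \<open>lf\<close>, \<open>md\<close> and \<open>rt\<close> are the actions of \<open>a\<^sup>\<or>\<^sup>\<or>\<close>, \<open>a\<^sup>\<or>\<close> and \<open>a\<close>. The transformations
  are \<open>cou\<close> from \<open>1\<close> to \<open>rt md\<close>, \<open>eva\<close> from \<open>lf md\<close> to \<open>1\<close> and \<open>uni\<close> from \<open>1\<close> to \<open>md lf\<close>. Only the triangle
  identity needed for \<open>lf\<close> to preserve copowers is part of the definition.
\<close>

datatype ('o, 'm) triple = Triple
  (lf: "('o, 'm) endo") (md: "('o, 'm) endo") (rt: "('o, 'm) endo")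
  (cou: "'o \<Rightarrow> ('o, 'm) arrow") (eva: "'o \<Rightarrow> ('o, 'm) arrow") (uni: "'o \<Rightarrow> ('o, 'm) arrow")

definition is_triple :: "('o, 'm::ab_group_add, 'k, 'z) lincat_scheme \<Rightarrow> ('o, 'm) triple \<Rightarrow> bool" where
  "is_triple C T \<longleftrightarrow> endofunctor C (lf T) \<and> endofunctor C (md T) \<and> endofunctor C (rt T) \<and>
     nat_tr C endo_id (endo_comp (rt T) (md T)) (cou T) \<and>
     nat_tr C (endo_comp (lf T) (md T)) endo_id (eva T) \<and>
     nat_tr C endo_id (endo_comp (md T) (lf T)) (uni T) \<and>
     (\<forall>x\<in>Obj C. eva T (ob (lf T) x) \<star>\<^bsub>C\<^esub> mp (lf T) (uni T x) = idt C (ob (lf T) x))"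

definition triple_id :: "('o, 'm::ab_group_add, 'k, 'z) lincat_scheme \<Rightarrow> ('o, 'm) triple" where
  "triple_id C = Triple endo_id endo_id endo_id (idt C) (idt C) (idt C)"

text \<open>Adjoints compose in the opposite order, hence \<open>md T\<close> after
  \<open>md S\<close>; units and counits are nested in the usual way. For triples of actions this is
  the triple of a tensor product up to the associativity constraint.\<close>

definition triple_comp :: "('o, 'm::ab_group_add, 'k, 'z) lincat_scheme
    \<Rightarrow> ('o, 'm) triple \<Rightarrow> ('o, 'm) triple \<Rightarrow> ('o, 'm) triple" where
  "triple_comp C S T = Triple (endo_comp (lf S) (lf T)) (endo_comp (md T) (md S)) (endo_comp (rt S) (rt T))
     (\<lambda>x. mp (rt S) (cou T (ob (md S) x)) \<star>\<^bsub>C\<^esub> cou S x)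
     (\<lambda>x. eva S x \<star>\<^bsub>C\<^esub> mp (lf S) (eva T (ob (md S) x)))
     (\<lambda>x. mp (md T) (uni S (ob (lf T) x)) \<star>\<^bsub>C\<^esub> uni T x)"

lemma endo_simps [simp]:
  "ob endo_id x = x" "mp endo_id f = f"
  "ob (endo_comp F G) x = ob F (ob G x)" "mp (endo_comp F G) f = mp F (mp G f)"
  by (simp_all add: endo_id_def endo_comp_def)

lemma endofunctorD:
  assumes "endofunctor C F"
  shows "x \<in> Obj C \<Longrightarrow> ob F x \<in> Obj C"
    "arr C f \<Longrightarrow> arr C (mp F f)"
    "arr C f \<Longrightarrow> src (mp F f) = ob F (src f)"
    "arr C f \<Longrightarrow> tgt (mp F f) = ob F (tgt f)"
    "x \<in> Obj C \<Longrightarrow> mp F (idt C x) = idt C (ob F x)"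
    "arr C f \<Longrightarrow> arr C g \<Longrightarrow> src g = tgt f \<Longrightarrow> mp F (g \<star>\<^bsub>C\<^esub> f) = mp F g \<star>\<^bsub>C\<^esub> mp F f"
    "arr C f \<Longrightarrow> arr C g \<Longrightarrow> src g = src f \<Longrightarrow> tgt g = tgt f \<Longrightarrow> mp F (f \<boxplus> g) = mp F f \<boxplus> mp F g"
    "arr C f \<Longrightarrow> mp F (scale_arr C r f) = scale_arr C r (mp F f)"
  using assms by (auto simp: endofunctor_def homs_def)

lemma nat_trD:
  assumes "nat_tr C F G \<eta>"
  shows "x \<in> Obj C \<Longrightarrow> \<eta> x \<in> homs C (ob F x) (ob G x)"
    "x \<in> Obj C \<Longrightarrow> arr C (\<eta> x)" "x \<in> Obj C \<Longrightarrow> src (\<eta> x) = ob F x" "x \<in> Obj C \<Longrightarrow> tgt (\<eta> x) = ob G x"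
    "arr C f \<Longrightarrow> \<eta> (tgt f) \<star>\<^bsub>C\<^esub> mp F f = mp G f \<star>\<^bsub>C\<^esub> \<eta> (src f)"
  using assms by (auto simp: nat_tr_def homs_def)

lemma is_tripleD:
  assumes "is_triple C T"
  shows "endofunctor C (lf T)" "endofunctor C (md T)" "endofunctor C (rt T)"
    "nat_tr C endo_id (endo_comp (rt T) (md T)) (cou T)"
    "nat_tr C (endo_comp (lf T) (md T)) endo_id (eva T)"
    "nat_tr C endo_id (endo_comp (md T) (lf T)) (uni T)"
  using assms by (simp_all add: is_triple_def)

lemma tripleD:
  assumes "is_triple C T"
  shows "endofunctor C (lf T)" "endofunctor C (md T)" "endofunctor C (rt T)"
    "x \<in> Obj C \<Longrightarrow> arr C (cou T x)" "x \<in> Obj C \<Longrightarrow> src (cou T x) = x"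
    "x \<in> Obj C \<Longrightarrow> tgt (cou T x) = ob (rt T) (ob (md T) x)"
    "x \<in> Obj C \<Longrightarrow> arr C (eva T x)" "x \<in> Obj C \<Longrightarrow> src (eva T x) = ob (lf T) (ob (md T) x)"
    "x \<in> Obj C \<Longrightarrow> tgt (eva T x) = x"
    "x \<in> Obj C \<Longrightarrow> arr C (uni T x)" "x \<in> Obj C \<Longrightarrow> src (uni T x) = x"
    "x \<in> Obj C \<Longrightarrow> tgt (uni T x) = ob (md T) (ob (lf T) x)"
    "x \<in> Obj C \<Longrightarrow> eva T (ob (lf T) x) \<star>\<^bsub>C\<^esub> mp (lf T) (uni T x) = idt C (ob (lf T) x)"
  using assms endofunctorD(1) nat_trD[OF is_tripleD(4)[OF assms]] nat_trD[OF is_tripleD(5)[OF assms]]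
    nat_trD[OF is_tripleD(6)[OF assms]]
  by (auto simp: is_triple_def)

lemma triple_natural:
  assumes "is_triple C T" and "arr C f" and "src f = x" and "tgt f = y"
  shows "cou T y \<star>\<^bsub>C\<^esub> f = mp (rt T) (mp (md T) f) \<star>\<^bsub>C\<^esub> cou T x"
    "eva T y \<star>\<^bsub>C\<^esub> mp (lf T) (mp (md T) f) = f \<star>\<^bsub>C\<^esub> eva T x"
    "uni T y \<star>\<^bsub>C\<^esub> f = mp (md T) (mp (lf T) f) \<star>\<^bsub>C\<^esub> uni T x"
  using assms nat_trD(5)[OF is_tripleD(4)[OF assms(1)], of f] nat_trD(5)[OF is_tripleD(5)[OF assms(1)], of f]
    nat_trD(5)[OF is_tripleD(6)[OF assms(1)], of f]
  by auto

lemma triple_id_simps [simp]: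
  "lf (triple_id C) = endo_id" "md (triple_id C) = endo_id" "rt (triple_id C) = endo_id"
  "cou (triple_id C) = idt C" "eva (triple_id C) = idt C" "uni (triple_id C) = idt C"
  by (simp_all add: triple_id_def)

lemma triple_comp_simps [simp]:
  "lf (triple_comp C S T) = endo_comp (lf S) (lf T)"
  "md (triple_comp C S T) = endo_comp (md T) (md S)"
  "rt (triple_comp C S T) = endo_comp (rt S) (rt T)"
  "cou (triple_comp C S T) x = mp (rt S) (cou T (ob (md S) x)) \<star>\<^bsub>C\<^esub> cou S x"
  "eva (triple_comp C S T) x = eva S x \<star>\<^bsub>C\<^esub> mp (lf S) (eva T (ob (md S) x))"
  "uni (triple_comp C S T) x = mp (md T) (uni S (ob (lf T) x)) \<star>\<^bsub>C\<^esub> uni T x"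
  by (simp_all add: triple_comp_def)

context linear_category
begin

lemmas endofunctor_simps [simp] = endofunctorD[of C]
lemmas triple_simps [simp] = tripleD[of C]

lemma endofunctor_id [simp]: "endofunctor C endo_id"
  by (auto simp: endofunctor_def homs_def)

lemma endofunctor_comp [simp]: "endofunctor C F \<Longrightarrow> endofunctor C G \<Longrightarrow> endofunctor C (endo_comp F G)"
  by (simp add: endofunctor_def[of C "endo_comp F G"] homs_def)

lemma is_triple_id: "is_triple C (triple_id C)"
  by (auto simp: is_triple_def nat_tr_def homs_def)

lemma is_triple_comp:
  assumes S: "is_triple C S" and T: "is_triple C T"
  shows "is_triple C (triple_comp C S T)"
proof -
  note [simp] = S T
  have "mp (rt S) (cou T (ob (md S) (tgt f))) \<star> cou S (tgt f) \<star> f =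
     mp (rt S) (mp (rt T) (mp (md T) (mp (md S) f))) \<star> mp (rt S) (cou T (ob (md S) (src f))) \<star> cou S (src f)"
    if f: "arr C f" for f
  proof -
    have "cou T (ob (md S) (tgt f)) \<star> mp (md S) f
        = mp (rt T) (mp (md T) (mp (md S) f)) \<star> cou T (ob (md S) (src f))"
      by (rule triple_natural[OF T]) (use f in simp_all)
    from arg_cong[OF this, of "mp (rt S)"] show ?thesis
      using f triple_natural(1)[OF S f] by (simp flip: cmp_assoc)
  qed
  moreover have "eva S (tgt f) \<star> mp (lf S) (eva T (ob (md S) (tgt f))) \<star>
         mp (lf S) (mp (lf T) (mp (md T) (mp (md S) f))) =
     f \<star> eva S (src f) \<star> mp (lf S) (eva T (ob (md S) (src f)))"
    if f: "arr C f" for f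
  proof -
    have "eva T (ob (md S) (tgt f)) \<star> mp (lf T) (mp (md T) (mp (md S) f))
        = mp (md S) f \<star> eva T (ob (md S) (src f))"
      by (rule triple_natural[OF T]) (use f in simp_all)
    from arg_cong[OF this, of "mp (lf S)"] show ?thesis
      using f triple_natural(2)[OF S f] by (simp) (simp flip: cmp_assoc)
  qed
  moreover have "mp (md T) (uni S (ob (lf T) (tgt f))) \<star> uni T (tgt f) \<star> f =
     mp (md T) (mp (md S) (mp (lf S) (mp (lf T) f))) \<star> mp (md T) (uni S (ob (lf T) (src f))) \<star> uni T (src f)"
    if f: "arr C f" for f
  proof -
    have "uni S (ob (lf T) (tgt f)) \<star> mp (lf T) f
        = mp (md S) (mp (lf S) (mp (lf T) f)) \<star> uni S (ob (lf T) (src f))"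
      by (rule triple_natural(3)[OF S]) (use f in simp_all)
    from arg_cong[OF this, of "mp (md T)"] show ?thesis
      using f triple_natural(3)[OF T f] by (simp flip: cmp_assoc)
  qed
  moreover have "eva S (ob (lf S) (ob (lf T) x)) \<star> mp (lf S) (eva T (ob (md S) (ob (lf S) (ob (lf T) x)))) \<star>
         mp (lf S) (mp (lf T) (mp (md T) (uni S (ob (lf T) x)))) \<star> mp (lf S) (mp (lf T) (uni T x)) =
         idt C (ob (lf S) (ob (lf T) x))"
    if x: "x \<in> Obj C" for x
  proof -
    \<comment> \<open>Naturality of \<open>eva T\<close> at \<open>uni S\<close> separates the two
      adjunctions; the triangle identities of \<open>T\<close> and of \<open>S\<close> then apply
      one after the other.\<close>
    have "eva T (ob (md S) (ob (lf S) (ob (lf T) x))) \<star> mp (lf T) (mp (md T) (uni S (ob (lf T) x)))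
        = uni S (ob (lf T) x) \<star> eva T (ob (lf T) x)"
      by (rule triple_natural[OF T]) (use x in simp_all)
    then have "eva T (ob (md S) (ob (lf S) (ob (lf T) x))) \<star> mp (lf T) (mp (md T) (uni S (ob (lf T) x)))
        \<star> mp (lf T) (uni T x) = uni S (ob (lf T) x)"
      using x by (simp add: cmp_reassoc)
    from arg_cong[OF this, of "mp (lf S)"] show ?thesis
      using x by simp
  qed
  ultimately show ?thesis
    by (simp add: is_triple_def[of C "triple_comp C S T"] nat_tr_def homs_def)
qed

end

section \<open>Copowers\<close>

lemma lookup_scale_map: "Poly_Mapping.lookup (Poly_Mapping.map ((*) r) p) k = (r::'k::field) * Poly_Mapping.lookup p k"
  by (simp add: Poly_Mapping.map.rep_eq when_def)

lemma module_poly_mapping: "Modules.module (\<lambda>r::'k::field. Poly_Mapping.map ((*) r) :: ('a \<Rightarrow>\<^sub>0 'k) \<Rightarrow> 'a \<Rightarrow>\<^sub>0 'k)"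
  by unfold_locales (auto intro!: poly_mapping_eqI simp: lookup_scale_map lookup_add algebra_simps)

section \<open>Linear extension from the free vector space on pairs\<close>

context vector_space
begin

text \<open>Keys may cancel in a sum, so \<open>p\<close>, \<open>q\<close> and \<open>p + q\<close>
  are summed over one common finite set; additivity is then a termwise statement.\<close>

lemma free_extension_superset:
  assumes "finite S" and "Poly_Mapping.keys p \<subseteq> S"
  shows "free_extension scale \<beta> p = (\<Sum>q\<in>S. scale (Poly_Mapping.lookup p q) (\<beta> (fst q) (snd q)))"
  unfolding free_extension_def using assms
  by (intro sum.mono_neutral_left) (auto simp: in_keys_iff)

lemma free_extension_add: "free_extension scale \<beta> (p + q) = free_extension scale \<beta> p + free_extension scale \<beta> q"
proof -
  let ?S = "Poly_Mapping.keys p \<union> Poly_Mapping.keys q"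
  show ?thesis
    using free_extension_superset[of ?S "p + q" \<beta>] free_extension_superset[of ?S p \<beta>]
      free_extension_superset[of ?S q \<beta>] Poly_Mapping.keys_add[of p q]
    by (simp add: lookup_add scale_left_distrib sum.distrib)
qed

lemma free_extension_zero: "free_extension scale \<beta> 0 = 0"
  by (simp add: free_extension_def)

lemma free_extension_diff: "free_extension scale \<beta> (p - q) = free_extension scale \<beta> p - free_extension scale \<beta> q"
  using free_extension_add[of \<beta> "p - q" q] by simp

lemma free_extension_single: "free_extension scale \<beta> (Poly_Mapping.single (v, w) r) = scale r (\<beta> v w)"
  using free_extension_superset[of "{(v, w)}" "Poly_Mapping.single (v, w) r" \<beta>] by simp

lemma free_extension_map: "free_extension scale \<beta> (Poly_Mapping.map ((*) r) p) = scale r (free_extension scale \<beta> p)"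
proof -
  have "Poly_Mapping.keys (Poly_Mapping.map ((*) r) p) \<subseteq> Poly_Mapping.keys p"
    by (auto simp: in_keys_iff lookup_scale_map)
  then show ?thesis
    using free_extension_superset[of "Poly_Mapping.keys p"]
    by (simp add: lookup_scale_map scale_sum_right)
qed

lemma subspace_free_extension_kernel:
  "module.subspace (\<lambda>r. Poly_Mapping.map ((*) r)) {p. free_extension scale \<beta> p = 0}"
  by (subst Modules.module.subspace_def[OF module_poly_mapping])
    (simp add: free_extension_add free_extension_map free_extension_zero)

lemma free_extension_sum: "finite I \<Longrightarrow> free_extension scale \<beta> (\<Sum>i\<in>I. p i) = (\<Sum>i\<in>I. free_extension scale \<beta> (p i))"
  by (induction I rule: finite_induct) (auto simp: free_extension_add free_extension_zero)

end

definition bilinear_on :: "('k::field \<Rightarrow> 'v::ab_group_add \<Rightarrow> 'v) \<Rightarrow> 'v set \<Rightarrow> ('k \<Rightarrow> 'w::ab_group_add \<Rightarrow> 'w) \<Rightarrow> 'w set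
    \<Rightarrow> ('k \<Rightarrow> 't::ab_group_add \<Rightarrow> 't) \<Rightarrow> ('v \<Rightarrow> 'w \<Rightarrow> 't) \<Rightarrow> bool" where
  "bilinear_on sV V sW W sT \<gamma> \<longleftrightarrow>
     (\<forall>v\<in>V. \<forall>v'\<in>V. \<forall>w\<in>W. \<gamma> (v + v') w = \<gamma> v w + \<gamma> v' w) \<and>
     (\<forall>v\<in>V. \<forall>w\<in>W. \<forall>w'\<in>W. \<gamma> v (w + w') = \<gamma> v w + \<gamma> v w') \<and>
     (\<forall>v\<in>V. \<forall>w\<in>W. \<forall>r. \<gamma> (sV r v) w = sT r (\<gamma> v w) \<and> \<gamma> v (sW r w) = sT r (\<gamma> v w))"

lemma ball_Collect3: "(\<forall>p\<in>{f x y z | x y z. P x y z}. Q p) \<longleftrightarrow> (\<forall>x y z. P x y z \<longrightarrow> Q (f x y z))"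
  by blast

text \<open>The free extension of \<gamma> sends each generating relation to the defect of one
  bilinearity equation.\<close>

lemma bilinear_on_kernel:
  assumes "vector_space sT"
  shows "bilinear_on sV V sW W sT \<gamma> \<longleftrightarrow> (\<forall>p\<in>bilinearity_relations sV V sW W. free_extension sT \<gamma> p = 0)"
proof -
  interpret vector_space sT by fact
  have 1: "(\<forall>p\<in>bilinearity_relations sV V sW W. free_extension sT \<gamma> p = 0) \<longleftrightarrow>
      (\<forall>v\<in>V. \<forall>v'\<in>V. \<forall>w\<in>W. \<gamma> (v + v') w - \<gamma> v w - \<gamma> v' w = 0) \<and>
     (\<forall>v\<in>V. \<forall>w\<in>W. \<forall>w'\<in>W. \<gamma> v (w + w') - \<gamma> v w - \<gamma> v w' = 0) \<and>
     (\<forall>v\<in>V. \<forall>w\<in>W. \<forall>r. \<gamma> (sV r v) w - sT r (\<gamma> v w) = 0) \<and>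
     (\<forall>v\<in>V. \<forall>w\<in>W. \<forall>r. \<gamma> v (sW r w) - sT r (\<gamma> v w) = 0)" (is "?L \<longleftrightarrow> ?R")
    unfolding bilinearity_relations_def ball_Un ball_Collect3
    by (simp only: free_extension_diff free_extension_single scale_one imp_conjL[symmetric] conj_assoc) blast
  show ?thesis unfolding 1 bilinear_on_def by (auto simp: algebra_simps)
qed

lemma tensor_product_bilinear:
  assumes "vector_space sT" and T: "is_tensor_product sV V sW W sT T \<beta>"
  shows "bilinear_on sV V sW W sT \<beta>"
proof -
  have "p \<in> {p. Poly_Mapping.keys p \<subseteq> V \<times> W \<and> free_extension sT \<beta> p = 0}"
    if "p \<in> bilinearity_relations sV V sW W" for p
    using T Modules.module.span_base[OF module_poly_mapping that] unfolding is_tensor_product_def by blast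
  then show ?thesis unfolding bilinear_on_kernel[OF assms(1)] by blast
qed

text \<open>Stands in for the linear map on \<open>T\<close> induced by \<gamma>, and is stated on
  representatives since no such map is constructed. The difference \<open>p - q\<close> lies in the
  span of the bilinearity relations, all of which the extension of \<gamma> annihilates.\<close>

lemma tensor_product_lift:
  assumes "vector_space sT" "vector_space sZ" and T: "is_tensor_product sV V sW W sT T \<beta>"
    and bil: "bilinear_on sV V sW W sZ \<gamma>"
    and "Poly_Mapping.keys p \<subseteq> V \<times> W" "Poly_Mapping.keys q \<subseteq> V \<times> W"
    and eq: "free_extension sT \<beta> p = free_extension sT \<beta> q"
  shows "free_extension sZ \<gamma> p = free_extension sZ \<gamma> q"
proof -
  interpret T: vector_space sT by fact
  interpret Z: vector_space sZ by fact
  have "Poly_Mapping.keys (p - q) \<subseteq> V \<times> W"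
    using assms(5,6) Poly_Mapping.keys_diff[of p q] by blast
  then have "p - q \<in> module.span (\<lambda>r. Poly_Mapping.map ((*) r)) (bilinearity_relations sV V sW W)"
    using T eq unfolding is_tensor_product_def by (auto simp: T.free_extension_diff)
  moreover have "module.span (\<lambda>r. Poly_Mapping.map ((*) r)) (bilinearity_relations sV V sW W)
      \<subseteq> {p. free_extension sZ \<gamma> p = 0}"
    using bil bilinear_on_kernel[OF assms(2)]
    by (intro Modules.module.span_minimal[OF module_poly_mapping _ Z.subspace_free_extension_kernel]) blast
  ultimately show ?thesis
    by (auto simp: Z.free_extension_diff)
qed

section \<open>Universal property of \<open>V \<otimes> m\<close> for morphisms out of it\<close>

context linear_category
begin

definition linear_on :: "'o \<Rightarrow> 'o \<Rightarrow> (('o, 'm) arrow \<Rightarrow> ('o, 'm) arrow) \<Rightarrow> 'o \<Rightarrow> 'o \<Rightarrow> bool" where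
  "linear_on n x u m s \<longleftrightarrow> (\<forall>f\<in>homs C n x. u f \<in> homs C m s) \<and>
     (\<forall>f\<in>homs C n x. \<forall>g\<in>homs C n x. u (f \<boxplus> g) = u f \<boxplus> u g) \<and>
     (\<forall>f\<in>homs C n x. \<forall>r. u (scale_arr C r f) = scale_arr C r (u f))"

lemma homs_sum:
  assumes "x \<in> Obj C" "y \<in> Obj C" "\<And>i. i \<in> I \<Longrightarrow> f i \<in> Hom C x y"
  shows "(\<Sum>i\<in>I. f i) \<in> Hom C x y"
  using assms(3) by (induction I rule: infinite_finite_induct) (auto simp: assms hom_zero hom_add)

lemma comp_sum_left:
  assumes "x \<in> Obj C" "y \<in> Obj C" "z \<in> Obj C" "\<And>i. i \<in> I \<Longrightarrow> g i \<in> Hom C y z" "f \<in> Hom C x y"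
  shows "(\<Sum>i\<in>I. g i) \<cdot> f = (\<Sum>i\<in>I. g i \<cdot> f)"
proof -
  have "0 \<cdot> f = 0" using comp_add_left[of x y z f 0 0] assms by (simp add: hom_zero)
  then show ?thesis
    using assms(4) by (induction I rule: infinite_finite_induct)
      (auto simp: assms comp_add_left[OF assms(1-3,5)] homs_sum)
qed

lemma comp_sum_right:
  assumes "x \<in> Obj C" "y \<in> Obj C" "z \<in> Obj C" "\<And>i. i \<in> I \<Longrightarrow> f i \<in> Hom C x y" "g \<in> Hom C y z"
  shows "g \<cdot> (\<Sum>i\<in>I. f i) = (\<Sum>i\<in>I. g \<cdot> f i)"
proof -
  have "g \<cdot> 0 = 0" using comp_add_right[of x y z 0 0 g] assms by (simp add: hom_zero)
  then show ?thesis
    using assms(4) by (induction I rule: infinite_finite_induct)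
      (auto simp: assms comp_add_right[OF assms(1-3) _ _ assms(5)] homs_sum)
qed

text \<open>A Yoneda argument. The defining isomorphism describes morphisms into \<open>t\<close>;
  applied to the identity of \<open>t\<close> it writes that identity as a combination of terms
  \<open>\<beta> v f\<close> with \<open>f\<close> from \<open>t\<close> to \<open>m\<close>, and
  this forces the value of \<open>k\<close>.\<close>

lemma copower_universal:
  assumes cp: "is_copower C sV V m t \<beta>" and m: "m \<in> Obj C" and s: "s \<in> Obj C"
    and U: "\<And>v. v \<in> V \<Longrightarrow> U v \<in> Hom C m s"
    and U_add: "\<And>v v'. v \<in> V \<Longrightarrow> v' \<in> V \<Longrightarrow> U (v + v') = U v + U v'"
    and U_scale: "\<And>v r. v \<in> V \<Longrightarrow> U (sV r v) = Scale C r (U v)"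
  shows "\<exists>!k. k \<in> Hom C t s \<and> (\<forall>v\<in>V. k \<cdot> \<beta> v (Idn C m) = U v)"
proof -
  interpret vector_space "Scale C" by (rule vector_space_mor)
  have t: "t \<in> Obj C" and T: "\<And>n. n \<in> Obj C \<Longrightarrow>
      is_tensor_product sV V (Scale C) (Hom C n m) (Scale C) (Hom C n t) \<beta>"
    and nat: "\<And>n n' h f v. n \<in> Obj C \<Longrightarrow> n' \<in> Obj C \<Longrightarrow> h \<in> Hom C n' n \<Longrightarrow> f \<in> Hom C n m \<Longrightarrow> v \<in> V \<Longrightarrow>
      \<beta> v (f \<cdot> h) = \<beta> v f \<cdot> h"
    using cp by (auto simp: is_copower_def)
  have \<beta>: "\<beta> v f \<in> Hom C n t" if "n \<in> Obj C" "v \<in> V" "f \<in> Hom C n m" for n v f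
  proof -
    have "free_extension (Scale C) \<beta> (Poly_Mapping.single (v, f) 1) \<in> Hom C n t"
      using T[OF that(1)] that unfolding is_tensor_product_def by auto
    then show ?thesis by (simp add: free_extension_single)
  qed
  obtain p where p: "Poly_Mapping.keys p \<subseteq> V \<times> Hom C t m"
    and id_p: "Idn C t = free_extension (Scale C) \<beta> p"
    using T[OF t] id_hom[OF t] unfolding is_tensor_product_def by blast
  let ?I = "Poly_Mapping.keys p" and ?r = "Poly_Mapping.lookup p"
  have I: "fst q \<in> V" "snd q \<in> Hom C t m" if "q \<in> ?I" for q
    using p that by auto
  have nat_id: "\<beta> v f = \<beta> v (Idn C m) \<cdot> f" if "n \<in> Obj C" "f \<in> Hom C n m" "v \<in> V" for n v f
    using nat[of m n f "Idn C m" v] that m by (simp add: id_hom comp_id_left)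
  have expand: "k = (\<Sum>q\<in>?I. Scale C (?r q) (k \<cdot> \<beta> (fst q) (Idn C m) \<cdot> snd q))" if k: "k \<in> Hom C t s" for k
  proof -
    have "k = k \<cdot> Idn C t" using k s t by (simp add: comp_id_right)
    also have "\<dots> = (\<Sum>q\<in>?I. k \<cdot> Scale C (?r q) (\<beta> (fst q) (snd q)))"
      unfolding id_p free_extension_def using I s t k \<beta>
      by (intro comp_sum_right[of t t s]) (auto intro!: hom_scale)
    also have "\<dots> = (\<Sum>q\<in>?I. Scale C (?r q) (k \<cdot> \<beta> (fst q) (Idn C m) \<cdot> snd q))"
      by (intro sum.cong refl, subst comp_scale_right[OF t t s])
        (simp_all add: I k \<beta>[OF t] flip: nat_id[OF t])
    finally show ?thesis .
  qed
  \<comment> \<open>The only candidate: the right side of \<open>expand\<close> with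
    \<open>k \<cdot> \<beta> v (Idn C m)\<close> replaced by \<open>U v\<close>.\<close>
  define k where "k = (\<Sum>q\<in>?I. Scale C (?r q) (U (fst q) \<cdot> snd q))"
  have k: "k \<in> Hom C t s"
    unfolding k_def using I s t m U by (intro homs_sum hom_scale) (auto intro!: comp_hom[of t m s])
  have kU: "k \<cdot> \<beta> v (Idn C m) = U v" if v: "v \<in> V" for v
  proof -
    define i where "i = \<beta> v (Idn C m)"
    have i: "i \<in> Hom C m t" using \<beta> m v by (simp add: i_def id_hom)
    \<comment> \<open>\<open>p'\<close> arises by precomposing the expansion of the identity of
      \<open>t\<close> with \<open>i\<close>. It represents the same element \<open>i\<close> of
      \<open>Hom C m t\<close> as the single tensor of \<open>v\<close> with the identity of
      \<open>m\<close>, so the bilinear map \<open>?B\<close> has the same extension on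
      both.\<close>
    define p' where "p' = (\<Sum>q\<in>?I. Poly_Mapping.single (fst q, snd q \<cdot> i) (?r q))"
    let ?B = "\<lambda>v f. U v \<cdot> f"
    have fe_p': "free_extension (Scale C) \<gamma> p' = (\<Sum>q\<in>?I. Scale C (?r q) (\<gamma> (fst q) (snd q \<cdot> i)))" for \<gamma>
      unfolding p'_def by (simp add: free_extension_sum free_extension_single)
    have "free_extension (Scale C) ?B p' = free_extension (Scale C) ?B (Poly_Mapping.single (v, Idn C m) 1)"
    proof (rule tensor_product_lift[OF vector_space_mor vector_space_mor T[OF m]])
      show "bilinear_on sV V (Scale C) (Hom C m m) (Scale C) ?B"
        using U U_add U_scale m s
        by (auto simp: bilinear_on_def comp_add_left[of m m s] comp_add_right[of m m s]
            comp_scale_left[of m m s] comp_scale_right[of m m s])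
      have "Poly_Mapping.keys p' \<subseteq> (\<Union>q\<in>?I. {(fst q, snd q \<cdot> i)})"
        unfolding p'_def by (rule order_trans[OF Poly_Mapping.keys_sum]) (auto split: if_splits)
      also have "\<dots> \<subseteq> V \<times> Hom C m m"
        using I comp_hom[OF m t m i] by auto
      finally show "Poly_Mapping.keys p' \<subseteq> V \<times> Hom C m m" .
      show "Poly_Mapping.keys (Poly_Mapping.single (v, Idn C m) (1::'k)) \<subseteq> V \<times> Hom C m m"
        using v m by (simp add: id_hom)
      have "free_extension (Scale C) \<beta> p' = (\<Sum>q\<in>?I. Scale C (?r q) (\<beta> (fst q) (snd q)) \<cdot> i)"
        unfolding fe_p' using I nat[OF t m i] \<beta>[OF t] comp_scale_left[OF m t t i] by (intro sum.cong) auto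
      also have "\<dots> = Idn C t \<cdot> i"
        unfolding id_p free_extension_def
        using I m t i \<beta> by (intro comp_sum_left[of m t t, symmetric]) (auto intro!: hom_scale)
      finally show "free_extension (Scale C) \<beta> p' = free_extension (Scale C) \<beta> (Poly_Mapping.single (v, Idn C m) 1)"
        using comp_id_left[OF m t i] by (simp add: free_extension_single i_def)
    qed
    then have "(\<Sum>q\<in>?I. Scale C (?r q) (U (fst q) \<cdot> snd q \<cdot> i)) = U v"
      using comp_id_right[OF m s U[OF v]] by (simp add: fe_p' free_extension_single)
    moreover have "k \<cdot> i = (\<Sum>q\<in>?I. Scale C (?r q) (U (fst q) \<cdot> snd q) \<cdot> i)"
      unfolding k_def using I m t s i U
      by (intro comp_sum_left[of m t s] hom_scale) (auto intro!: comp_hom[of t m s])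
    moreover have "Scale C (?r q) (U (fst q) \<cdot> snd q) \<cdot> i = Scale C (?r q) (U (fst q) \<cdot> snd q \<cdot> i)"
      if "q \<in> ?I" for q
      using I[OF that] U m t s i comp_hom[OF t m s I(2)[OF that] U[OF I(1)[OF that]]]
      by (simp add: comp_scale_left[of m t s] comp_assoc[of m t m s])
    ultimately show ?thesis by (simp add: i_def)
  qed
  show ?thesis
  proof (rule ex1I[of _ k])
    show "k \<in> Hom C t s \<and> (\<forall>v\<in>V. k \<cdot> \<beta> v (Idn C m) = U v)" using k kU by blast
    fix k' assume k': "k' \<in> Hom C t s \<and> (\<forall>v\<in>V. k' \<cdot> \<beta> v (Idn C m) = U v)"
    show "k' = k"
    proof -
      have eq: "j \<cdot> \<beta> (fst q) (Idn C m) \<cdot> snd q = U (fst q) \<cdot> snd q"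
        if "q \<in> ?I" "j \<in> Hom C t s" "\<forall>v\<in>V. j \<cdot> \<beta> v (Idn C m) = U v" for j q
        using that I[OF that(1)] m t s \<beta>[OF m] comp_assoc[of t m t s "snd q" "\<beta> (fst q) (Idn C m)" j]
        by (simp add: id_hom)
      show ?thesis
        using expand[of k] expand[of k'] eq k k' kU by simp
    qed
  qed
qed

end

section \<open>Calculus of the chosen copowers in terms of arrows\<close>

locale nakayama = linear_category C
  for C :: "('o, 'm::ab_group_add, 'k::field, 'z) lincat_scheme" (structure) +
  fixes cpo :: "'m set \<Rightarrow> 'o \<Rightarrow> 'o" and cpb :: "'m set \<Rightarrow> 'o \<Rightarrow> 'm \<Rightarrow> 'm \<Rightarrow> 'm"
    and No :: "'o \<Rightarrow> 'o" and Nm :: "'m \<Rightarrow> 'm" and \<pi> :: "'o \<Rightarrow> 'o \<Rightarrow> 'm"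
  assumes choice: "copower_choice C cpo cpb"
    and left_nakayama: "is_left_nakayama C cpo cpb No Nm \<pi>"
begin

definition P :: "'o \<Rightarrow> 'o \<Rightarrow> 'o \<Rightarrow> 'o" where
  "P n x m = cpo (Hom C n x) m"

text \<open>The coprojection from \<open>m\<close> to \<open>Hom n x \<otimes> m\<close> at the
  vector \<phi>. The ends of the arrow \<phi> select the hom-space, and by \<open>cpb_eq\<close> the
  coprojections determine the structure map on all test objects.\<close>

definition inc :: "('o, 'm) arrow \<Rightarrow> 'o \<Rightarrow> ('o, 'm) arrow" where
  "inc \<phi> m = Arr m (cpb (Hom C (src \<phi>) (tgt \<phi>)) m (mor \<phi>) (Idn C m)) (P (src \<phi>) (tgt \<phi>) m)"

definition pr :: "'o \<Rightarrow> 'o \<Rightarrow> ('o, 'm) arrow" where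
  "pr x m = Arr (No x) (\<pi> x m) (P m x m)"

definition Nak :: "('o, 'm) arrow \<Rightarrow> ('o, 'm) arrow" where
  "Nak h = Arr (No (src h)) (Nm (mor h)) (No (tgt h))"

lemma copower: "n \<in> Obj C \<Longrightarrow> x \<in> Obj C \<Longrightarrow> m \<in> Obj C \<Longrightarrow>
    is_copower C (Scale C) (Hom C n x) m (P n x m) (cpb (Hom C n x) m)"
  using choice by (simp add: copower_choice_def P_def)

lemma P_obj [simp]: "n \<in> Obj C \<Longrightarrow> x \<in> Obj C \<Longrightarrow> m \<in> Obj C \<Longrightarrow> P n x m \<in> Obj C"
  using copower by (simp add: is_copower_def)

lemma tensor:
  assumes "n \<in> Obj C" "x \<in> Obj C" "m \<in> Obj C" "l \<in> Obj C"
  shows "is_tensor_product (Scale C) (Hom C n x) (Scale C) (Hom C l m) (Scale C) (Hom C l (P n x m))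
    (cpb (Hom C n x) m)"
  using copower[OF assms(1-3)] assms(4) by (simp add: is_copower_def)

lemma cpb_hom:
  assumes "n \<in> Obj C" "x \<in> Obj C" "m \<in> Obj C" "l \<in> Obj C" "v \<in> Hom C n x" "f \<in> Hom C l m"
  shows "cpb (Hom C n x) m v f \<in> Hom C l (P n x m)"
proof -
  have "free_extension (Scale C) (cpb (Hom C n x) m) (Poly_Mapping.single (v, f) 1) \<in> Hom C l (P n x m)"
    using tensor[OF assms(1-4)] assms(5,6) unfolding is_tensor_product_def by auto
  then show ?thesis
    by (simp add: vector_space.free_extension_single[OF vector_space_mor] vector_space.vector_space_assms(4)[OF vector_space_mor])
qed

text \<open>Naturality in the test object, applied to the identity of \<open>m\<close>.\<close>

lemma cpb_eq:
  assumes "n \<in> Obj C" "x \<in> Obj C" "m \<in> Obj C" "l \<in> Obj C" "v \<in> Hom C n x" "f \<in> Hom C l m"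
  shows "cpb (Hom C n x) m v f = cpb (Hom C n x) m v (Idn C m) \<cdot> f"
  using copower[OF assms(1-3)] assms comp_id_left[OF assms(4,3,6)] id_hom[OF assms(3)]
  unfolding is_copower_def by metis

lemma inc_simps [simp]:
  "arr C \<phi> \<Longrightarrow> m \<in> Obj C \<Longrightarrow> arr C (inc \<phi> m)"
  "src (inc \<phi> m) = m" "tgt (inc \<phi> m) = P (src \<phi>) (tgt \<phi>) m"
  by (auto simp: inc_def intro!: cpb_hom id_hom arr_mor)

lemma mor_inc: "mor (inc \<phi> m) = cpb (Hom C (src \<phi>) (tgt \<phi>)) m (mor \<phi>) (Idn C m)"
  by (simp add: inc_def)

lemma inc_plus:
  assumes "arr C f" "arr C g" "src g = src f" "tgt g = tgt f" "m \<in> Obj C"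
  shows "inc (f \<boxplus> g) m = inc f m \<boxplus> inc g m"
  using tensor_product_bilinear[OF vector_space_mor tensor[of "src f" "tgt f" m m]] assms
    arr_mor[of C f] arr_mor[of C g] id_hom[of m]
  by (simp add: inc_def plus_arr_def bilinear_on_def)

lemma inc_scale:
  assumes "arr C f" "m \<in> Obj C"
  shows "inc (scale_arr C r f) m = scale_arr C r (inc f m)"
  using tensor_product_bilinear[OF vector_space_mor tensor[of "src f" "tgt f" m m]] assms
    arr_mor[of C f] id_hom[of m]
  by (simp add: inc_def scale_arr_def bilinear_on_def)

lemma inc_universal:
  assumes "n \<in> Obj C" "x \<in> Obj C" "m \<in> Obj C" "s \<in> Obj C" and u: "linear_on n x u m s"
  shows "\<exists>!t. t \<in> homs C (P n x m) s \<and> (\<forall>\<phi>\<in>homs C n x. t \<star> inc \<phi> m = u \<phi>)"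
proof -
  let ?U = "\<lambda>v. mor (u (Arr n v x))"
  have arrD: "Arr n v x \<in> homs C n x" if "v \<in> Hom C n x" for v
    using that assms by (simp add: homs_def)
  have "\<exists>!k. k \<in> Hom C (P n x m) s \<and> (\<forall>v\<in>Hom C n x. k \<cdot> cpb (Hom C n x) m v (Idn C m) = ?U v)"
  proof (rule copower_universal[OF copower])
    fix v assume v: "v \<in> Hom C n x"
    show "?U v \<in> Hom C m s"
      using u arrD[OF v] arr_mor[of C "u (Arr n v x)"] by (auto simp: linear_on_def homs_def)
    show "?U (Scale C r v) = Scale C r (?U v)" for r
    proof -
      have "u (scale_arr C r (Arr n v x)) = scale_arr C r (u (Arr n v x))"
        using u arrD[OF v] unfolding linear_on_def by blast
      then show ?thesis by (simp add: scale_arr_def)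
    qed
    fix v' assume v': "v' \<in> Hom C n x"
    have "u (Arr n v x \<boxplus> Arr n v' x) = u (Arr n v x) \<boxplus> u (Arr n v' x)"
      using u arrD[OF v] arrD[OF v'] unfolding linear_on_def by blast
    then show "?U (v + v') = ?U v + ?U v'"
      by (simp add: plus_arr_def)
  qed (use assms in auto)
  then obtain k where k: "k \<in> Hom C (P n x m) s" "\<And>v. v \<in> Hom C n x \<Longrightarrow> k \<cdot> cpb (Hom C n x) m v (Idn C m) = ?U v"
    and uniq: "\<And>k'. k' \<in> Hom C (P n x m) s \<Longrightarrow>
      (\<And>v. v \<in> Hom C n x \<Longrightarrow> k' \<cdot> cpb (Hom C n x) m v (Idn C m) = ?U v) \<Longrightarrow> k' = k"
    by metis
  have coll: "Arr n (mor \<phi>) x = \<phi>" "mor \<phi> \<in> Hom C n x" if "\<phi> \<in> homs C n x" for \<phi>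
    using that arr_collapse[of C \<phi>] arr_mor[of C \<phi>] by (auto simp: homs_def)
  show ?thesis
  proof (intro ex1I[of _ "Arr (P n x m) k s"] conjI ballI)
    show "Arr (P n x m) k s \<in> homs C (P n x m) s"
      using k(1) assms by (simp add: homs_def)
    fix \<phi> assume \<phi>: "\<phi> \<in> homs C n x"
    have u\<phi>: "u \<phi> \<in> homs C m s" using u \<phi> by (auto simp: linear_on_def)
    show "Arr (P n x m) k s \<star> inc \<phi> m = u \<phi>"
      using k(1) k(2)[OF coll(2)[OF \<phi>]] assms u\<phi> coll(1)[OF \<phi>] \<phi>
      by (intro arr_eqI[of C]) (auto simp: homs_def mor_cmp, simp add: inc_def)
  next
    fix t assume t: "t \<in> homs C (P n x m) s \<and> (\<forall>\<phi>\<in>homs C n x. t \<star> inc \<phi> m = u \<phi>)"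
    have "mor t = k"
    proof (rule uniq)
      show "mor t \<in> Hom C (P n x m) s"
        using t by (auto simp: homs_def dest: arr_mor)
      fix v assume v: "v \<in> Hom C n x"
      have "mor (t \<star> inc (Arr n v x) m) = ?U v"
        using t arrD[OF v] by simp
      then show "mor t \<cdot> cpb (Hom C n x) m v (Idn C m) = ?U v"
        using conjunct1[OF t] arrD[OF v] assms by (simp add: homs_def mor_cmp mor_inc)
    qed
    then show "t = Arr (P n x m) k s"
      using t arr_collapse[of C t] by (auto simp: homs_def)
  qed
qed

text \<open>The image \<open>G (V \<otimes> m)\<close> with the images of the coprojections is
  required to have the universal property of \<open>V \<otimes> G m\<close>. In this form morphisms
  out of it can be defined directly, without a comparison isomorphism.\<close>

definition preserves_copowers :: "('o, 'm) endo \<Rightarrow> bool" where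
  "preserves_copowers G \<longleftrightarrow> endofunctor C G \<and> (\<forall>n\<in>Obj C. \<forall>x\<in>Obj C. \<forall>m\<in>Obj C. \<forall>s\<in>Obj C. \<forall>u.
     linear_on n x u (ob G m) s \<longrightarrow>
     (\<exists>!t. t \<in> homs C (ob G (P n x m)) s \<and> (\<forall>\<phi>\<in>homs C n x. t \<star> mp G (inc \<phi> m) = u \<phi>)))"

definition induced :: "('o, 'm) endo \<Rightarrow> 'o \<Rightarrow> 'o \<Rightarrow> 'o \<Rightarrow> 'o \<Rightarrow> (('o, 'm) arrow \<Rightarrow> ('o, 'm) arrow) \<Rightarrow> ('o, 'm) arrow" where
  "induced G n x m s u =
     (THE t. t \<in> homs C (ob G (P n x m)) s \<and> (\<forall>\<phi>\<in>homs C n x. t \<star> mp G (inc \<phi> m) = u \<phi>))"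

lemma preserves_copowers_id [simp]: "preserves_copowers endo_id"
  using inc_universal by (simp add: preserves_copowers_def)

lemma induced_simps [simp]:
  assumes "preserves_copowers G" "n \<in> Obj C" "x \<in> Obj C" "m \<in> Obj C" "s \<in> Obj C"
    "linear_on n x u (ob G m) s"
  shows "arr C (induced G n x m s u)" "src (induced G n x m s u) = ob G (P n x m)"
    "tgt (induced G n x m s u) = s"
    "arr C \<phi> \<Longrightarrow> src \<phi> = n \<Longrightarrow> tgt \<phi> = x \<Longrightarrow> induced G n x m s u \<star> mp G (inc \<phi> m) = u \<phi>"
proof -
  have "\<exists>!t. t \<in> homs C (ob G (P n x m)) s \<and> (\<forall>\<phi>\<in>homs C n x. t \<star> mp G (inc \<phi> m) = u \<phi>)"
    using assms unfolding preserves_copowers_def by blast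
  from theI'[OF this] show "arr C (induced G n x m s u)" "src (induced G n x m s u) = ob G (P n x m)"
    "tgt (induced G n x m s u) = s"
    "arr C \<phi> \<Longrightarrow> src \<phi> = n \<Longrightarrow> tgt \<phi> = x \<Longrightarrow> induced G n x m s u \<star> mp G (inc \<phi> m) = u \<phi>"
    by (simp_all add: induced_def homs_def)
qed

text \<open>Uniqueness half of the universal property, for the family that \<open>t\<close> itself
  induces. Equations between arrows out of a copower can thus be tested on coprojections.\<close>

lemma copower_ext:
  assumes G: "preserves_copowers G" and nxm: "n \<in> Obj C" "x \<in> Obj C" "m \<in> Obj C"
    and t: "arr C t" "src t = ob G (P n x m)" and t': "arr C t'" "src t' = ob G (P n x m)" and tt: "tgt t' = tgt t"
    and eq: "\<And>\<phi>. arr C \<phi> \<Longrightarrow> src \<phi> = n \<Longrightarrow> tgt \<phi> = x \<Longrightarrow> t \<star> mp G (inc \<phi> m) = t' \<star> mp G (inc \<phi> m)"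
  shows "t = t'"
proof -
  have [simp]: "endofunctor C G" using G by (simp add: preserves_copowers_def)
  have lin: "linear_on n x (\<lambda>\<phi>. t \<star> mp G (inc \<phi> m)) (ob G m) (tgt t)"
    using t nxm by (auto simp: linear_on_def homs_def inc_plus inc_scale cmp_plus_right cmp_scale_right)
  have ex1: "\<exists>!k. k \<in> homs C (ob G (P n x m)) (tgt t) \<and>
      (\<forall>\<phi>\<in>homs C n x. k \<star> mp G (inc \<phi> m) = t \<star> mp G (inc \<phi> m))"
    by (rule G[unfolded preserves_copowers_def, THEN conjunct2, rule_format, OF nxm arr_tgt[OF t(1)] lin])
  have "t' \<star> mp G (inc \<phi> m) = t \<star> mp G (inc \<phi> m)" if "\<phi> \<in> homs C n x" for \<phi>
    using eq[of \<phi>] that by (simp add: homs_def)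
  moreover have "t \<in> homs C (ob G (P n x m)) (tgt t)" "t' \<in> homs C (ob G (P n x m)) (tgt t)"
    using t t' tt by (auto simp: homs_def)
  ultimately show ?thesis
    using ex1 by blast
qed

text \<open>Transpose the given family along the adjunction of \<open>lf T\<close> with
  \<open>md T\<close>, use the universal property of \<open>V \<otimes> m\<close> itself, and
  transpose back. The triangle identity for \<open>lf T\<close> serves both existence and
  uniqueness.\<close>

lemma preserves_copowers_left_adjoint:
  assumes T: "is_triple C T"
  shows "preserves_copowers (lf T)"
  unfolding preserves_copowers_def
proof (intro conjI ballI allI impI)
  note [simp] = T
  show "endofunctor C (lf T)" by simp
  fix n x m s u
  assume nxms [simp]: "n \<in> Obj C" "x \<in> Obj C" "m \<in> Obj C" "s \<in> Obj C" and u: "linear_on n x u (ob (lf T) m) s"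
  have u_simps [simp]: "arr C (u f)" "src (u f) = ob (lf T) m" "tgt (u f) = s"
    if "arr C f" "src f = n" "tgt f = x" for f
    using u that by (auto simp: linear_on_def homs_def)
  have u_lin [simp]: "u (f \<boxplus> g) = u f \<boxplus> u g" "u (scale_arr C r f) = scale_arr C r (u f)"
    if "arr C f" "src f = n" "tgt f = x" "arr C g" "src g = n" "tgt g = x" for f g r
    using u that by (auto simp: linear_on_def homs_def)
  let ?v = "\<lambda>\<phi>. mp (md T) (u \<phi>) \<star> uni T m"
  have v: "linear_on n x ?v m (ob (md T) s)"
    by (auto simp: linear_on_def homs_def cmp_plus_left cmp_scale_left)
  define k where "k = induced endo_id n x m (ob (md T) s) ?v"
  have k [simp]: "arr C k" "src k = P n x m" "tgt k = ob (md T) s"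
    "\<And>\<phi>. arr C \<phi> \<Longrightarrow> src \<phi> = n \<Longrightarrow> tgt \<phi> = x \<Longrightarrow> k \<star> inc \<phi> m = ?v \<phi>"
    using v induced_simps[of endo_id n x m "ob (md T) s" ?v] by (auto simp: k_def)
  show "\<exists>!t. t \<in> homs C (ob (lf T) (P n x m)) s \<and> (\<forall>\<phi>\<in>homs C n x. t \<star> mp (lf T) (inc \<phi> m) = u \<phi>)"
  proof (intro ex1I[of _ "eva T s \<star> mp (lf T) k"] conjI ballI)
    show "eva T s \<star> mp (lf T) k \<in> homs C (ob (lf T) (P n x m)) s"
      by (simp add: homs_def)
    fix \<phi> assume "\<phi> \<in> homs C n x"
    then have \<phi> [simp]: "arr C \<phi>" "src \<phi> = n" "tgt \<phi> = x" by (auto simp: homs_def)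
    have "eva T s \<star> mp (lf T) k \<star> mp (lf T) (inc \<phi> m) = eva T s \<star> mp (lf T) (k \<star> inc \<phi> m)"
      by (subst endofunctor_simps(6)) simp_all
    also have "\<dots> = (eva T s \<star> mp (lf T) (mp (md T) (u \<phi>))) \<star> mp (lf T) (uni T m)"
      by simp
    also have "\<dots> = u \<phi>"
      by (subst triple_natural(2)[OF T, of "u \<phi>" "ob (lf T) m"]) simp_all
    finally show "(eva T s \<star> mp (lf T) k) \<star> mp (lf T) (inc \<phi> m) = u \<phi>"
      by simp
  next
    fix t assume t: "t \<in> homs C (ob (lf T) (P n x m)) s \<and> (\<forall>\<phi>\<in>homs C n x. t \<star> mp (lf T) (inc \<phi> m) = u \<phi>)"
    then have t_simps [simp]: "arr C t" "src t = ob (lf T) (P n x m)" "tgt t = s"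
      by (auto simp: homs_def)
    \<comment> \<open>The transpose of \<open>t\<close> solves the transposed problem, hence equals
      \<open>k\<close>; transposing back recovers \<open>t\<close>.\<close>
    have "mp (md T) t \<star> uni T (P n x m) = k"
    proof (rule copower_ext[of endo_id n x m])
      fix \<phi> assume \<phi> [simp]: "arr C \<phi>" "src \<phi> = n" "tgt \<phi> = x"
      have "mp (md T) t \<star> uni T (P n x m) \<star> inc \<phi> m = mp (md T) (t \<star> mp (lf T) (inc \<phi> m)) \<star> uni T m"
        by (simp add: triple_natural(3)[OF T, of "inc \<phi> m"])
      also have "t \<star> mp (lf T) (inc \<phi> m) = u \<phi>"
        using t by (simp add: homs_def)
      finally show "(mp (md T) t \<star> uni T (P n x m)) \<star> mp endo_id (inc \<phi> m) = k \<star> mp endo_id (inc \<phi> m)"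
        by simp
    qed auto
    then have "eva T s \<star> mp (lf T) k = (eva T s \<star> mp (lf T) (mp (md T) t)) \<star> mp (lf T) (uni T (P n x m))"
      by auto
    also have "\<dots> = t"
      by (subst triple_natural(2)[OF T, of t "ob (lf T) (P n x m)"]) simp_all
    finally show "t = eva T s \<star> mp (lf T) k" ..
  qed
qed

section \<open>Action of morphisms on \<open>Hom n x \<otimes> m\<close> in each of its three
  variables\<close>

definition pre :: "('o, 'm) arrow \<Rightarrow> 'o \<Rightarrow> 'o \<Rightarrow> ('o, 'm) arrow" where
  "pre f x m = induced endo_id (tgt f) x m (P (src f) x m) (\<lambda>\<phi>. inc (\<phi> \<star> f) m)"

definition pst :: "'o \<Rightarrow> 'o \<Rightarrow> ('o, 'm) arrow \<Rightarrow> ('o, 'm) arrow" where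
  "pst n x f = induced endo_id n x (src f) (P n x (tgt f)) (\<lambda>\<phi>. inc \<phi> (tgt f) \<star> f)"

definition cov :: "('o, 'm) arrow \<Rightarrow> 'o \<Rightarrow> 'o \<Rightarrow> ('o, 'm) arrow" where
  "cov h n m = induced endo_id n (src h) m (P n (tgt h) m) (\<lambda>\<phi>. inc (h \<star> \<phi>) m)"

lemma pre_simps [simp]:
  assumes "arr C f" "x \<in> Obj C" "m \<in> Obj C"
  shows "arr C (pre f x m)" "src (pre f x m) = P (tgt f) x m" "tgt (pre f x m) = P (src f) x m"
    "arr C \<phi> \<Longrightarrow> src \<phi> = tgt f \<Longrightarrow> tgt \<phi> = x \<Longrightarrow> pre f x m \<star> inc \<phi> m = inc (\<phi> \<star> f) m"
  using assms induced_simps[of endo_id "tgt f" x m "P (src f) x m" "\<lambda>\<phi>. inc (\<phi> \<star> f) m"]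
  by (auto simp: pre_def linear_on_def homs_def cmp_plus_left cmp_scale_left inc_plus inc_scale)

lemma pst_simps [simp]:
  assumes "arr C f" "n \<in> Obj C" "x \<in> Obj C"
  shows "arr C (pst n x f)" "src (pst n x f) = P n x (src f)" "tgt (pst n x f) = P n x (tgt f)"
    "arr C \<phi> \<Longrightarrow> src \<phi> = n \<Longrightarrow> tgt \<phi> = x \<Longrightarrow> src f = m \<Longrightarrow> pst n x f \<star> inc \<phi> m = inc \<phi> (tgt f) \<star> f"
  using assms induced_simps[of endo_id n x "src f" "P n x (tgt f)" "\<lambda>\<phi>. inc \<phi> (tgt f) \<star> f"]
  by (auto simp: pst_def linear_on_def homs_def cmp_plus_left cmp_scale_left inc_plus inc_scale)

lemma cov_simps [simp]:
  assumes "arr C h" "n \<in> Obj C" "m \<in> Obj C"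
  shows "arr C (cov h n m)" "src (cov h n m) = P n (src h) m" "tgt (cov h n m) = P n (tgt h) m"
    "arr C \<phi> \<Longrightarrow> src \<phi> = n \<Longrightarrow> tgt \<phi> = src h \<Longrightarrow> cov h n m \<star> inc \<phi> m = inc (h \<star> \<phi>) m"
  using assms induced_simps[of endo_id n "src h" m "P n (tgt h) m" "\<lambda>\<phi>. inc (h \<star> \<phi>) m"]
  by (auto simp: cov_def linear_on_def homs_def cmp_plus_right cmp_scale_right inc_plus inc_scale)

text \<open>\<open>copower_map\<close> is described by its effect on bare morphisms from all test
  objects; by naturality (\<open>cpb_eq\<close>) the coprojections already fix it. \<open>u'\<close>
  is the lift of \<open>u\<close> to arrows, which supplies the ends.\<close>

lemma copower_map_eq:
  assumes ob: "n \<in> Obj C" "x \<in> Obj C" "m \<in> Obj C" "n' \<in> Obj C" "x' \<in> Obj C" "m' \<in> Obj C"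
    and t: "t \<in> homs C (P n x m) (P n' x' m')" and g: "g \<in> homs C m m'"
    and u: "\<And>\<phi>. \<phi> \<in> homs C n x \<Longrightarrow> u' \<phi> \<in> homs C n' x'" "\<And>\<phi>. \<phi> \<in> homs C n x \<Longrightarrow> u (mor \<phi>) = mor (u' \<phi>)"
    and eq: "\<And>\<phi>. \<phi> \<in> homs C n x \<Longrightarrow> t \<star> inc \<phi> m = inc (u' \<phi>) m' \<star> g"
  shows "copower_map C cpo cpb (Hom C n x) m (Hom C n' x') m' u (mor g) = mor t"
proof -
  have [simp]: "arr C t" "src t = P n x m" "tgt t = P n' x' m'" "arr C g" "src g = m" "tgt g = m'"
    using t g by (auto simp: homs_def)
  have t_hom: "mor t \<in> Hom C (P n x m) (P n' x' m')" "mor g \<in> Hom C m m'"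
    using arr_mor[of C t] arr_mor[of C g] by auto
  have um: "u v \<in> Hom C n' x'"
    "mor t \<cdot> cpb (Hom C n x) m v (Idn C m) = cpb (Hom C n' x') m' (u v) (mor g)" if "v \<in> Hom C n x" for v
  proof -
    let ?\<phi> = "Arr n v x"
    have \<phi>: "?\<phi> \<in> homs C n x" using that ob by (simp add: homs_def)
    have [simp]: "arr C (u' ?\<phi>)" "src (u' ?\<phi>) = n'" "tgt (u' ?\<phi>) = x'"
      using homsD[OF u(1)[OF \<phi>]] by auto
    have uv: "u v = mor (u' ?\<phi>)" using u(2)[OF \<phi>] by simp
    show *: "u v \<in> Hom C n' x'"
      using arr_mor[of C "u' ?\<phi>"] by (simp add: uv)
    have "mor t \<cdot> mor (inc ?\<phi> m) = mor (inc (u' ?\<phi>) m') \<cdot> mor g"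
      using arg_cong[OF eq[OF \<phi>], of mor] ob that by (simp add: mor_cmp)
    then show "mor t \<cdot> cpb (Hom C n x) m v (Idn C m) = cpb (Hom C n' x') m' (u v) (mor g)"
      using cpb_eq[OF ob(4-6,3) * t_hom(2)] by (simp add: inc_def uv)
  qed
  have *: "P n x m \<in> Obj C" "P n' x' m' \<in> Obj C" using ob by auto
  have big: "mor t \<cdot> cpb (Hom C n x) m v f = cpb (Hom C n' x') m' (u v) (mor g \<cdot> f)"
    if "l \<in> Obj C" "f \<in> Hom C l m" "v \<in> Hom C n x" for l f v
  proof -
    have "mor t \<cdot> cpb (Hom C n x) m v f = mor t \<cdot> (cpb (Hom C n x) m v (Idn C m) \<cdot> f)"
      using cpb_eq[OF ob(1-3) that(1,3,2)] by simp
    also have "\<dots> = cpb (Hom C n' x') m' (u v) (mor g) \<cdot> f"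
      using comp_assoc[OF that(1) ob(3) * that(2) cpb_hom[OF ob(1-3,3) that(3) id_hom[OF ob(3)]] t_hom(1)]
        um(2)[OF that(3)] by simp
    also have "\<dots> = cpb (Hom C n' x') m' (u v) (Idn C m') \<cdot> (mor g \<cdot> f)"
      using cpb_eq[OF ob(4-6,3) um(1)[OF that(3)] t_hom(2)]
        comp_assoc[OF that(1) ob(3,6) *(2) that(2) t_hom(2)
          cpb_hom[OF ob(4-6,6) um(1)[OF that(3)] id_hom[OF ob(6)]]]
      by simp
    also have "\<dots> = cpb (Hom C n' x') m' (u v) (mor g \<cdot> f)"
      using cpb_eq[OF ob(4-6) that(1) um(1)[OF that(3)]] comp_hom[OF that(1) ob(3,6) that(2) t_hom(2)] by simp
    finally show ?thesis .
  qed
  show ?thesis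
    unfolding copower_map_def P_def[symmetric]
  proof (rule the_equality)
    show "mor t \<in> Hom C (P n x m) (P n' x' m') \<and> (\<forall>l\<in>Obj C. \<forall>f\<in>Hom C l m. \<forall>v\<in>Hom C n x.
        mor t \<cdot> cpb (Hom C n x) m v f = cpb (Hom C n' x') m' (u v) (mor g \<cdot> f))"
      by (intro conjI ballI t_hom(1) big)
    fix t' assume t': "t' \<in> Hom C (P n x m) (P n' x' m') \<and> (\<forall>l\<in>Obj C. \<forall>f\<in>Hom C l m. \<forall>v\<in>Hom C n x.
        t' \<cdot> cpb (Hom C n x) m v f = cpb (Hom C n' x') m' (u v) (mor g \<cdot> f))"
    have "Arr (P n x m) t' (P n' x' m') = t"
    proof (rule copower_ext[of endo_id n x m])
      fix \<phi> assume \<phi>: "arr C \<phi>" "src \<phi> = n" "tgt \<phi> = x"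
      then have "mor \<phi> \<in> Hom C n x" using arr_mor by blast
      then have "t' \<cdot> mor (inc \<phi> m) = mor t \<cdot> mor (inc \<phi> m)"
        using t' big[OF ob(3) id_hom[OF ob(3)]] ob \<phi> by (simp add: inc_def id_hom)
      then show "Arr (P n x m) t' (P n' x' m') \<star> mp endo_id (inc \<phi> m) = t \<star> mp endo_id (inc \<phi> m)"
        using \<phi> t' ob by (intro arr_eqI[of C]) (auto simp: mor_cmp)
    qed (use t' ob in auto)
    then show "t' = mor t" by auto
  qed
qed

end

section \<open>The Nakayama functor\<close>

context nakayama
begin

section \<open>The end, its projections and its universal property as arrows\<close>

lemma No_obj [simp]: "x \<in> Obj C \<Longrightarrow> No x \<in> Obj C"
  using left_nakayama by (auto simp: is_left_nakayama_def is_end_def is_wedge_def)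

lemma pr_simps [simp]:
  assumes "x \<in> Obj C" "m \<in> Obj C"
  shows "arr C (pr x m)" "src (pr x m) = No x" "tgt (pr x m) = P m x m"
  using assms left_nakayama by (auto simp: is_left_nakayama_def is_end_def is_wedge_def pr_def P_def[symmetric])

lemma mor_pr: "mor (pr x m) = \<pi> x m"
  and mor_Nak: "mor (Nak h) = Nm (mor h)"
  by (simp_all add: pr_def Nak_def)

lemma copower_map_pre:
  assumes "arr C f" "x \<in> Obj C" "m \<in> Obj C"
  shows "copower_map C cpo cpb (Hom C (tgt f) x) m (Hom C (src f) x) m (\<lambda>\<phi>. \<phi> \<cdot> mor f) (Idn C m) = mor (pre f x m)"
  using assms copower_map_eq[of "tgt f" x m "src f" x m "pre f x m" "idt C m" "\<lambda>\<phi>. \<phi> \<star> f" "\<lambda>\<phi>. \<phi> \<cdot> mor f"]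
  by (auto simp: homs_def mor_cmp)

lemma copower_map_pst:
  assumes "arr C f" "n \<in> Obj C" "x \<in> Obj C"
  shows "copower_map C cpo cpb (Hom C n x) (src f) (Hom C n x) (tgt f) (\<lambda>\<phi>. \<phi> \<cdot> Idn C n) (mor f) = mor (pst n x f)"
proof -
  have "mor \<phi> \<cdot> Idn C n = mor \<phi>" if "\<phi> \<in> homs C n x" for \<phi>
    using that assms comp_id_right[of n x] arr_mor[of C \<phi>] by (simp add: homs_def)
  with copower_map_eq[of n x "src f" n x "tgt f" "pst n x f" f "\<lambda>\<phi>. \<phi>" "\<lambda>\<phi>. \<phi> \<cdot> Idn C n"] assms
  show ?thesis by (simp add: homs_def)
qed

lemma copower_map_cov:
  assumes "arr C h" "n \<in> Obj C" "m \<in> Obj C"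
  shows "copower_map C cpo cpb (Hom C n (src h)) m (Hom C n (tgt h)) m (\<lambda>\<phi>. mor h \<cdot> \<phi>) (Idn C m) = mor (cov h n m)"
  using assms copower_map_eq[of n "src h" m n "tgt h" m "cov h n m" "idt C m" "\<lambda>\<phi>. h \<star> \<phi>" "\<lambda>\<phi>. mor h \<cdot> \<phi>"]
  by (auto simp: homs_def mor_cmp)

lemma wedge_raw:
  assumes "x \<in> Obj C" "n \<in> Obj C" "m \<in> Obj C" "f \<in> Hom C n m"
  shows "copower_map C cpo cpb (Hom C m x) m (Hom C n x) m (\<lambda>\<phi>. \<phi> \<cdot> f) (Idn C m) \<cdot> \<pi> x m
    = copower_map C cpo cpb (Hom C n x) n (Hom C n x) m (\<lambda>\<phi>. \<phi> \<cdot> Idn C n) f \<cdot> \<pi> x n"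
  using left_nakayama assms unfolding is_left_nakayama_def is_end_def is_wedge_def by blast

lemma Nm_raw:
  assumes "x \<in> Obj C" "y \<in> Obj C" "h \<in> Hom C x y"
  shows "Nm h \<in> Hom C (No x) (No y)" and "m \<in> Obj C \<Longrightarrow> \<pi> y m \<cdot> Nm h =
     copower_map C cpo cpb (Hom C m x) m (Hom C m y) m (\<lambda>\<phi>. h \<cdot> \<phi>) (Idn C m) \<cdot> \<pi> x m"
  using left_nakayama assms unfolding is_left_nakayama_def by blast+

lemma wedge:
  assumes "arr C f" "x \<in> Obj C" "src f = n" "tgt f = m"
  shows "pre f x m \<star> pr x m = pst n x f \<star> pr x n"
proof (rule arr_eqI[of C])
  have "mor f \<in> Hom C n m" "n \<in> Obj C" "m \<in> Obj C" using assms arr_mor[of C f] by auto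
  then show "mor (pre f x m \<star> pr x m) = mor (pst n x f \<star> pr x n)"
    using wedge_raw[of x n m "mor f"] assms copower_map_pre[of f x m] copower_map_pst[of f n x]
    by (auto simp: mor_cmp mor_pr)
qed (use assms in auto)

lemma end_universal:
  assumes w: "w \<in> Obj C" and x: "x \<in> Obj C"
    and \<omega>: "\<And>m. m \<in> Obj C \<Longrightarrow> arr C (\<omega> m)" "\<And>m. m \<in> Obj C \<Longrightarrow> src (\<omega> m) = w"
      "\<And>m. m \<in> Obj C \<Longrightarrow> tgt (\<omega> m) = P m x m"
    and wedge: "\<And>f. arr C f \<Longrightarrow> pre f x (tgt f) \<star> \<omega> (tgt f) = pst (src f) x f \<star> \<omega> (src f)"
  shows "\<exists>!h. h \<in> homs C w (No x) \<and> (\<forall>m\<in>Obj C. pr x m \<star> h = \<omega> m)"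
proof -
  let ?G = "\<lambda>n n' m m' f g. copower_map C cpo cpb (Hom C n x) m (Hom C n' x) m' (\<lambda>\<phi>. \<phi> \<cdot> f) g"
  have "is_wedge C C (\<lambda>n m. cpo (Hom C n x) m) ?G w (\<lambda>m. mor (\<omega> m))"
    unfolding is_wedge_def P_def[symmetric]
  proof (intro conjI ballI w)
    fix m assume "m \<in> Obj C"
    then show "mor (\<omega> m) \<in> Hom C w (P m x m)"
      using \<omega> arr_mor[of C "\<omega> m"] by simp
    fix n f assume "n \<in> Obj C" "f \<in> Hom C n m"
    then show "?G m n m m f (Idn C m) \<cdot> mor (\<omega> m) = ?G n n n m (Idn C n) f \<cdot> mor (\<omega> n)"
      using arg_cong[OF wedge[of "Arr n f m"], of mor] copower_map_pre[of "Arr n f m" x m]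
        copower_map_pst[of "Arr n f m" n x] x \<open>m \<in> Obj C\<close> \<omega>
      by (simp add: mor_cmp)
  qed
  then have "\<exists>!h. h \<in> Hom C w (No x) \<and> (\<forall>m\<in>Obj C. \<pi> x m \<cdot> h = mor (\<omega> m))"
    using left_nakayama x by (simp add: is_left_nakayama_def is_end_def)
  then obtain h where h: "h \<in> Hom C w (No x)" "\<And>m. m \<in> Obj C \<Longrightarrow> \<pi> x m \<cdot> h = mor (\<omega> m)"
    and uniq: "\<And>h'. h' \<in> Hom C w (No x) \<Longrightarrow> (\<And>m. m \<in> Obj C \<Longrightarrow> \<pi> x m \<cdot> h' = mor (\<omega> m)) \<Longrightarrow> h' = h"
    by metis
  show ?thesis
  proof (intro ex1I[of _ "Arr w h (No x)"] conjI ballI)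
    show "Arr w h (No x) \<in> homs C w (No x)" using h w x by (simp add: homs_def)
    show "pr x m \<star> Arr w h (No x) = \<omega> m" if "m \<in> Obj C" for m
      using that h w x \<omega>[OF that] by (intro arr_eqI[of C]) (auto simp: mor_cmp mor_pr)
    fix t assume t: "t \<in> homs C w (No x) \<and> (\<forall>m\<in>Obj C. pr x m \<star> t = \<omega> m)"
    then have t': "arr C t" "src t = w" "tgt t = No x" and eq: "\<And>m. m \<in> Obj C \<Longrightarrow> pr x m \<star> t = \<omega> m"
      by (auto simp: homs_def)
    have "mor t = h"
    proof (rule uniq)
      show "mor t \<in> Hom C w (No x)" using t' arr_mor[of C t] by simp
      show "\<pi> x m \<cdot> mor t = mor (\<omega> m)" if "m \<in> Obj C" for m
        using arg_cong[OF eq[OF that], of mor] t' x that by (simp add: mor_cmp mor_pr)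
    qed
    then show "t = Arr w h (No x)" using t' arr_collapse[of C t] by simp
  qed
qed

text \<open>The composites of \<open>h\<close> with the projections form a wedge, so uniqueness in
  the universal property applies. Together with \<open>copower_ext\<close> this is the basic method
  for proving equations about \<open>tau\<close>.\<close>

lemma end_ext:
  assumes "arr C h" "arr C h'" "src h' = src h" "tgt h = No x" "tgt h' = No x" "x \<in> Obj C"
    and eq: "\<And>m. m \<in> Obj C \<Longrightarrow> pr x m \<star> h = pr x m \<star> h'"
  shows "h = h'"
proof -
  have wd: "pre f x (tgt f) \<star> pr x (tgt f) \<star> h = pst (src f) x f \<star> pr x (src f) \<star> h" if "arr C f" for f
    using wedge[of f x, THEN cmp_reassoc] that assms by simp
  have "\<exists>!k. k \<in> homs C (src h) (No x) \<and> (\<forall>m\<in>Obj C. pr x m \<star> k = pr x m \<star> h)"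
    using wd assms by (intro end_universal) auto
  moreover have "h \<in> homs C (src h) (No x)" "h' \<in> homs C (src h) (No x)"
    using assms by (auto simp: homs_def)
  moreover have "\<forall>m\<in>Obj C. pr x m \<star> h' = pr x m \<star> h" using eq by simp
  ultimately show ?thesis by blast
qed

lemma Nak_simps [simp]:
  assumes "arr C h"
  shows "arr C (Nak h)" "src (Nak h) = No (src h)" "tgt (Nak h) = No (tgt h)"
  using assms Nm_raw[OF _ _ arr_mor[of C h]] by (auto simp: Nak_def)

lemma pr_Nak [simp]:
  assumes "arr C h" "m \<in> Obj C" "tgt h = y"
  shows "pr y m \<star> Nak h = cov h m m \<star> pr (src h) m"
proof (rule arr_eqI[of C])
  show "mor (pr y m \<star> Nak h) = mor (cov h m m \<star> pr (src h) m)"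
    using assms Nm_raw[OF _ _ arr_mor[of C h]] copower_map_cov[of h m m]
    by (auto simp: mor_cmp mor_pr mor_Nak)
qed (use assms in auto)

lemma pr_Nak2 [simp]:
  assumes "arr C h" "m \<in> Obj C" "tgt h = y"
  shows "pr y m \<star> Nak h \<star> z = cov h m m \<star> pr (src h) m \<star> z"
  using pr_Nak[OF assms, THEN cmp_reassoc] by simp

lemma cov_cmp:
  assumes "arr C h" "arr C g" "src g = tgt h" "n \<in> Obj C" "m \<in> Obj C"
  shows "cov g n m \<star> cov h n m = cov (g \<star> h) n m"
proof (rule copower_ext[of endo_id n "src h" m])
  fix \<phi> assume "arr C \<phi>" "src \<phi> = n" "tgt \<phi> = src h"
  then show "(cov g n m \<star> cov h n m) \<star> mp endo_id (inc \<phi> m) = cov (g \<star> h) n m \<star> mp endo_id (inc \<phi> m)"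
    using assms by simp
qed (use assms in auto)

lemma cov_idt:
  assumes "x \<in> Obj C" "n \<in> Obj C" "m \<in> Obj C"
  shows "cov (idt C x) n m = idt C (P n x m)"
  by (rule copower_ext[of endo_id n x m]) (use assms in auto)

lemma cov_plus:
  assumes "arr C h" "arr C g" "src g = src h" "tgt g = tgt h" "n \<in> Obj C" "m \<in> Obj C"
  shows "cov (h \<boxplus> g) n m = cov h n m \<boxplus> cov g n m"
  by (rule copower_ext[of endo_id n "src h" m])
    (use assms in \<open>auto simp: cmp_plus_left inc_plus\<close>)

lemma cov_scale:
  assumes "arr C h" "n \<in> Obj C" "m \<in> Obj C"
  shows "cov (scale_arr C r h) n m = scale_arr C r (cov h n m)"
  by (rule copower_ext[of endo_id n "src h" m])
    (use assms in \<open>auto simp: cmp_scale_left inc_scale\<close>)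

text \<open>Each law is the corresponding law of \<open>cov\<close>, tested on the projections of
  the end.\<close>

lemma endofunctor_Nak: "endofunctor C (Endo No Nak)"
  unfolding endofunctor_def
proof (intro conjI allI impI ballI; (elim conjE)?)
  show "mp (Endo No Nak) (idt C x) = idt C (ob (Endo No Nak) x)" if "x \<in> Obj C" for x
    by (rule end_ext[of _ _ x]) (use that in \<open>auto simp: cov_idt\<close>)
  show "mp (Endo No Nak) (g \<star> f) = mp (Endo No Nak) g \<star> mp (Endo No Nak) f"
    if "arr C f" "arr C g" "src g = tgt f" for f g
    by (rule end_ext[of _ _ "tgt g"]) (use that in \<open>auto simp: cov_cmp cov_cmp[THEN cmp_reassoc]\<close>)
  show "mp (Endo No Nak) (f \<boxplus> g) = mp (Endo No Nak) f \<boxplus> mp (Endo No Nak) g"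
    if "arr C f" "arr C g" "src g = src f" "tgt g = tgt f" for f g
    by (rule end_ext[of _ _ "tgt g"]) (use that in \<open>auto simp: cov_plus cmp_plus_right cmp_plus_left\<close>)
  show "mp (Endo No Nak) (scale_arr C r f) = scale_arr C r (mp (Endo No Nak) f)" if "arr C f" for f r
    by (rule end_ext[of _ _ "tgt f"]) (use that in \<open>auto simp: cov_scale cmp_scale_right cmp_scale_left\<close>)
qed (auto simp: homs_def)

lemmas Nak_functor = endofunctorD[OF endofunctor_Nak, simplified]
declare Nak_functor(5,6) [simp]

end

section \<open>Lax structures on the Nakayama functor\<close>

context nakayama
begin

text \<open>
  Reindexing of copowers along \<open>Hom (md n) x \<rightarrow> Hom n (rt x)\<close>; its components for \<open>n = m\<close> assemble to
  \<open>tau\<close> below.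
\<close>

definition thet :: "('o, 'm) triple \<Rightarrow> 'o \<Rightarrow> 'o \<Rightarrow> 'o \<Rightarrow> ('o, 'm) arrow" where
  "thet T n x m = induced (lf T) (ob (md T) n) x (ob (md T) m) (P n (ob (rt T) x) m)
     (\<lambda>\<phi>. inc (mp (rt T) \<phi> \<star> cou T n) m \<star> eva T m)"

lemma thet_simps [simp]:
  assumes T: "is_triple C T" and ob: "n \<in> Obj C" "x \<in> Obj C" "m \<in> Obj C"
  shows "arr C (thet T n x m)" "src (thet T n x m) = ob (lf T) (P (ob (md T) n) x (ob (md T) m))"
    "tgt (thet T n x m) = P n (ob (rt T) x) m"
    "arr C \<phi> \<Longrightarrow> src \<phi> = ob (md T) n \<Longrightarrow> tgt \<phi> = x \<Longrightarrow> md_m = ob (md T) m \<Longrightarrow>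
       thet T n x m \<star> mp (lf T) (inc \<phi> md_m) = inc (mp (rt T) \<phi> \<star> cou T n) m \<star> eva T m"
proof -
  note [simp] = T
  have *: "linear_on (ob (md T) n) x (\<lambda>\<phi>. inc (mp (rt T) \<phi> \<star> cou T n) m \<star> eva T m)
      (ob (lf T) (ob (md T) m)) (P n (ob (rt T) x) m)"
    using ob by (auto simp: linear_on_def homs_def cmp_plus_left cmp_scale_left inc_plus inc_scale)
  show "arr C (thet T n x m)" "src (thet T n x m) = ob (lf T) (P (ob (md T) n) x (ob (md T) m))"
    "tgt (thet T n x m) = P n (ob (rt T) x) m"
    "arr C \<phi> \<Longrightarrow> src \<phi> = ob (md T) n \<Longrightarrow> tgt \<phi> = x \<Longrightarrow> md_m = ob (md T) m \<Longrightarrow>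
       thet T n x m \<star> mp (lf T) (inc \<phi> md_m) = inc (mp (rt T) \<phi> \<star> cou T n) m \<star> eva T m"
    using induced_simps[OF preserves_copowers_left_adjoint[OF T] _ _ _ _ *] ob
    by (simp_all add: thet_def)
qed

lemma thet_cmp2 [simp]:
  assumes "is_triple C T" "n \<in> Obj C" "x \<in> Obj C" "m \<in> Obj C"
    "arr C \<phi>" "src \<phi> = ob (md T) n" "tgt \<phi> = x" "md_m = ob (md T) m"
  shows "thet T n x m \<star> mp (lf T) (inc \<phi> md_m) \<star> z = inc (mp (rt T) \<phi> \<star> cou T n) m \<star> eva T m \<star> z"
  using thet_simps(4)[OF assms, THEN cmp_reassoc] by simp

lemma pre_inc2 [simp]:
  assumes "arr C f" "x \<in> Obj C" "m \<in> Obj C" "arr C \<phi>" "src \<phi> = tgt f" "tgt \<phi> = x"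
  shows "pre f x m \<star> inc \<phi> m \<star> z = inc (\<phi> \<star> f) m \<star> z"
  using pre_simps(4)[OF assms, THEN cmp_reassoc] by simp

lemma pst_inc2 [simp]:
  assumes "arr C f" "n \<in> Obj C" "x \<in> Obj C" "arr C \<phi>" "src \<phi> = n" "tgt \<phi> = x" "src f = m"
  shows "pst n x f \<star> inc \<phi> m \<star> z = inc \<phi> (tgt f) \<star> f \<star> z"
  using pst_simps(4)[OF assms, THEN cmp_reassoc] by simp

lemma cov_inc2 [simp]:
  assumes "arr C h" "n \<in> Obj C" "m \<in> Obj C" "arr C \<phi>" "src \<phi> = n" "tgt \<phi> = src h"
  shows "cov h n m \<star> inc \<phi> m \<star> z = inc (h \<star> \<phi>) m \<star> z"
  using cov_simps(4)[OF assms, THEN cmp_reassoc] by simp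

text \<open>On coprojections this is naturality of \<open>cou T\<close>. Together with
  \<open>thet_pst\<close> it makes the family that defines \<open>tau\<close> a wedge.\<close>

lemma thet_pre:
  assumes T: "is_triple C T" and f: "arr C f" "src f = n" "tgt f = m" and x: "x \<in> Obj C" and l: "l \<in> Obj C"
  shows "pre f (ob (rt T) x) l \<star> thet T m x l = thet T n x l \<star> mp (lf T) (pre (mp (md T) f) x (ob (md T) l))"
proof (rule copower_ext[OF preserves_copowers_left_adjoint[OF T], of "ob (md T) m" x "ob (md T) l"])
  note [simp] = T x l f
  have [simp]: "n \<in> Obj C" "m \<in> Obj C" using f arr_src arr_tgt by metis+
  fix \<phi> assume [simp]: "arr C \<phi>" "src \<phi> = ob (md T) m" "tgt \<phi> = x"
  have "mp (lf T) (pre (mp (md T) f) x (ob (md T) l)) \<star> mp (lf T) (inc \<phi> (ob (md T) l))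
      = mp (lf T) (inc (\<phi> \<star> mp (md T) f) (ob (md T) l))"
    by (subst endofunctor_simps(6)[symmetric]) simp_all
  then show "(pre f (ob (rt T) x) l \<star> thet T m x l) \<star> mp (lf T) (inc \<phi> (ob (md T) l))
    = (thet T n x l \<star> mp (lf T) (pre (mp (md T) f) x (ob (md T) l))) \<star> mp (lf T) (inc \<phi> (ob (md T) l))"
    by (simp add: triple_natural(1)[OF T])
qed (use assms in auto)

text \<open>On coprojections this is naturality of \<open>eva T\<close>.\<close>

lemma thet_pst:
  assumes T: "is_triple C T" and f: "arr C f" "src f = n" "tgt f = m" and x: "x \<in> Obj C" and l: "l \<in> Obj C"
  shows "pst l (ob (rt T) x) f \<star> thet T l x n = thet T l x m \<star> mp (lf T) (pst (ob (md T) l) x (mp (md T) f))"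
proof (rule copower_ext[OF preserves_copowers_left_adjoint[OF T], of "ob (md T) l" x "ob (md T) n"])
  note [simp] = T x l f
  have [simp]: "n \<in> Obj C" "m \<in> Obj C" using f arr_src arr_tgt by metis+
  fix \<phi> assume [simp]: "arr C \<phi>" "src \<phi> = ob (md T) l" "tgt \<phi> = x"
  have "mp (lf T) (pst (ob (md T) l) x (mp (md T) f)) \<star> mp (lf T) (inc \<phi> (ob (md T) n))
      = mp (lf T) (inc \<phi> (ob (md T) m)) \<star> mp (lf T) (mp (md T) f)"
    by (subst (1 2) endofunctor_simps(6)[symmetric]) simp_all
  then show "(pst l (ob (rt T) x) f \<star> thet T l x n) \<star> mp (lf T) (inc \<phi> (ob (md T) n))
    = (thet T l x m \<star> mp (lf T) (pst (ob (md T) l) x (mp (md T) f))) \<star> mp (lf T) (inc \<phi> (ob (md T) n))"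
    by (simp add: triple_natural(2)[OF T, of f n m])
qed (use assms in auto)

lemma thet_cov:
  assumes T: "is_triple C T" and h: "arr C h" "src h = x" "tgt h = y" and ob: "n \<in> Obj C" "m \<in> Obj C"
  shows "cov (mp (rt T) h) n m \<star> thet T n x m = thet T n y m \<star> mp (lf T) (cov h (ob (md T) n) (ob (md T) m))"
proof (rule copower_ext[OF preserves_copowers_left_adjoint[OF T], of "ob (md T) n" x "ob (md T) m"])
  note [simp] = T h ob
  have [simp]: "x \<in> Obj C" "y \<in> Obj C" using h arr_src arr_tgt by metis+
  fix \<phi> assume [simp]: "arr C \<phi>" "src \<phi> = ob (md T) n" "tgt \<phi> = x"
  have "mp (lf T) (cov h (ob (md T) n) (ob (md T) m)) \<star> mp (lf T) (inc \<phi> (ob (md T) m))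
      = mp (lf T) (inc (h \<star> \<phi>) (ob (md T) m))"
    by (subst endofunctor_simps(6)[symmetric]) simp_all
  then show "(cov (mp (rt T) h) n m \<star> thet T n x m) \<star> mp (lf T) (inc \<phi> (ob (md T) m))
    = (thet T n y m \<star> mp (lf T) (cov h (ob (md T) n) (ob (md T) m))) \<star> mp (lf T) (inc \<phi> (ob (md T) m))"
    by simp
qed (use assms in auto)

section \<open>The comparison map on ends and its behaviour under change of triples\<close>

definition tau :: "('o, 'm) triple \<Rightarrow> 'o \<Rightarrow> ('o, 'm) arrow" where
  "tau T x = (THE h. h \<in> homs C (ob (lf T) (No x)) (No (ob (rt T) x)) \<and>
     (\<forall>m\<in>Obj C. pr (ob (rt T) x) m \<star> h = thet T m x m \<star> mp (lf T) (pr x (ob (md T) m))))"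

lemma tau_simps [simp]:
  assumes T: "is_triple C T" and x: "x \<in> Obj C"
  shows "arr C (tau T x)" "src (tau T x) = ob (lf T) (No x)" "tgt (tau T x) = No (ob (rt T) x)"
    "m \<in> Obj C \<Longrightarrow> rt_x = ob (rt T) x \<Longrightarrow>
      pr rt_x m \<star> tau T x = thet T m x m \<star> mp (lf T) (pr x (ob (md T) m))"
proof -
  note [simp] = T x
  have "\<exists>!h. h \<in> homs C (ob (lf T) (No x)) (No (ob (rt T) x)) \<and>
     (\<forall>m\<in>Obj C. pr (ob (rt T) x) m \<star> h = thet T m x m \<star> mp (lf T) (pr x (ob (md T) m)))"
  proof (rule end_universal)
    fix f assume [simp]: "arr C f"
    let ?n = "src f" and ?m = "tgt f"
    have "pre f (ob (rt T) x) ?m \<star> thet T ?m x ?m \<star> mp (lf T) (pr x (ob (md T) ?m))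
        = thet T ?n x ?m \<star> mp (lf T) (pre (mp (md T) f) x (ob (md T) ?m) \<star> pr x (ob (md T) ?m))"
      by (simp add: thet_pre[OF T, THEN cmp_reassoc])
    \<comment> \<open>The wedge condition of \<open>No x\<close>, at the image of \<open>f\<close>
      under \<open>md T\<close>, links the two components.\<close>
    also have "\<dots> = thet T ?n x ?m \<star> mp (lf T) (pst (ob (md T) ?n) x (mp (md T) f) \<star> pr x (ob (md T) ?n))"
      using wedge[of "mp (md T) f" x] by simp
    also have "\<dots> = pst ?n (ob (rt T) x) f \<star> thet T ?n x ?n \<star> mp (lf T) (pr x (ob (md T) ?n))"
      by (simp add: thet_pst[OF T, THEN cmp_reassoc])
    finally show "pre f (ob (rt T) x) ?m \<star> thet T ?m x ?m \<star> mp (lf T) (pr x (ob (md T) ?m)) =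
      pst ?n (ob (rt T) x) f \<star> thet T ?n x ?n \<star> mp (lf T) (pr x (ob (md T) ?n))" .
  qed simp_all
  from theI'[OF this] show "arr C (tau T x)" "src (tau T x) = ob (lf T) (No x)" "tgt (tau T x) = No (ob (rt T) x)"
    "m \<in> Obj C \<Longrightarrow> rt_x = ob (rt T) x \<Longrightarrow>
      pr rt_x m \<star> tau T x = thet T m x m \<star> mp (lf T) (pr x (ob (md T) m))"
    by (simp_all add: tau_def homs_def)
qed

text \<open>After projection to the component at \<open>m\<close> this is \<open>thet_cov\<close>,
  since both \<open>Nak\<close> are computed there by \<open>cov\<close>.\<close>

lemma tau_natural:
  assumes T: "is_triple C T" and h: "arr C h" "src h = x" "tgt h = y"
  shows "Nak (mp (rt T) h) \<star> tau T x = tau T y \<star> mp (lf T) (Nak h)"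
proof -
  note [simp] = T h
  have [simp]: "x \<in> Obj C" "y \<in> Obj C" using h arr_src arr_tgt by metis+
  show ?thesis
  proof (rule end_ext[of _ _ "ob (rt T) y"])
  fix m assume [simp]: "m \<in> Obj C"
  have "pr (ob (rt T) y) m \<star> tau T y \<star> mp (lf T) (Nak h)
     = thet T m y m \<star> mp (lf T) (pr y (ob (md T) m) \<star> Nak h)"
    by (simp add: tau_simps(4)[THEN cmp_reassoc] del: pr_Nak pr_Nak2)
  then show "pr (ob (rt T) y) m \<star> Nak (mp (rt T) h) \<star> tau T x
     = pr (ob (rt T) y) m \<star> tau T y \<star> mp (lf T) (Nak h)"
    by (simp add: thet_cov[OF T, THEN cmp_reassoc])
qed simp_all
qed

text \<open>Naturality of \<open>tau\<close> in the triple, which is contravariant in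
  \<open>md\<close>: \<gamma> runs from \<open>md T'\<close> to \<open>md T\<close>. The hypotheses
  \<open>cou\<close> and \<open>eva\<close> say that \<alpha>, \<gamma> and \<kappa> respect the
  structure maps that enter \<open>thet\<close>.\<close>

lemma tau_transform:
  assumes T: "is_triple C T" and T': "is_triple C T'"
    and \<alpha>: "nat_tr C (rt T) (rt T') \<alpha>" and \<gamma>: "nat_tr C (md T') (md T) \<gamma>" and \<kappa>: "nat_tr C (lf T) (lf T') \<kappa>"
    and cou: "\<And>m. m \<in> Obj C \<Longrightarrow> \<alpha> (ob (md T) m) \<star> cou T m = mp (rt T') (\<gamma> m) \<star> cou T' m"
    and eva: "\<And>m. m \<in> Obj C \<Longrightarrow> eva T' m \<star> \<kappa> (ob (md T') m) = eva T m \<star> mp (lf T) (\<gamma> m)"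
    and x: "x \<in> Obj C"
  shows "Nak (\<alpha> x) \<star> tau T x = tau T' x \<star> \<kappa> (No x)"
proof (rule end_ext[of _ _ "ob (rt T') x"])
  note [simp] = T T' x nat_trD(2-4)[OF \<alpha>] nat_trD(2-4)[OF \<gamma>] nat_trD(2-4)[OF \<kappa>]
  fix m assume [simp]: "m \<in> Obj C"
  let ?F = "ob (md T) m" and ?F' = "ob (md T') m"
  let ?u = "\<lambda>\<phi>. inc (mp (rt T') \<phi> \<star> cou T' m) m \<star> eva T m"
  \<comment> \<open>A common factor of both sides, with a mixed source: the Hom variable is
    \<open>md T' m\<close>, the copowered object is \<open>md T m\<close>. One side reaches it by
    \<open>pre\<close> of \<open>\<gamma> m\<close>, the other by \<open>pst\<close> of
    \<open>\<gamma> m\<close>.\<close>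
  define th where "th = induced (lf T) ?F' x ?F (P m (ob (rt T') x) m) ?u"
  have "linear_on ?F' x ?u (ob (lf T) ?F) (P m (ob (rt T') x) m)"
    by (auto simp: linear_on_def homs_def cmp_plus_left cmp_scale_left inc_plus inc_scale)
  note th [simp] = induced_simps[OF preserves_copowers_left_adjoint[OF T] _ _ _ _ this, simplified, folded th_def]
  have 1: "cov (\<alpha> x) m m \<star> thet T m x m = th \<star> mp (lf T) (pre (\<gamma> m) x ?F)"
  proof (rule copower_ext[OF preserves_copowers_left_adjoint[OF T], of ?F x ?F])
    fix \<phi> assume [simp]: "arr C \<phi>" "src \<phi> = ?F" "tgt \<phi> = x"
    have "mp (lf T) (pre (\<gamma> m) x ?F) \<star> mp (lf T) (inc \<phi> ?F) = mp (lf T) (inc (\<phi> \<star> \<gamma> m) ?F)"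
      by (subst endofunctor_simps(6)[symmetric]) simp_all
    moreover have "\<alpha> x \<star> mp (rt T) \<phi> \<star> cou T m = mp (rt T') \<phi> \<star> mp (rt T') (\<gamma> m) \<star> cou T' m"
      using nat_trD(5)[OF \<alpha>, of \<phi>, THEN cmp_reassoc] cou[of m] by simp
    ultimately show "(cov (\<alpha> x) m m \<star> thet T m x m) \<star> mp (lf T) (inc \<phi> ?F)
       = (th \<star> mp (lf T) (pre (\<gamma> m) x ?F)) \<star> mp (lf T) (inc \<phi> ?F)"
      by simp
  qed simp_all
  have 2: "thet T' m x m \<star> \<kappa> (P ?F' x ?F') = th \<star> mp (lf T) (pst ?F' x (\<gamma> m))"
  proof (rule copower_ext[OF preserves_copowers_left_adjoint[OF T], of ?F' x ?F'])
    fix \<phi> assume [simp]: "arr C \<phi>" "src \<phi> = ?F'" "tgt \<phi> = x"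
    have "mp (lf T) (pst ?F' x (\<gamma> m)) \<star> mp (lf T) (inc \<phi> ?F')
        = mp (lf T) (inc \<phi> ?F) \<star> mp (lf T) (\<gamma> m)"
      by (subst (1 2) endofunctor_simps(6)[symmetric]) simp_all
    moreover have "\<kappa> (P ?F' x ?F') \<star> mp (lf T) (inc \<phi> ?F') = mp (lf T') (inc \<phi> ?F') \<star> \<kappa> ?F'"
      using nat_trD(5)[OF \<kappa>, of "inc \<phi> ?F'"] by simp
    ultimately show "(thet T' m x m \<star> \<kappa> (P ?F' x ?F')) \<star> mp (lf T) (inc \<phi> ?F')
       = (th \<star> mp (lf T) (pst ?F' x (\<gamma> m))) \<star> mp (lf T) (inc \<phi> ?F')"
      using eva[of m] th(4)[THEN cmp_reassoc] by simp
  qed simp_all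
  have "pr (ob (rt T') x) m \<star> Nak (\<alpha> x) \<star> tau T x
      = (cov (\<alpha> x) m m \<star> thet T m x m) \<star> mp (lf T) (pr x ?F)"
    by simp
  also have "\<dots> = th \<star> mp (lf T) (pre (\<gamma> m) x ?F \<star> pr x ?F)"
    unfolding 1 by simp
  \<comment> \<open>The wedge condition of \<open>No x\<close> at \<open>\<gamma> m\<close>
    exchanges the two factorisations.\<close>
  also have "pre (\<gamma> m) x ?F \<star> pr x ?F = pst ?F' x (\<gamma> m) \<star> pr x ?F'"
    by (rule wedge) simp_all
  also have "th \<star> mp (lf T) (pst ?F' x (\<gamma> m) \<star> pr x ?F') = (thet T' m x m \<star> \<kappa> (P ?F' x ?F')) \<star> mp (lf T) (pr x ?F')"
    unfolding 2 by simp
  also have "\<dots> = thet T' m x m \<star> mp (lf T') (pr x ?F') \<star> \<kappa> (No x)"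
    using nat_trD(5)[OF \<kappa>, of "pr x ?F'"] by simp
  also have "\<dots> = pr (ob (rt T') x) m \<star> tau T' x \<star> \<kappa> (No x)"
    by (simp add: tau_simps(4)[THEN cmp_reassoc])
  finally show "pr (ob (rt T') x) m \<star> Nak (\<alpha> x) \<star> tau T x = pr (ob (rt T') x) m \<star> tau T' x \<star> \<kappa> (No x)" .
qed (use T T' x nat_trD(2-4)[OF \<alpha>] nat_trD(2-4)[OF \<kappa>] in auto)

text \<open>The component of \<open>tau S\<close> at \<open>m\<close> uses
  \<open>No (rt T x)\<close> in its component at \<open>md S m\<close>, where \<open>tau T\<close>
  is known; so the claim reduces to the corresponding factorisation of \<open>thet\<close>.\<close>

lemma tau_comp:
  assumes S: "is_triple C S" and T: "is_triple C T" and x: "x \<in> Obj C"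
  shows "tau (triple_comp C S T) x = tau S (ob (rt T) x) \<star> mp (lf S) (tau T x)"
proof (rule end_ext[of _ _ "ob (rt S) (ob (rt T) x)"])
  note ST = is_triple_comp[OF S T]
  note [simp] = S T x ST
  fix m assume [simp]: "m \<in> Obj C"
  let ?F = "ob (md S) m"
  have *: "thet (triple_comp C S T) m x m = thet S m (ob (rt T) x) m \<star> mp (lf S) (thet T ?F x ?F)"
  proof (rule copower_ext[OF preserves_copowers_left_adjoint[OF ST], of "ob (md T) ?F" x "ob (md T) ?F"])
    fix \<phi> assume [simp]: "arr C \<phi>" "src \<phi> = ob (md T) ?F" "tgt \<phi> = x"
    have 1: "thet (triple_comp C S T) m x m \<star> mp (lf (triple_comp C S T)) (inc \<phi> (ob (md T) ?F))
        = inc (mp (rt (triple_comp C S T)) \<phi> \<star> cou (triple_comp C S T) m) m \<star> eva (triple_comp C S T) m"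
      by (rule thet_simps(4)[OF ST]) simp_all
    have "mp (lf S) (thet T ?F x ?F) \<star> mp (lf S) (mp (lf T) (inc \<phi> (ob (md T) ?F)))
        = mp (lf S) (inc (mp (rt T) \<phi> \<star> cou T ?F) ?F) \<star> mp (lf S) (eva T ?F)"
      by (subst (1 2) endofunctor_simps(6)[symmetric]) simp_all
    then show "thet (triple_comp C S T) m x m \<star> mp (lf (triple_comp C S T)) (inc \<phi> (ob (md T) ?F))
       = (thet S m (ob (rt T) x) m \<star> mp (lf S) (thet T ?F x ?F)) \<star> mp (lf (triple_comp C S T)) (inc \<phi> (ob (md T) ?F))"
      unfolding 1 by simp
  qed (use thet_simps(1-3)[OF ST, of m x m] in simp_all)
  have "pr (ob (rt S) (ob (rt T) x)) m \<star> tau (triple_comp C S T) x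
     = thet (triple_comp C S T) m x m \<star> mp (lf S) (mp (lf T) (pr x (ob (md T) ?F)))"
    using tau_simps(4)[OF ST x, of m] by simp
  also have "\<dots> = thet S m (ob (rt T) x) m \<star> mp (lf S) (thet T ?F x ?F \<star> mp (lf T) (pr x (ob (md T) ?F)))"
    unfolding * by simp
  also have "thet T ?F x ?F \<star> mp (lf T) (pr x (ob (md T) ?F)) = pr (ob (rt T) x) ?F \<star> tau T x"
    by simp
  also have "thet S m (ob (rt T) x) m \<star> mp (lf S) (pr (ob (rt T) x) ?F \<star> tau T x)
     = pr (ob (rt S) (ob (rt T) x)) m \<star> tau S (ob (rt T) x) \<star> mp (lf S) (tau T x)"
    by (simp add: tau_simps(4)[THEN cmp_reassoc] del: tau_simps(4))
  finally show "pr (ob (rt S) (ob (rt T) x)) m \<star> tau (triple_comp C S T) x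
     = pr (ob (rt S) (ob (rt T) x)) m \<star> tau S (ob (rt T) x) \<star> mp (lf S) (tau T x)" .
qed (use S T x tau_simps(1-3)[OF is_triple_comp[OF S T] x] in auto)

lemma tau_id:
  assumes x: "x \<in> Obj C"
  shows "tau (triple_id C) x = idt C (No x)"
proof (rule end_ext[of _ _ x])
  note [simp] = is_triple_id x
  fix m assume [simp]: "m \<in> Obj C"
  have "thet (triple_id C) m x m = idt C (P m x m)"
  proof (rule copower_ext[of endo_id m x m])
    fix \<phi> assume [simp]: "arr C \<phi>" "src \<phi> = m" "tgt \<phi> = x"
    show "thet (triple_id C) m x m \<star> mp endo_id (inc \<phi> m) = idt C (P m x m) \<star> mp endo_id (inc \<phi> m)"
      using thet_simps(4)[OF is_triple_id, of m x m \<phi> m] by simp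
  qed (use thet_simps(1-3)[OF is_triple_id, of m x m] in auto)
  then show "pr x m \<star> tau (triple_id C) x = pr x m \<star> idt C (No x)"
    using tau_simps(4)[OF is_triple_id x, of m] by simp
qed (use x tau_simps(1-3)[OF is_triple_id x] in auto)

end

section \<open>Invertibility\<close>

text \<open>\<open>T\<close> is \<open>S\<close> shifted by one step along a chain of adjoints, so
  the two describe four consecutive functors \<open>lf T\<close>, \<open>lf S\<close>,
  \<open>md S\<close>, \<open>rt S\<close>; \<open>ev\<close> is the counit for \<open>md S\<close>
  and \<open>rt S\<close>. In the application these are the actions of the third, second and first
  iterated dual of \<open>a\<close> and of \<open>a\<close> itself.\<close>

definition is_chain :: "('o, 'm::ab_group_add, 'k, 'z) lincat_scheme \<Rightarrow> ('o, 'm) triple \<Rightarrow> ('o, 'm) triple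
    \<Rightarrow> ('o \<Rightarrow> ('o, 'm) arrow) \<Rightarrow> bool" where
  "is_chain C S T ev \<longleftrightarrow> is_triple C S \<and> is_triple C T \<and>
     md T = lf S \<and> rt T = md S \<and> cou T = uni S \<and> nat_tr C (endo_comp (md S) (rt S)) endo_id ev \<and>
     (\<forall>x\<in>Obj C. mp (rt S) (ev x) \<star>\<^bsub>C\<^esub> cou S (ob (rt S) x) = idt C (ob (rt S) x)
       \<and> ev (ob (md S) x) \<star>\<^bsub>C\<^esub> mp (md S) (cou S x) = idt C (ob (md S) x)
       \<and> mp (md S) (eva S x) \<star>\<^bsub>C\<^esub> uni S (ob (md S) x) = idt C (ob (md S) x)
       \<and> mp (lf S) (eva T x) \<star>\<^bsub>C\<^esub> uni T (ob (lf S) x) = idt C (ob (lf S) x))"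

context nakayama
begin

text \<open>The transpose, along the adjunction of \<open>lf T\<close> with \<open>lf S\<close>, of
  the map from \<open>lf T (No (rt S x))\<close> to \<open>No x\<close> given by
  \<open>tau T\<close> at \<open>rt S x\<close> followed by \<open>Nak (ev x)\<close>.\<close>

definition tau_inv :: "('o, 'm) triple \<Rightarrow> ('o, 'm) triple \<Rightarrow> ('o \<Rightarrow> ('o, 'm) arrow) \<Rightarrow> 'o \<Rightarrow> ('o, 'm) arrow" where
  "tau_inv S T ev x = mp (lf S) (Nak (ev x)) \<star> mp (lf S) (tau T (ob (rt S) x)) \<star> uni T (No (ob (rt S) x))"

text \<open>The units and counits of the chain are morphisms of triples, from the identity to
  \<open>S\<close> after \<open>T\<close> and from \<open>T\<close> after \<open>S\<close> to the
  identity, so \<open>tau_transform\<close> makes \<open>tau\<close> compatible with them. The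
  triangle identities then give an inverse by the usual calculation with duals.\<close>

lemma tau_inverse:
  assumes chain: "is_chain C S T ev" and x: "x \<in> Obj C"
  shows "tau_inv S T ev x \<in> homs C (No (ob (rt S) x)) (ob (lf S) (No x))"
    and "tau_inv S T ev x \<star> tau S x = idt C (ob (lf S) (No x))"
    and "tau S x \<star> tau_inv S T ev x = idt C (No (ob (rt S) x))"
proof -
  have S: "is_triple C S" and T: "is_triple C T" and eqs: "md T = lf S" "rt T = md S" "cou T = uni S"
    and ev: "nat_tr C (endo_comp (md S) (rt S)) endo_id ev"
    and zigzag: "\<And>x. x \<in> Obj C \<Longrightarrow> mp (rt S) (ev x) \<star> cou S (ob (rt S) x) = idt C (ob (rt S) x)"
      "\<And>x. x \<in> Obj C \<Longrightarrow> ev (ob (md S) x) \<star> mp (md S) (cou S x) = idt C (ob (md S) x)"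
      "\<And>x. x \<in> Obj C \<Longrightarrow> mp (md S) (eva S x) \<star> uni S (ob (md S) x) = idt C (ob (md S) x)"
      "\<And>x. x \<in> Obj C \<Longrightarrow> mp (lf S) (eva T x) \<star> uni T (ob (lf S) x) = idt C (ob (lf S) x)"
    using chain by (auto simp: is_chain_def)
  have T': "endofunctor C (lf T)"
    "x \<in> Obj C \<Longrightarrow> arr C (eva T x)" "x \<in> Obj C \<Longrightarrow> src (eva T x) = ob (lf T) (ob (lf S) x)"
    "x \<in> Obj C \<Longrightarrow> tgt (eva T x) = x"
    "x \<in> Obj C \<Longrightarrow> arr C (uni T x)" "x \<in> Obj C \<Longrightarrow> src (uni T x) = x"
    "x \<in> Obj C \<Longrightarrow> tgt (uni T x) = ob (lf S) (ob (lf T) x)" for x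
    using tripleD[OF T] eqs by auto
  have tauT: "arr C (tau T x)" "src (tau T x) = ob (lf T) (No x)" "tgt (tau T x) = No (ob (md S) x)"
    if "x \<in> Obj C" for x
    using tau_simps(1-3)[OF T that] eqs by auto
  note [simp] = S x T' tauT nat_trD(2-4)[OF ev, simplified] zigzag
  have nat_uni: "uni T (tgt f) \<star> f = mp (lf S) (mp (lf T) f) \<star> uni T (src f)" if "arr C f" for f
    using triple_natural(3)[OF T that refl refl] eqs by simp
  show hom: "tau_inv S T ev x \<in> homs C (No (ob (rt S) x)) (ob (lf S) (No x))"
    by (simp add: tau_inv_def homs_def)
  \<comment> \<open>The morphism from the identity triple consists of \<open>cou S\<close>,
    \<open>eva S\<close> and \<open>uni T\<close>. With naturality of \<open>tau S\<close> it yields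
    the composite \<open>tau S \<star> tau_inv\<close>.\<close>
  have I: "Nak (cou S y) = tau S (ob (md S) y) \<star> mp (lf S) (tau T y) \<star> uni T (No y)" if [simp]: "y \<in> Obj C" for y
  proof -
    have "Nak (cou S y) \<star> tau (triple_id C) y = tau (triple_comp C S T) y \<star> uni T (No y)"
    proof (rule tau_transform[of _ _ _ "eva S"])
      show "nat_tr C (lf (triple_id C)) (lf (triple_comp C S T)) (uni T)"
        "nat_tr C (md (triple_comp C S T)) (md (triple_id C)) (eva S)"
        "nat_tr C (rt (triple_id C)) (rt (triple_comp C S T)) (cou S)"
        using is_tripleD(6)[OF T] is_tripleD(4,5)[OF S] eqs by simp_all
      fix m assume [simp]: "m \<in> Obj C"
      have "mp (rt S) (mp (md S) (eva S m)) \<star> mp (rt S) (uni S (ob (md S) m))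
          = idt C (ob (rt S) (ob (md S) m))"
        by (subst endofunctor_simps(6)[symmetric]) simp_all
      from this[THEN cmp_reassoc] show "cou S (ob (md (triple_id C)) m) \<star> cou (triple_id C) m
          = mp (rt (triple_comp C S T)) (eva S m) \<star> cou (triple_comp C S T) m"
        by (simp add: eqs)
      show "eva (triple_comp C S T) m \<star> uni T (ob (md (triple_comp C S T)) m)
          = eva (triple_id C) m \<star> mp (lf (triple_id C)) (eva S m)"
        by (simp add: eqs)
    qed (use S T in \<open>auto intro: is_triple_id is_triple_comp\<close>)
    then show ?thesis
      by (simp add: tau_id tau_comp[OF S T] eqs)
  qed
  \<comment> \<open>The morphism to the identity triple consists of \<open>ev\<close>,
    \<open>uni S\<close> and \<open>eva T\<close>. With naturality of \<open>uni T\<close> it yields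
    the other composite.\<close>
  have II: "Nak (ev y) \<star> tau T (ob (rt S) y) \<star> mp (lf T) (tau S y) = eva T (No y)" if [simp]: "y \<in> Obj C" for y
  proof -
    have "Nak (ev y) \<star> tau (triple_comp C T S) y = tau (triple_id C) y \<star> eva T (No y)"
    proof (rule tau_transform[of _ _ _ "uni S"])
      show "nat_tr C (lf (triple_comp C T S)) (lf (triple_id C)) (eva T)"
        "nat_tr C (md (triple_id C)) (md (triple_comp C T S)) (uni S)"
        "nat_tr C (rt (triple_comp C T S)) (rt (triple_id C)) ev"
        using is_tripleD(5)[OF T] is_tripleD(6)[OF S] ev eqs by simp_all
      fix m assume [simp]: "m \<in> Obj C"
      show "ev (ob (md (triple_comp C T S)) m) \<star> cou (triple_comp C T S) m
          = mp (rt (triple_id C)) (uni S m) \<star> cou (triple_id C) m"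
        using zigzag(2)[of "ob (lf S) m", THEN cmp_reassoc] by (simp add: eqs)
      have "mp (lf T) (eva S (ob (lf S) m)) \<star> mp (lf T) (mp (lf S) (uni S m))
          = idt C (ob (lf T) (ob (lf S) m))"
        by (subst endofunctor_simps(6)[symmetric]) simp_all
      then show "eva (triple_id C) m \<star> eva T (ob (md (triple_id C)) m)
          = eva (triple_comp C T S) m \<star> mp (lf (triple_comp C T S)) (uni S m)"
        by (simp add: eqs)
    qed (use S T in \<open>auto intro: is_triple_id is_triple_comp\<close>)
    then show ?thesis
      by (simp add: tau_id tau_comp[OF T S] eqs)
  qed
  have "tau_inv S T ev x \<star> tau S x = mp (lf S) (Nak (ev x)) \<star> mp (lf S) (tau T (ob (rt S) x))
      \<star> mp (lf S) (mp (lf T) (tau S x)) \<star> uni T (ob (lf S) (No x))"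
    using nat_uni[of "tau S x"] by (simp add: tau_inv_def)
  also have "\<dots> = mp (lf S) (Nak (ev x) \<star> tau T (ob (rt S) x) \<star> mp (lf T) (tau S x)) \<star> uni T (ob (lf S) (No x))"
    by simp
  also have "\<dots> = idt C (ob (lf S) (No x))"
    by (subst II) simp_all
  finally show "tau_inv S T ev x \<star> tau S x = idt C (ob (lf S) (No x))" .
  have "tau S x \<star> tau_inv S T ev x
      = (tau S x \<star> mp (lf S) (Nak (ev x))) \<star> mp (lf S) (tau T (ob (rt S) x)) \<star> uni T (No (ob (rt S) x))"
    by (simp add: tau_inv_def)
  also have "tau S x \<star> mp (lf S) (Nak (ev x)) = Nak (mp (rt S) (ev x)) \<star> tau S (ob (md S) (ob (rt S) x))"
    by (rule tau_natural[symmetric]) simp_all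
  also have "(Nak (mp (rt S) (ev x)) \<star> tau S (ob (md S) (ob (rt S) x)))
       \<star> mp (lf S) (tau T (ob (rt S) x)) \<star> uni T (No (ob (rt S) x))
     = Nak (mp (rt S) (ev x)) \<star> Nak (cou S (ob (rt S) x))"
    by (simp add: I)
  also have "\<dots> = Nak (mp (rt S) (ev x) \<star> cou S (ob (rt S) x))"
    by (subst Nak_functor(6)) simp_all
  also have "\<dots> = idt C (No (ob (rt S) x))"
    by simp
  finally show "tau S x \<star> tau_inv S T ev x = idt C (No (ob (rt S) x))" .
qed

end

section \<open>Actions of monoidal categories\<close>

text \<open>An interface shared by \<open>A\<close> and by the reversal of \<open>B\<close>, so that
  the calculus of left actions is developed once.\<close>

locale weak_monoidal = linear_category A
  for A :: "('a, 'f::ab_group_add, 'k::field, 'z) moncat_scheme" (structure) +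
  assumes tensor_bilinear: "bilinear_functor A A A (tenso A) (tensm A)"
    and unit_obj [simp]: "Unit A \<in> Obj A"
    and assoc_iso: "\<lbrakk>a \<in> Obj A; b \<in> Obj A; c \<in> Obj A\<rbrakk>
          \<Longrightarrow> is_iso A ((a \<otimes>\<^sub>o b) \<otimes>\<^sub>o c) (a \<otimes>\<^sub>o (b \<otimes>\<^sub>o c)) (assoc A a b c)"
    and lunit_iso: "a \<in> Obj A \<Longrightarrow> is_iso A (Unit A \<otimes>\<^sub>o a) a (lunit A a)"
    and runit_iso: "a \<in> Obj A \<Longrightarrow> is_iso A (a \<otimes>\<^sub>o Unit A) a (runit A a)"
    and triangle: "\<lbrakk>a \<in> Obj A; b \<in> Obj A\<rbrakk>
          \<Longrightarrow> (Idn A a \<otimes>\<^sub>m lunit A b) \<cdot> assoc A a (Unit A) b = runit A a \<otimes>\<^sub>m Idn A b"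
begin

definition ten :: "('a, 'f) arrow \<Rightarrow> ('a, 'f) arrow \<Rightarrow> ('a, 'f) arrow" where
  "ten f g = Arr (src f \<otimes>\<^sub>o src g) (mor f \<otimes>\<^sub>m mor g) (tgt f \<otimes>\<^sub>o tgt g)"

definition "ass a b c = Arr ((a \<otimes>\<^sub>o b) \<otimes>\<^sub>o c) (assoc A a b c) (a \<otimes>\<^sub>o (b \<otimes>\<^sub>o c))"
definition "assi a b c = Arr (a \<otimes>\<^sub>o (b \<otimes>\<^sub>o c)) (inv_mor A (assoc A a b c)) ((a \<otimes>\<^sub>o b) \<otimes>\<^sub>o c)"
definition "lu a = Arr (Unit A \<otimes>\<^sub>o a) (lunit A a) a"
definition "lui a = Arr a (inv_mor A (lunit A a)) (Unit A \<otimes>\<^sub>o a)"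
definition "ru a = Arr (a \<otimes>\<^sub>o Unit A) (runit A a) a"
definition "rui a = Arr a (inv_mor A (runit A a)) (a \<otimes>\<^sub>o Unit A)"

lemma tenso_obj [simp]: "a \<in> Obj A \<Longrightarrow> b \<in> Obj A \<Longrightarrow> a \<otimes>\<^sub>o b \<in> Obj A"
  using tensor_bilinear by (simp add: bilinear_functor_def)

lemma ten_simps [simp]:
  "arr A f \<Longrightarrow> arr A g \<Longrightarrow> arr A (ten f g)"
  "src (ten f g) = src f \<otimes>\<^sub>o src g" "tgt (ten f g) = tgt f \<otimes>\<^sub>o tgt g" "mor (ten f g) = mor f \<otimes>\<^sub>m mor g"
  "a \<in> Obj A \<Longrightarrow> b \<in> Obj A \<Longrightarrow> ten (idt A a) (idt A b) = idt A (a \<otimes>\<^sub>o b)"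
  using tensor_bilinear arr_mor[of A f] arr_mor[of A g] by (auto simp: ten_def bilinear_functor_def idt_def)

lemma constraint_simps [simp]:
  "src (ass a b c) = (a \<otimes>\<^sub>o b) \<otimes>\<^sub>o c" "tgt (ass a b c) = a \<otimes>\<^sub>o (b \<otimes>\<^sub>o c)" "mor (ass a b c) = assoc A a b c"
  "src (assi a b c) = a \<otimes>\<^sub>o (b \<otimes>\<^sub>o c)" "tgt (assi a b c) = (a \<otimes>\<^sub>o b) \<otimes>\<^sub>o c"
  "mor (assi a b c) = inv_mor A (assoc A a b c)"
  "src (lu a) = Unit A \<otimes>\<^sub>o a" "tgt (lu a) = a" "mor (lu a) = lunit A a"
  "src (lui a) = a" "tgt (lui a) = Unit A \<otimes>\<^sub>o a" "mor (lui a) = inv_mor A (lunit A a)"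
  "src (ru a) = a \<otimes>\<^sub>o Unit A" "tgt (ru a) = a" "mor (ru a) = runit A a"
  "src (rui a) = a" "tgt (rui a) = a \<otimes>\<^sub>o Unit A" "mor (rui a) = inv_mor A (runit A a)"
  by (simp_all add: ass_def assi_def lu_def lui_def ru_def rui_def)

lemma constraint_arr [simp]:
  assumes "a \<in> Obj A"
  shows "b \<in> Obj A \<Longrightarrow> c \<in> Obj A \<Longrightarrow> arr A (ass a b c)" "b \<in> Obj A \<Longrightarrow> c \<in> Obj A \<Longrightarrow> arr A (assi a b c)"
    "arr A (lu a)" "arr A (lui a)" "arr A (ru a)" "arr A (rui a)"
  using assms iso_arrows[OF assoc_iso[of a b c]] iso_arrows[OF lunit_iso[of a]] iso_arrows[OF runit_iso[of a]]
  by (simp_all add: ass_def assi_def lu_def lui_def ru_def rui_def)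

lemma constraint_inverse [simp]:
  assumes "a \<in> Obj A"
  shows "b \<in> Obj A \<Longrightarrow> c \<in> Obj A \<Longrightarrow> ass a b c \<star> assi a b c = idt A (a \<otimes>\<^sub>o (b \<otimes>\<^sub>o c))"
    "b \<in> Obj A \<Longrightarrow> c \<in> Obj A \<Longrightarrow> assi a b c \<star> ass a b c = idt A ((a \<otimes>\<^sub>o b) \<otimes>\<^sub>o c)"
    "lu a \<star> lui a = idt A a" "lui a \<star> lu a = idt A (Unit A \<otimes>\<^sub>o a)"
    "ru a \<star> rui a = idt A a" "rui a \<star> ru a = idt A (a \<otimes>\<^sub>o Unit A)"
  using assms iso_arrows[OF assoc_iso[of a b c]] iso_arrows[OF lunit_iso[of a]] iso_arrows[OF runit_iso[of a]]
  by (simp_all add: ass_def assi_def lu_def lui_def ru_def rui_def)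

lemma triangle_arr:
  assumes "a \<in> Obj A" "b \<in> Obj A"
  shows "ten (idt A a) (lu b) \<star> ass a (Unit A) b = ten (ru a) (idt A b)"
  using assms triangle[OF assms] by (intro arr_eqI[of A]) (auto simp: mor_cmp)

definition mate :: "'a \<Rightarrow> 'a \<Rightarrow> 'a \<Rightarrow> ('a, 'f) arrow \<Rightarrow> ('a, 'f) arrow \<Rightarrow> ('a, 'f) arrow \<Rightarrow> ('a, 'f) arrow" where
  "mate d X Y e h f = lu X \<star> ten e (idt A X) \<star> assi Y d X \<star> ten (idt A Y) (ten f (idt A X))
     \<star> ten (idt A Y) h \<star> rui Y"

lemma mate_simps:
  assumes "c \<in> Obj A" "d \<in> Obj A" "X \<in> Obj A" "Y \<in> Obj A"
    "e \<in> homs A (Y \<otimes>\<^sub>o d) (Unit A)" "h \<in> homs A (Unit A) (c \<otimes>\<^sub>o X)" "f \<in> homs A c d"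
  shows "mate d X Y e h f \<in> homs A Y X"
    and "mor (mate d X Y e h f) = rmate A d X Y (mor e) (mor h) (mor f)"
  using assms by (auto simp: mate_def rmate_def homs_def mor_cmp)

end

text \<open>The action is given by separate parameters rather than by a \<open>bimodcat\<close>
  record, so that a right action with its arguments swapped is an instance too.\<close>

locale lmod = A: weak_monoidal A + linear_category C
  for A :: "('a, 'f::ab_group_add, 'k::field, 'z) moncat_scheme"
    and C :: "('o, 'm::ab_group_add, 'k, 'y) lincat_scheme" (structure) +
  fixes acto :: "'a \<Rightarrow> 'o \<Rightarrow> 'o" and actm :: "'f \<Rightarrow> 'm \<Rightarrow> 'm"
    and lass :: "'a \<Rightarrow> 'a \<Rightarrow> 'o \<Rightarrow> 'm" and lun :: "'o \<Rightarrow> 'm"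
  assumes act_bilinear: "bilinear_functor A C C acto actm"
    and lass_iso: "\<lbrakk>a \<in> Obj A; a' \<in> Obj A; m \<in> Obj C\<rbrakk>
          \<Longrightarrow> is_iso C (acto (a \<otimes>\<^sub>o\<^bsub>A\<^esub> a') m) (acto a (acto a' m)) (lass a a' m)"
    and lass_natural: "\<lbrakk>a \<in> Obj A; a' \<in> Obj A; m \<in> Obj C; c \<in> Obj A; c' \<in> Obj A; n \<in> Obj C;
          f \<in> Hom A a c; f' \<in> Hom A a' c'; h \<in> Hom C m n\<rbrakk>
          \<Longrightarrow> lass c c' n \<cdot> actm (f \<otimes>\<^sub>m\<^bsub>A\<^esub> f') h = actm f (actm f' h) \<cdot> lass a a' m"
    and lun_iso: "m \<in> Obj C \<Longrightarrow> is_iso C (acto (Unit A) m) m (lun m)"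
    and lun_natural: "\<lbrakk>m \<in> Obj C; n \<in> Obj C; h \<in> Hom C m n\<rbrakk>
          \<Longrightarrow> lun n \<cdot> actm (Idn A (Unit A)) h = h \<cdot> lun m"
    and act_pentagon: "\<lbrakk>a \<in> Obj A; b \<in> Obj A; c \<in> Obj A; m \<in> Obj C\<rbrakk>
          \<Longrightarrow> actm (Idn A a) (lass b c m) \<cdot> lass a (b \<otimes>\<^sub>o\<^bsub>A\<^esub> c) m \<cdot> actm (assoc A a b c) (Idn C m)
            = lass a b (acto c m) \<cdot> lass (a \<otimes>\<^sub>o\<^bsub>A\<^esub> b) c m"
    and act_triangle: "\<lbrakk>a \<in> Obj A; m \<in> Obj C\<rbrakk>
          \<Longrightarrow> actm (Idn A a) (lun m) \<cdot> lass a (Unit A) m = actm (runit A a) (Idn C m)"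
begin

definition act :: "('a, 'f) arrow \<Rightarrow> ('o, 'm) arrow \<Rightarrow> ('o, 'm) arrow" where
  "act f h = Arr (acto (src f) (src h)) (actm (mor f) (mor h)) (acto (tgt f) (tgt h))"

text \<open>\<open>wl\<close> and \<open>wr\<close> are the two whiskerings of the action. Every
  \<open>act f h\<close> splits into them in either order (\<open>act_wr_wl\<close>), and the later
  calculations are carried out with whiskerings.\<close>

definition "wl a h = act (idt A a) h"
definition "wr f m = act f (idt C m)"
definition "la a b m = Arr (acto (a \<otimes>\<^sub>o\<^bsub>A\<^esub> b) m) (lass a b m) (acto a (acto b m))"
definition "lai a b m = Arr (acto a (acto b m)) (inv_mor C (lass a b m)) (acto (a \<otimes>\<^sub>o\<^bsub>A\<^esub> b) m)"
definition "lnt m = Arr (acto (Unit A) m) (lun m) m"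
definition "lnti m = Arr m (inv_mor C (lun m)) (acto (Unit A) m)"

lemma acto_obj [simp]: "a \<in> Obj A \<Longrightarrow> m \<in> Obj C \<Longrightarrow> acto a m \<in> Obj C"
  using act_bilinear by (simp add: bilinear_functor_def)

lemma act_simps:
  "arr A f \<Longrightarrow> arr C h \<Longrightarrow> arr C (act f h)"
  "src (act f h) = acto (src f) (src h)" "tgt (act f h) = acto (tgt f) (tgt h)" "mor (act f h) = actm (mor f) (mor h)"
  "a \<in> Obj A \<Longrightarrow> m \<in> Obj C \<Longrightarrow> act (idt A a) (idt C m) = idt C (acto a m)"
  using act_bilinear arr_mor[of A f] arr_mor[of C h] by (auto simp: act_def bilinear_functor_def idt_def)

lemma actm_comp:
  assumes "x \<in> Obj A" "x' \<in> Obj A" "x'' \<in> Obj A" "f \<in> Hom A x x'" "f' \<in> Hom A x' x''"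
    "y \<in> Obj C" "y' \<in> Obj C" "y'' \<in> Obj C" "g \<in> Hom C y y'" "g' \<in> Hom C y' y''"
  shows "actm (f' \<cdot>\<^bsub>A\<^esub> f) (g' \<cdot> g) = actm f' g' \<cdot> actm f g"
  by (rule act_bilinear[unfolded bilinear_functor_def, THEN conjunct2, THEN conjunct2, THEN conjunct2,
        THEN conjunct1, rule_format, OF assms(1-5,6-10)])

lemma actm_linear:
  assumes "x \<in> Obj A" "x' \<in> Obj A" "f \<in> Hom A x x'" "y \<in> Obj C" "y' \<in> Obj C" "g \<in> Hom C y y'"
  shows "g' \<in> Hom C y y' \<Longrightarrow> actm f (g + g') = actm f g + actm f g'"
    and "actm f (Scale C r g) = Scale C r (actm f g)"
  by (rule act_bilinear[unfolded bilinear_functor_def, THEN conjunct2, THEN conjunct2, THEN conjunct2,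
        THEN conjunct2, THEN conjunct2, THEN conjunct1, rule_format, OF assms],
      assumption,
      rule act_bilinear[unfolded bilinear_functor_def, THEN conjunct2, THEN conjunct2, THEN conjunct2,
        THEN conjunct2, THEN conjunct2, THEN conjunct2, rule_format, OF assms, THEN conjunct2])

lemma act_cmp:
  assumes "arr A f" "arr A f'" "src f' = tgt f" "arr C h" "arr C h'" "src h' = tgt h"
  shows "act (f' \<star>\<^bsub>A\<^esub> f) (h' \<star> h) = act f' h' \<star> act f h"
proof (rule arr_eqI[of C])
  show "mor (act (f' \<star>\<^bsub>A\<^esub> f) (h' \<star> h)) = mor (act f' h' \<star> act f h)"
    using assms actm_comp[OF _ _ _ arr_mor[of A f] _ _ _ _ arr_mor[of C h], of "tgt f'" "mor f'" "tgt h'" "mor h'"]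
      arr_mor[of A f'] arr_mor[of C h'] arr_src[of A f] arr_tgt[of A f] arr_tgt[of A f'] arr_src[of C h] arr_tgt[of C h]
      arr_tgt[of C h']
    by (simp add: mor_cmp act_simps A.mor_cmp)
qed (use assms in \<open>auto simp: act_simps\<close>)

lemma act_linear:
  assumes "arr A f" "arr C h"
  shows "arr C h' \<Longrightarrow> src h' = src h \<Longrightarrow> tgt h' = tgt h \<Longrightarrow> act f (h \<boxplus> h') = act f h \<boxplus> act f h'"
    "act f (scale_arr C r h) = scale_arr C r (act f h)"
  using assms actm_linear[OF arr_src[of A f] arr_tgt[of A f] arr_mor[of A f] arr_src[of C h] arr_tgt[of C h] arr_mor[of C h]]
    arr_mor[of C h']
  by (simp_all add: act_def plus_arr_def scale_arr_def)

lemma w_simps [simp]: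
  "a \<in> Obj A \<Longrightarrow> arr C h \<Longrightarrow> arr C (wl a h)"
  "src (wl a h) = acto a (src h)" "tgt (wl a h) = acto a (tgt h)"
  "a \<in> Obj A \<Longrightarrow> m \<in> Obj C \<Longrightarrow> wl a (idt C m) = idt C (acto a m)"
  "arr A f \<Longrightarrow> m \<in> Obj C \<Longrightarrow> arr C (wr f m)"
  "src (wr f m) = acto (src f) m" "tgt (wr f m) = acto (tgt f) m"
  "a \<in> Obj A \<Longrightarrow> m \<in> Obj C \<Longrightarrow> wr (idt A a) m = idt C (acto a m)"
  "arr C h \<Longrightarrow> a \<in> Obj A \<Longrightarrow> arr C h' \<Longrightarrow> src h' = src h \<Longrightarrow> tgt h' = tgt h \<Longrightarrow> wl a (h \<boxplus> h') = wl a h \<boxplus> wl a h'"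
  "arr C h \<Longrightarrow> a \<in> Obj A \<Longrightarrow> wl a (scale_arr C r h) = scale_arr C r (wl a h)"
  by (simp_all add: wl_def wr_def act_simps act_linear)

lemma wl_cmp [simp]:
  "a \<in> Obj A \<Longrightarrow> arr C h \<Longrightarrow> arr C g \<Longrightarrow> src g = tgt h \<Longrightarrow> wl a (g \<star> h) = wl a g \<star> wl a h"
  using act_cmp[of "idt A a" "idt A a" h g] by (simp add: wl_def)

lemma wr_cmp [simp]:
  "m \<in> Obj C \<Longrightarrow> arr A f \<Longrightarrow> arr A g \<Longrightarrow> src g = tgt f \<Longrightarrow> wr (g \<star>\<^bsub>A\<^esub> f) m = wr g m \<star> wr f m"
  using act_cmp[of f g "idt C m" "idt C m"] by (simp add: wr_def)

lemma act_wr_wl: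
  assumes "arr A f" "arr C h"
  shows "act f h = wr f (tgt h) \<star> wl (src f) h" "act f h = wl (tgt f) h \<star> wr f (src h)"
  using act_cmp[of "idt A (src f)" f h "idt C (tgt h)"] act_cmp[of f "idt A (tgt f)" "idt C (src h)" h] assms
  by (simp_all add: wr_def wl_def)

lemma interchange:
  assumes "arr A f" "src f = a" "tgt f = b" "arr C h" "src h = m" "tgt h = n"
  shows "wr f n \<star> wl a h = wl b h \<star> wr f m"
  using act_wr_wl[of f h] assms by simp

lemma l_simps [simp]:
  "src (la a b m) = acto (a \<otimes>\<^sub>o\<^bsub>A\<^esub> b) m" "tgt (la a b m) = acto a (acto b m)" "mor (la a b m) = lass a b m"
  "src (lai a b m) = acto a (acto b m)" "tgt (lai a b m) = acto (a \<otimes>\<^sub>o\<^bsub>A\<^esub> b) m"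
  "src (lnt m) = acto (Unit A) m" "tgt (lnt m) = m" "mor (lnt m) = lun m"
  "src (lnti m) = m" "tgt (lnti m) = acto (Unit A) m"
  by (simp_all add: la_def lai_def lnt_def lnti_def)

lemma l_arr [simp]:
  assumes "m \<in> Obj C"
  shows "a \<in> Obj A \<Longrightarrow> b \<in> Obj A \<Longrightarrow> arr C (la a b m)" "a \<in> Obj A \<Longrightarrow> b \<in> Obj A \<Longrightarrow> arr C (lai a b m)"
    "arr C (lnt m)" "arr C (lnti m)"
  using assms iso_arrows[OF lass_iso[of a b m]] iso_arrows[OF lun_iso[of m]]
  by (simp_all add: la_def lai_def lnt_def lnti_def)

lemma l_inverse [simp]:
  assumes "m \<in> Obj C"
  shows "a \<in> Obj A \<Longrightarrow> b \<in> Obj A \<Longrightarrow> la a b m \<star> lai a b m = idt C (acto a (acto b m))"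
    "a \<in> Obj A \<Longrightarrow> b \<in> Obj A \<Longrightarrow> lai a b m \<star> la a b m = idt C (acto (a \<otimes>\<^sub>o\<^bsub>A\<^esub> b) m)"
    "lnt m \<star> lnti m = idt C m" "lnti m \<star> lnt m = idt C (acto (Unit A) m)"
  using assms iso_arrows[OF lass_iso[of a b m]] iso_arrows[OF lun_iso[of m]]
  by (simp_all add: la_def lai_def lnt_def lnti_def)

lemma l_inverse2 [simp]:
  assumes "m \<in> Obj C"
  shows "a \<in> Obj A \<Longrightarrow> b \<in> Obj A \<Longrightarrow> arr C z \<Longrightarrow> tgt z = acto a (acto b m) \<Longrightarrow> la a b m \<star> lai a b m \<star> z = z"
    "a \<in> Obj A \<Longrightarrow> b \<in> Obj A \<Longrightarrow> arr C z \<Longrightarrow> tgt z = acto (a \<otimes>\<^sub>o\<^bsub>A\<^esub> b) m \<Longrightarrow> lai a b m \<star> la a b m \<star> z = z"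
    "arr C z \<Longrightarrow> tgt z = m \<Longrightarrow> lnt m \<star> lnti m \<star> z = z"
    "arr C z \<Longrightarrow> tgt z = acto (Unit A) m \<Longrightarrow> lnti m \<star> lnt m \<star> z = z"
  using l_inverse[OF assms, THEN cmp_reassoc] by simp_all

lemma wl_inverse [simp]:
  assumes "c \<in> Obj A" "arr C f" "arr C g" "src f = tgt g" "f \<star> g = idt C x" "x \<in> Obj C"
  shows "wl c f \<star> wl c g = idt C (acto c x)"
    "arr C z \<Longrightarrow> tgt z = acto c x \<Longrightarrow> wl c f \<star> wl c g \<star> z = z"
proof -
  show *: "wl c f \<star> wl c g = idt C (acto c x)"
    using wl_cmp[of c g f] assms by (simp del: wl_cmp)
  show "arr C z \<Longrightarrow> tgt z = acto c x \<Longrightarrow> wl c f \<star> wl c g \<star> z = z"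
    using *[THEN cmp_reassoc] assms by simp
qed

lemma la_natural:
  assumes "a \<in> Obj A" "b \<in> Obj A" "arr C h" "src h = m" "tgt h = n"
  shows "la a b n \<star> wl (a \<otimes>\<^sub>o\<^bsub>A\<^esub> b) h = wl a (wl b h) \<star> la a b m"
proof -
  have "a \<otimes>\<^sub>o\<^bsub>A\<^esub> b \<in> Obj A" "m \<in> Obj C" "n \<in> Obj C" using assms by auto
  moreover have "Idn A a \<otimes>\<^sub>m\<^bsub>A\<^esub> Idn A b = Idn A (a \<otimes>\<^sub>o\<^bsub>A\<^esub> b)"
    using A.tensor_bilinear assms by (simp add: bilinear_functor_def)
  ultimately show ?thesis
    using assms lass_natural[of a b m a b n "Idn A a" "Idn A b" "mor h"] arr_mor[of C h]
    by (intro arr_eqI[of C]) (auto simp: mor_cmp wl_def act_simps A.id_hom)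
qed

lemma lai_natural:
  assumes "a \<in> Obj A" "b \<in> Obj A" "arr C h" "src h = m" "tgt h = n"
  shows "wl (a \<otimes>\<^sub>o\<^bsub>A\<^esub> b) h \<star> lai a b m = lai a b n \<star> wl a (wl b h)"
proof -
  have [simp]: "m \<in> Obj C" "n \<in> Obj C" using assms by auto
  have "wl (a \<otimes>\<^sub>o\<^bsub>A\<^esub> b) h \<star> lai a b m = lai a b n \<star> (la a b n \<star> wl (a \<otimes>\<^sub>o\<^bsub>A\<^esub> b) h) \<star> lai a b m"
    using assms by simp
  also have "\<dots> = lai a b n \<star> wl a (wl b h)"
    unfolding la_natural[OF assms] using assms by simp
  finally show ?thesis .
qed

text \<open>Naturality of the action constraint, solved for the tensor product. This and the rules
  for \<open>wr\<close> of the constraints and their inverses rewrite the action of a composite in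
  \<open>A\<close> into action constraints, so that identities in \<open>A\<close> turn into
  identities between transformations by simplification.\<close>

lemma wr_ten:
  assumes m: "m \<in> Obj C" and f: "arr A f" and g: "arr A g"
  shows "wr (A.ten f g) m = lai (tgt f) (tgt g) m \<star> act f (wr g m) \<star> la (src f) (src g) m"
proof -
  have "la (tgt f) (tgt g) m \<star> wr (A.ten f g) m = act f (wr g m) \<star> la (src f) (src g) m"
    using assms lass_natural[of "src f" "src g" m "tgt f" "tgt g" m "mor f" "mor g" "Idn C m"]
      arr_mor[of A f] arr_mor[of A g]
    by (intro arr_eqI[of C]) (auto simp: mor_cmp wr_def act_simps id_hom)
  from arg_cong[OF this, of "\<lambda>z. lai (tgt f) (tgt g) m \<star> z"] show ?thesis
    using assms by (simp add: act_simps)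
qed

lemma wr_ten_left [simp]:
  assumes "m \<in> Obj C" "arr A f" "b \<in> Obj A"
  shows "wr (A.ten f (idt A b)) m = lai (tgt f) b m \<star> wr f (acto b m) \<star> la (src f) b m"
  using wr_ten[of m f "idt A b"] act_wr_wl[of f "idt C (acto b m)"] assms by simp

lemma wr_ten_right [simp]:
  assumes "m \<in> Obj C" "arr A g" "a \<in> Obj A"
  shows "wr (A.ten (idt A a) g) m = lai a (tgt g) m \<star> wl a (wr g m) \<star> la a (src g) m"
  using wr_ten[of m "idt A a" g] assms by (simp add: wl_def)

lemma lnt_natural:
  assumes "arr C h" "src h = m" "tgt h = n"
  shows "lnt n \<star> wl (Unit A) h = h \<star> lnt m"
proof -
  have [simp]: "m \<in> Obj C" "n \<in> Obj C" using assms by auto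
  then show ?thesis using assms lun_natural[of m n "mor h"] arr_mor[of C h]
    by (intro arr_eqI[of C]) (auto simp: mor_cmp wl_def act_simps)
qed

lemma lnti_natural:
  assumes "arr C h" "src h = m" "tgt h = n"
  shows "wl (Unit A) h \<star> lnti m = lnti n \<star> h"
proof -
  have [simp]: "m \<in> Obj C" "n \<in> Obj C" using assms by auto
  have "wl (Unit A) h \<star> lnti m = lnti n \<star> (lnt n \<star> wl (Unit A) h) \<star> lnti m" using assms by simp
  also have "\<dots> = lnti n \<star> h" unfolding lnt_natural[OF assms] using assms by simp
  finally show ?thesis .
qed

lemma wr_ru [simp]:
  assumes "a \<in> Obj A" "m \<in> Obj C"
  shows "wr (A.ru a) m = wl a (lnt m) \<star> la a (Unit A) m"
  using act_triangle[OF assms] assms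
  by (intro arr_eqI[of C]) (auto simp: mor_cmp wr_def wl_def act_simps)

lemma pentagon_arr:
  assumes "a \<in> Obj A" "b \<in> Obj A" "c \<in> Obj A" "m \<in> Obj C"
  shows "wl a (la b c m) \<star> la a (b \<otimes>\<^sub>o\<^bsub>A\<^esub> c) m \<star> wr (A.ass a b c) m = la a b (acto c m) \<star> la (a \<otimes>\<^sub>o\<^bsub>A\<^esub> b) c m"
  using act_pentagon[OF assms] assms
  by (intro arr_eqI[of C]) (auto simp: mor_cmp wr_def wl_def act_simps)

text \<open>The pentagon of the action, solved for the associator.\<close>

lemma wr_ass [simp]:
  assumes "a \<in> Obj A" "b \<in> Obj A" "c \<in> Obj A" "m \<in> Obj C"
  shows "wr (A.ass a b c) m = lai a (b \<otimes>\<^sub>o\<^bsub>A\<^esub> c) m \<star> wl a (lai b c m) \<star> la a b (acto c m) \<star> la (a \<otimes>\<^sub>o\<^bsub>A\<^esub> b) c m"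
  using arg_cong[OF pentagon_arr[OF assms], of "\<lambda>z. lai a (b \<otimes>\<^sub>o\<^bsub>A\<^esub> c) m \<star> wl a (lai b c m) \<star> z"] assms by simp

text \<open>\<open>wr g m\<close> is a right inverse of \<open>F\<close> and \<open>F'\<close> is a
  left inverse, so they agree. This transfers the formula for the action of a constraint to that of
  its inverse.\<close>

lemma wr_inverse:
  assumes fg: "f \<star>\<^bsub>A\<^esub> g = idt A y" "arr A f" "arr A g" "src f = tgt g" and m: "m \<in> Obj C"
    and F: "wr f m = F" "F' \<star> F = idt C (acto (src f) m)" and F': "arr C F'" and y: "y \<in> Obj A"
  shows "wr g m = F'"
proof -
  have "arr C F" "tgt F = acto y m" using fg m F(1) by (metis w_simps(5), metis A.tgt_cmp w_simps(7) tgt_idt)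
  have "src F' = tgt F" using F(2) by (metis arr_cmp arr_idt acto_obj arr_src fg(2) m)
  have "F \<star> wr g m = idt C (acto y m)" using wr_cmp[OF m fg(3,2,4)] fg(1) F(1) m y by simp
  then have "F' \<star> (F \<star> wr g m) = F'" using F' \<open>src F' = tgt F\<close> \<open>tgt F = _\<close> by simp
  then show ?thesis using F(2)[THEN cmp_reassoc, of "wr g m"] fg m by simp
qed

lemma wr_rui [simp]:
  assumes "a \<in> Obj A" "m \<in> Obj C"
  shows "wr (A.rui a) m = lai a (Unit A) m \<star> wl a (lnti m)"
  by (rule wr_inverse[OF A.constraint_inverse(5) _ _ _ _ wr_ru]) (use assms in auto)

lemma wr_assi [simp]:
  assumes "a \<in> Obj A" "b \<in> Obj A" "c \<in> Obj A" "m \<in> Obj C"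
  shows "wr (A.assi a b c) m = lai (a \<otimes>\<^sub>o\<^bsub>A\<^esub> b) c m \<star> lai a b (acto c m) \<star> wl a (la b c m) \<star> la a (b \<otimes>\<^sub>o\<^bsub>A\<^esub> c) m"
  by (rule wr_inverse[OF A.constraint_inverse(1) _ _ _ _ wr_ass]) (use assms in auto)

text \<open>
  Kelly's argument: after acting with the unit, the two sides become equal by the pentagon and the
  triangles of \<open>A\<close> and of the action, and acting with the unit is faithful.
\<close>

lemma wr_lu [simp]:
  assumes a: "a \<in> Obj A" and m: "m \<in> Obj C"
  shows "wr (A.lu a) m = lnt (acto a m) \<star> la (Unit A) a m"
proof -
  let ?I = "Unit A"
  note [simp] = a m
  have "wr (A.ten (idt A ?I) (A.lu a)) m \<star> wr (A.ass ?I ?I a) m = wr (A.ten (A.ru ?I) (idt A a)) m"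
    by (subst wr_cmp[symmetric]) (simp_all add: A.triangle_arr del: wr_ten_left wr_ten_right)
  then have "lai ?I a m \<star> wl ?I (wr (A.lu a) m) \<star> wl ?I (lai ?I a m) \<star> la ?I ?I (acto a m) \<star> la (?I \<otimes>\<^sub>o\<^bsub>A\<^esub> ?I) a m
    = lai ?I a m \<star> wl ?I (lnt (acto a m)) \<star> la ?I ?I (acto a m) \<star> la (?I \<otimes>\<^sub>o\<^bsub>A\<^esub> ?I) a m"
    by simp
  from arg_cong[OF this, of "\<lambda>z. la ?I a m \<star> z \<star> lai (?I \<otimes>\<^sub>o\<^bsub>A\<^esub> ?I) a m \<star> lai ?I ?I (acto a m) \<star> wl ?I (la ?I a m)"]
  have eq: "wl ?I (wr (A.lu a) m) = wl ?I (lnt (acto a m) \<star> la ?I a m)"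
    by simp
  have "wr (A.lu a) m \<star> lnt (acto (?I \<otimes>\<^sub>o\<^bsub>A\<^esub> a) m) = (lnt (acto a m) \<star> la ?I a m) \<star> lnt (acto (?I \<otimes>\<^sub>o\<^bsub>A\<^esub> a) m)"
    using lnt_natural[of "wr (A.lu a) m"] lnt_natural[of "lnt (acto a m) \<star> la ?I a m"] eq by simp
  from arg_cong[OF this, of "\<lambda>z. z \<star> lnti (acto (?I \<otimes>\<^sub>o\<^bsub>A\<^esub> a) m)"] show ?thesis by simp
qed

lemma wr_lui [simp]:
  assumes "a \<in> Obj A" "m \<in> Obj C"
  shows "wr (A.lui a) m = lai (Unit A) a m \<star> lnti (acto a m)"
  by (rule wr_inverse[OF A.constraint_inverse(3) _ _ _ _ wr_lu]) (use assms in auto)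

end

section \<open>Duals of tensor products as arrows\<close>

context weak_monoidal
begin

definition "TE a b X Y eX eY = eY \<star> ten (idt A Y) (lu b) \<star> ten (idt A Y) (ten eX (idt A b))
   \<star> ten (idt A Y) (assi X a b) \<star> ass Y X (a \<otimes>\<^sub>o b)"

text \<open>
  \<open>TE'\<close> and \<open>TH'\<close> are \<open>TE\<close> and \<open>TH\<close> with the opposite bracketing. They are what \<open>tens_ev\<close> and
  \<open>tens_coev\<close> of a monoidal category become in the reversed category.
\<close>

definition "TE' a b X Y eX eY = eY \<star> ten (ru Y) (idt A b) \<star> ten (ten (idt A Y) eX) (idt A b)
   \<star> ten (ass Y X a) (idt A b) \<star> assi (Y \<otimes>\<^sub>o X) a b"

definition "TH a b X Y hX hY = assi a b (Y \<otimes>\<^sub>o X) \<star> ten (idt A a) (ass b Y X)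
   \<star> ten (idt A a) (ten hY (idt A X)) \<star> ten (idt A a) (lui X) \<star> hX"

definition "TH' a b X Y hX hY = ass (a \<otimes>\<^sub>o b) Y X \<star> ten (assi a b Y) (idt A X)
   \<star> ten (ten (idt A a) hY) (idt A X) \<star> ten (rui a) (idt A X) \<star> hX"

lemma tens_simps:
  assumes "a \<in> Obj A" "b \<in> Obj A" "X \<in> Obj A" "Y \<in> Obj A"
    and e: "eX \<in> homs A (X \<otimes>\<^sub>o a) (Unit A)" "eY \<in> homs A (Y \<otimes>\<^sub>o b) (Unit A)"
    and h: "hX \<in> homs A (Unit A) (a \<otimes>\<^sub>o X)" "hY \<in> homs A (Unit A) (b \<otimes>\<^sub>o Y)"
  shows "TE a b X Y eX eY \<in> homs A ((Y \<otimes>\<^sub>o X) \<otimes>\<^sub>o (a \<otimes>\<^sub>o b)) (Unit A)"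
    "TE' a b X Y eX eY \<in> homs A ((Y \<otimes>\<^sub>o X) \<otimes>\<^sub>o (a \<otimes>\<^sub>o b)) (Unit A)"
    "TH a b X Y hX hY \<in> homs A (Unit A) ((a \<otimes>\<^sub>o b) \<otimes>\<^sub>o (Y \<otimes>\<^sub>o X))"
    "TH' a b X Y hX hY \<in> homs A (Unit A) ((a \<otimes>\<^sub>o b) \<otimes>\<^sub>o (Y \<otimes>\<^sub>o X))"
    "mor (TE a b X Y eX eY) = tens_ev A a b X Y (mor eX) (mor eY)"
    "mor (TH a b X Y hX hY) = tens_coev A a b X Y (mor hX) (mor hY)"
  using assms by (auto simp: homs_def TE_def TE'_def TH_def TH'_def tens_ev_def tens_coev_def mor_cmp)

definition dual_arrows :: "'a \<Rightarrow> 'a \<Rightarrow> ('a, 'f) arrow \<Rightarrow> ('a, 'f) arrow \<Rightarrow> bool" where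
  "dual_arrows c X e h \<longleftrightarrow> c \<in> Obj A \<and> X \<in> Obj A \<and>
     e \<in> homs A (X \<otimes>\<^sub>o c) (Unit A) \<and> h \<in> homs A (Unit A) (c \<otimes>\<^sub>o X) \<and>
     ru c \<star> ten (idt A c) e \<star> ass c X c \<star> ten h (idt A c) \<star> lui c = idt A c \<and>
     lu X \<star> ten e (idt A X) \<star> assi X c X \<star> ten (idt A X) h \<star> rui X = idt A X"

lemma dual_arrowsD:
  assumes "dual_arrows c X e h"
  shows "c \<in> Obj A" "X \<in> Obj A" "arr A e" "src e = X \<otimes>\<^sub>o c" "tgt e = Unit A"
    "arr A h" "src h = Unit A" "tgt h = c \<otimes>\<^sub>o X"
  using assms by (auto simp: dual_arrows_def homs_def)

lemma dual_pair_arrows: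
  assumes "dual_pair A c X e h"
  shows "dual_arrows c X (Arr (X \<otimes>\<^sub>o c) e (Unit A)) (Arr (Unit A) h (c \<otimes>\<^sub>o X))"
proof -
  let ?e = "Arr (X \<otimes>\<^sub>o c) e (Unit A)" and ?h = "Arr (Unit A) h (c \<otimes>\<^sub>o X)"
  have [simp]: "X \<in> Obj A" "c \<in> Obj A" "e \<in> Hom A (X \<otimes>\<^sub>o c) (Unit A)" "h \<in> Hom A (Unit A) (c \<otimes>\<^sub>o X)"
    using assms by (auto simp: dual_pair_def)
  have "ru c \<star> ten (idt A c) ?e \<star> ass c X c \<star> ten ?h (idt A c) \<star> lui c = idt A c"
    using assms by (intro arr_eqI[of A]) (auto simp: dual_pair_def mor_cmp)
  moreover have "lu X \<star> ten ?e (idt A X) \<star> assi X c X \<star> ten (idt A X) ?h \<star> rui X = idt A X"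
    using assms by (intro arr_eqI[of A]) (auto simp: dual_pair_def mor_cmp)
  ultimately show ?thesis by (simp add: dual_arrows_def homs_def)
qed

end

section \<open>Duality in \<open>A\<close> as adjunction between actions\<close>

context lmod
begin

text \<open>\<open>evm\<close> and \<open>coevm\<close> are the counit and the unit at
  \<open>m\<close> of the adjunction between the actions of \<open>X\<close> and of \<open>c\<close>
  when \<open>e\<close> and \<open>h\<close> make \<open>X\<close> a right dual of \<open>c\<close>.
  They are defined for arbitrary \<open>e\<close> and \<open>h\<close>, so that composite
  evaluations can be compared through their action.\<close>

definition "evm X c e m = lnt m \<star> wr e m \<star> lai X c m"
definition "coevm c X h m = la c X m \<star> wr h m \<star> lnti m"

lemma evm_simps [simp]:
  assumes "X \<in> Obj A" "c \<in> Obj A" "arr A e" "src e = X \<otimes>\<^sub>o\<^bsub>A\<^esub> c" "tgt e = Unit A" "m \<in> Obj C"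
  shows "arr C (evm X c e m)" "src (evm X c e m) = acto X (acto c m)" "tgt (evm X c e m) = m"
  using assms by (auto simp: evm_def)

lemma coevm_simps [simp]:
  assumes "X \<in> Obj A" "c \<in> Obj A" "arr A h" "tgt h = c \<otimes>\<^sub>o\<^bsub>A\<^esub> X" "src h = Unit A" "m \<in> Obj C"
  shows "arr C (coevm c X h m)" "src (coevm c X h m) = m" "tgt (coevm c X h m) = acto c (acto X m)"
  using assms by (auto simp: coevm_def)

lemma evm_natural:
  assumes [simp]: "X \<in> Obj A" "c \<in> Obj A" "arr A e" "src e = X \<otimes>\<^sub>o\<^bsub>A\<^esub> c" "tgt e = Unit A"
    and f: "arr C f" "src f = m" "tgt f = n"
  shows "evm X c e n \<star> wl X (wl c f) = f \<star> evm X c e m"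
proof -
  note [simp] = f
  have [simp]: "m \<in> Obj C" "n \<in> Obj C" using f arr_src arr_tgt by metis+
  have "evm X c e n \<star> wl X (wl c f) = lnt n \<star> (wr e n \<star> wl (X \<otimes>\<^sub>o\<^bsub>A\<^esub> c) f) \<star> lai X c m"
    by (simp add: evm_def lai_natural[symmetric])
  also have "wr e n \<star> wl (X \<otimes>\<^sub>o\<^bsub>A\<^esub> c) f = wl (Unit A) f \<star> wr e m"
    by (rule interchange) simp_all
  finally show ?thesis
    using lnt_natural[OF f, THEN cmp_reassoc] by (simp add: evm_def)
qed

lemma coevm_natural:
  assumes [simp]: "X \<in> Obj A" "c \<in> Obj A" "arr A h" "tgt h = c \<otimes>\<^sub>o\<^bsub>A\<^esub> X" "src h = Unit A"
    and f: "arr C f" "src f = m" "tgt f = n"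
  shows "coevm c X h n \<star> f = wl c (wl X f) \<star> coevm c X h m"
proof -
  note [simp] = f
  have [simp]: "m \<in> Obj C" "n \<in> Obj C" using f arr_src arr_tgt by metis+
  have "coevm c X h n \<star> f = la c X n \<star> (wr h n \<star> wl (Unit A) f) \<star> lnti m"
    by (simp add: coevm_def lnti_natural)
  also have "wr h n \<star> wl (Unit A) f = wl (c \<otimes>\<^sub>o\<^bsub>A\<^esub> X) f \<star> wr h m"
    by (rule interchange) simp_all
  finally show ?thesis
    using la_natural[of c X f m n, THEN cmp_reassoc] by (simp add: coevm_def)
qed

text \<open>Acting on \<open>m\<close> with the two duality equations and simplifying turns them
  into the triangle identities.\<close>

lemma zigzag:
  assumes dual: "A.dual_arrows c X e h" and [simp]: "m \<in> Obj C"
  shows "wl c (evm X c e m) \<star> coevm c X h (acto c m) = idt C (acto c m)"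
    and "evm X c e (acto X m) \<star> wl X (coevm c X h m) = idt C (acto X m)"
proof -
  note [simp] = A.dual_arrowsD[OF dual]
  have "wr (A.ru c \<star>\<^bsub>A\<^esub> A.ten (idt A c) e \<star>\<^bsub>A\<^esub> A.ass c X c \<star>\<^bsub>A\<^esub> A.ten h (idt A c) \<star>\<^bsub>A\<^esub> A.lui c) m = idt C (acto c m)"
    using dual by (simp add: A.dual_arrows_def del: wr_cmp)
  then show "wl c (evm X c e m) \<star> coevm c X h (acto c m) = idt C (acto c m)"
    by (simp add: evm_def coevm_def)
  have "wr (A.lu X \<star>\<^bsub>A\<^esub> A.ten e (idt A X) \<star>\<^bsub>A\<^esub> A.assi X c X \<star>\<^bsub>A\<^esub> A.ten (idt A X) h \<star>\<^bsub>A\<^esub> A.rui X) m = idt C (acto X m)"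
    using dual by (simp add: A.dual_arrows_def del: wr_cmp)
  then show "evm X c e (acto X m) \<star> wl X (coevm c X h m) = idt C (acto X m)"
    by (simp add: evm_def coevm_def)
qed

lemma wr_mate:
  assumes [simp]: "c \<in> Obj A" "d \<in> Obj A" "X \<in> Obj A" "Y \<in> Obj A" "arr A e" "src e = Y \<otimes>\<^sub>o\<^bsub>A\<^esub> d" "tgt e = Unit A"
    "arr A h" "tgt h = c \<otimes>\<^sub>o\<^bsub>A\<^esub> X" "src h = Unit A" "arr A f" "src f = c" "tgt f = d" "m \<in> Obj C"
  shows "wr (A.mate d X Y e h f) m = evm Y d e (acto X m) \<star> wl Y (wr f (acto X m)) \<star> wl Y (coevm c X h m)"
  by (simp add: A.mate_def evm_def coevm_def)

text \<open>Both bracketings act as the counit of the composed adjunction. Since later arguments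
  refer to this action, the left action can use \<open>TE\<close> and the reversed right action
  \<open>TE'\<close>.\<close>

lemma evm_TE:
  assumes [simp]: "a \<in> Obj A" "b \<in> Obj A" "X \<in> Obj A" "Y \<in> Obj A"
    "arr A eX" "src eX = X \<otimes>\<^sub>o\<^bsub>A\<^esub> a" "tgt eX = Unit A" "arr A eY" "src eY = Y \<otimes>\<^sub>o\<^bsub>A\<^esub> b" "tgt eY = Unit A" "m \<in> Obj C"
  shows "evm (Y \<otimes>\<^sub>o\<^bsub>A\<^esub> X) (a \<otimes>\<^sub>o\<^bsub>A\<^esub> b) (A.TE a b X Y eX eY) m
      = evm Y b eY m \<star> wl Y (evm X a eX (acto b m)) \<star> wl Y (wl X (la a b m)) \<star> la Y X (acto (a \<otimes>\<^sub>o\<^bsub>A\<^esub> b) m)"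
    and "evm (Y \<otimes>\<^sub>o\<^bsub>A\<^esub> X) (a \<otimes>\<^sub>o\<^bsub>A\<^esub> b) (A.TE' a b X Y eX eY) m
      = evm Y b eY m \<star> wl Y (evm X a eX (acto b m)) \<star> wl Y (wl X (la a b m)) \<star> la Y X (acto (a \<otimes>\<^sub>o\<^bsub>A\<^esub> b) m)"
  by (simp_all add: A.TE_def A.TE'_def evm_def la_natural)

lemma coevm_TH:
  assumes [simp]: "a \<in> Obj A" "b \<in> Obj A" "X \<in> Obj A" "Y \<in> Obj A"
    "arr A hX" "tgt hX = a \<otimes>\<^sub>o\<^bsub>A\<^esub> X" "src hX = Unit A" "arr A hY" "tgt hY = b \<otimes>\<^sub>o\<^bsub>A\<^esub> Y" "src hY = Unit A" "m \<in> Obj C"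
  shows "coevm (a \<otimes>\<^sub>o\<^bsub>A\<^esub> b) (Y \<otimes>\<^sub>o\<^bsub>A\<^esub> X) (A.TH a b X Y hX hY) m
      = lai a b (acto (Y \<otimes>\<^sub>o\<^bsub>A\<^esub> X) m) \<star> wl a (wl b (lai Y X m)) \<star> wl a (coevm b Y hY (acto X m)) \<star> coevm a X hX m"
    and "coevm (a \<otimes>\<^sub>o\<^bsub>A\<^esub> b) (Y \<otimes>\<^sub>o\<^bsub>A\<^esub> X) (A.TH' a b X Y hX hY) m
      = lai a b (acto (Y \<otimes>\<^sub>o\<^bsub>A\<^esub> X) m) \<star> wl a (wl b (lai Y X m)) \<star> wl a (coevm b Y hY (acto X m)) \<star> coevm a X hX m"
  by (simp_all add: A.TH_def A.TH'_def coevm_def lai_natural[THEN cmp_reassoc])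

lemma evm_unit:
  assumes [simp]: "m \<in> Obj C"
  shows "evm (Unit A) (Unit A) (A.lu (Unit A)) m = lnt m \<star> lnt (acto (Unit A) m)"
    and "evm (Unit A) (Unit A) (A.ru (Unit A)) m = lnt m \<star> lnt (acto (Unit A) m)"
  by (simp_all add: evm_def lnt_natural)

lemma coevm_unit:
  assumes [simp]: "m \<in> Obj C"
  shows "coevm (Unit A) (Unit A) (A.lui (Unit A)) m = lnti (acto (Unit A) m) \<star> lnti m"
    and "coevm (Unit A) (Unit A) (A.rui (Unit A)) m = lnti (acto (Unit A) m) \<star> lnti m"
  by (simp_all add: coevm_def lnti_natural)

end

section \<open>Transposition along an adjunction\<close>

context linear_category
begin

text \<open>Transposing \<open>q\<close> along the adjunction of \<open>F\<close> with
  \<open>G\<close> and back: naturality of the unit \<open>H\<close> at \<open>q\<close> and one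
  triangle identity.\<close>

lemma transpose_left:
  assumes [simp]: "endofunctor C F" "endofunctor C G"
    and E: "nat_tr C (endo_comp F G) endo_id E" and H: "nat_tr C endo_id (endo_comp G F) H"
    and zigzag: "\<And>x. x \<in> Obj C \<Longrightarrow> mp G (E x) \<star> H (ob G x) = idt C (ob G x)"
    and q: "arr C q" "src q = m" "tgt q = ob G z" and z: "z \<in> Obj C"
  shows "mp G (E z \<star> mp F q) \<star> H m = q"
proof -
  note [simp] = q z nat_trD(2-4)[OF E, simplified] nat_trD(2-4)[OF H, simplified]
  have [simp]: "m \<in> Obj C" using q arr_src by metis
  have "H (ob G z) \<star> q = mp G (mp F q) \<star> H m"
    using nat_trD(5)[OF H, of q] by simp
  then have "mp G (E z \<star> mp F q) \<star> H m = mp G (E z) \<star> H (ob G z) \<star> q"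
    by simp
  then show ?thesis
    using zigzag[OF z, THEN cmp_reassoc] by simp
qed

text \<open>The transformation \<open>p\<close> from \<open>K F\<close> to the identity is
  transposed to one from \<open>K\<close> to \<open>G\<close> and back. Naturality of
  \<open>p\<close> at \<open>E m\<close> brings the unit and the counit together, where the triangle
  identity cancels them.\<close>

lemma transpose_right:
  assumes [simp]: "endofunctor C F" "endofunctor C G" "endofunctor C K"
    and E: "nat_tr C (endo_comp G F) endo_id E" and H: "nat_tr C endo_id (endo_comp F G) H"
    and p: "nat_tr C (endo_comp K F) endo_id p"
    and zigzag: "mp F (E m) \<star> H (ob F m) = idt C (ob F m)" and m: "m \<in> Obj C"
  shows "E m \<star> p (ob G (ob F m)) \<star> mp K (H (ob F m)) = p m"
proof -
  note [simp] = m nat_trD(2-4)[OF E, simplified] nat_trD(2-4)[OF H, simplified] nat_trD(2-4)[OF p, simplified]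
  have "E m \<star> p (ob G (ob F m)) = p m \<star> mp K (mp F (E m))"
    using nat_trD(5)[OF p, of "E m"] by simp
  then have "E m \<star> p (ob G (ob F m)) \<star> mp K (H (ob F m)) = p m \<star> mp K (mp F (E m) \<star> H (ob F m))"
    by (simp add: cmp_reassoc del: cmp_assoc flip: cmp_assoc)
  then show ?thesis using zigzag by simp
qed

end

section \<open>Transposed transformations\<close>

lemma endo_comp_assoc: "endo_comp (endo_comp F G) H = endo_comp F (endo_comp G H)"
  by (simp add: endo_comp_def)

lemma endo_comp_id [simp]: "endo_comp endo_id F = F" "endo_comp F endo_id = F"
  by (simp_all add: endo_comp_def endo_id_def)

context linear_category
begin

lemma nat_tr_cmp:
  assumes \<eta>: "nat_tr C F G \<eta>" and \<theta>: "nat_tr C G H \<theta>" and [simp]: "endofunctor C F" "endofunctor C G" "endofunctor C H"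
  shows "nat_tr C F H (\<lambda>x. \<theta> x \<star> \<eta> x)"
  unfolding nat_tr_def
proof (intro conjI ballI allI impI)
  note [simp] = nat_trD(2-4)[OF \<eta>] nat_trD(2-4)[OF \<theta>]
  show "\<theta> x \<star> \<eta> x \<in> homs C (ob F x) (ob H x)" if "x \<in> Obj C" for x
    using that by (simp add: homs_def)
  show "(\<theta> (tgt f) \<star> \<eta> (tgt f)) \<star> mp F f = mp H f \<star> \<theta> (src f) \<star> \<eta> (src f)" if "arr C f" for f
    using nat_trD(5)[OF \<eta> that] nat_trD(5)[OF \<theta> that, THEN cmp_reassoc] by simp
qed

lemma nat_tr_whisker_left:
  assumes \<eta>: "nat_tr C F G \<eta>" and [simp]: "endofunctor C F" "endofunctor C G" "endofunctor C K"
  shows "nat_tr C (endo_comp K F) (endo_comp K G) (\<lambda>x. mp K (\<eta> x))"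
  unfolding nat_tr_def
proof (intro conjI ballI allI impI)
  note [simp] = nat_trD(2-4)[OF \<eta>]
  show "mp K (\<eta> x) \<in> homs C (ob (endo_comp K F) x) (ob (endo_comp K G) x)" if "x \<in> Obj C" for x
    using that by (simp add: homs_def)
  show "mp K (\<eta> (tgt f)) \<star> mp (endo_comp K F) f = mp (endo_comp K G) f \<star> mp K (\<eta> (src f))" if [simp]: "arr C f" for f
    using arg_cong[OF nat_trD(5)[OF \<eta> that], of "mp K"] by simp
qed

lemma nat_tr_whisker_right:
  assumes \<eta>: "nat_tr C F G \<eta>" and [simp]: "endofunctor C K"
  shows "nat_tr C (endo_comp F K) (endo_comp G K) (\<lambda>x. \<eta> (ob K x))"
  unfolding nat_tr_def
proof (intro conjI ballI allI impI)
  note [simp] = nat_trD(2-4)[OF \<eta>]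
  show "\<eta> (ob K x) \<in> homs C (ob (endo_comp F K) x) (ob (endo_comp G K) x)" if "x \<in> Obj C" for x
    using that by (simp add: homs_def)
  show "\<eta> (ob K (tgt f)) \<star> mp (endo_comp F K) f = mp (endo_comp G K) f \<star> \<eta> (ob K (src f))" if [simp]: "arr C f" for f
    using nat_trD(5)[OF \<eta>, of "mp K f"] by simp
qed

text \<open>Adds to a triple the counit \<open>E\<close> for \<open>md\<close> and
  \<open>rt\<close>, and the triangle identities with which \<open>tau_mate\<close> undoes a
  transposition.\<close>

definition adjoint_triple :: "('o, 'm) triple \<Rightarrow> ('o \<Rightarrow> ('o, 'm) arrow) \<Rightarrow> bool" where
  "adjoint_triple T E \<longleftrightarrow> is_triple C T \<and> nat_tr C (endo_comp (md T) (rt T)) endo_id E \<and>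
     (\<forall>x\<in>Obj C. mp (rt T) (E x) \<star> cou T (ob (rt T) x) = idt C (ob (rt T) x)
        \<and> mp (md T) (eva T x) \<star> uni T (ob (md T) x) = idt C (ob (md T) x))"

lemma adjoint_triple_id: "adjoint_triple (triple_id C) (idt C)"
  by (auto simp: adjoint_triple_def is_triple_id nat_tr_def homs_def)

text \<open>Composition of adjunctions. Naturality of a unit of one factor at a counit of the other
  makes the triangle identity of one factor applicable and leaves that of the other.\<close>

lemma adjoint_triple_comp:
  assumes S: "adjoint_triple S D" and T: "adjoint_triple T E"
  shows "adjoint_triple (triple_comp C S T) (\<lambda>x. E x \<star> mp (md T) (D (ob (rt T) x)))"
proof -
  have S': "is_triple C S" and T': "is_triple C T"
    and D: "nat_tr C (endo_comp (md S) (rt S)) endo_id D" and E: "nat_tr C (endo_comp (md T) (rt T)) endo_id E"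
    and zS: "\<And>x. x \<in> Obj C \<Longrightarrow> mp (rt S) (D x) \<star> cou S (ob (rt S) x) = idt C (ob (rt S) x)"
      "\<And>x. x \<in> Obj C \<Longrightarrow> mp (md S) (eva S x) \<star> uni S (ob (md S) x) = idt C (ob (md S) x)"
    and zT: "\<And>x. x \<in> Obj C \<Longrightarrow> mp (rt T) (E x) \<star> cou T (ob (rt T) x) = idt C (ob (rt T) x)"
      "\<And>x. x \<in> Obj C \<Longrightarrow> mp (md T) (eva T x) \<star> uni T (ob (md T) x) = idt C (ob (md T) x)"
    using S T by (auto simp: adjoint_triple_def)
  note [simp] = S' T' nat_trD(2-4)[OF D, simplified] nat_trD(2-4)[OF E, simplified]
  have "nat_tr C (endo_comp (md T) (endo_comp (endo_comp (md S) (rt S)) (rt T)))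
      (endo_comp (md T) (endo_comp endo_id (rt T))) (\<lambda>x. mp (md T) (D (ob (rt T) x)))"
    by (rule nat_tr_whisker_left[OF nat_tr_whisker_right[OF D]]) simp_all
  then have "nat_tr C (endo_comp (md T) (endo_comp (endo_comp (md S) (rt S)) (rt T))) endo_id
      (\<lambda>x. E x \<star> mp (md T) (D (ob (rt T) x)))"
    by (intro nat_tr_cmp[OF _ E]) simp_all
  then have 1: "nat_tr C (endo_comp (md (triple_comp C S T)) (rt (triple_comp C S T))) endo_id
      (\<lambda>x. E x \<star> mp (md T) (D (ob (rt T) x)))"
    by (simp add: endo_comp_assoc)
  have 2: "mp (rt S) (mp (rt T) (E x)) \<star> mp (rt S) (mp (rt T) (mp (md T) (D (ob (rt T) x)))) \<star>
      mp (rt S) (cou T (ob (md S) (ob (rt S) (ob (rt T) x)))) \<star> cou S (ob (rt S) (ob (rt T) x))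
      = idt C (ob (rt S) (ob (rt T) x))" if [simp]: "x \<in> Obj C" for x
  proof -
    have "mp (rt T) (E x) \<star> mp (rt T) (mp (md T) (D (ob (rt T) x))) \<star> cou T (ob (md S) (ob (rt S) (ob (rt T) x)))
       = D (ob (rt T) x)"
      using triple_natural(1)[OF T', of "D (ob (rt T) x)" "ob (md S) (ob (rt S) (ob (rt T) x))" "ob (rt T) x"]
        zT(1)[of x, THEN cmp_reassoc]
      by (simp flip: triple_natural(1)[OF T'])
    from arg_cong[OF this, of "mp (rt S)", simplified, symmetric] show ?thesis
      using zS(1)[of "ob (rt T) x"] by simp
  qed
  have 3: "mp (md T) (mp (md S) (eva S x)) \<star> mp (md T) (mp (md S) (mp (lf S) (eva T (ob (md S) x)))) \<star>
      mp (md T) (uni S (ob (lf T) (ob (md T) (ob (md S) x)))) \<star> uni T (ob (md T) (ob (md S) x))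
      = idt C (ob (md T) (ob (md S) x))" if [simp]: "x \<in> Obj C" for x
  proof -
    have "mp (md S) (eva S x) \<star> mp (md S) (mp (lf S) (eva T (ob (md S) x))) \<star> uni S (ob (lf T) (ob (md T) (ob (md S) x)))
       = eva T (ob (md S) x)"
      using triple_natural(3)[OF S', of "eva T (ob (md S) x)" "ob (lf T) (ob (md T) (ob (md S) x))" "ob (md S) x"]
        zS(2)[of x, THEN cmp_reassoc]
      by (simp flip: triple_natural(3)[OF S'])
    from arg_cong[OF this, of "mp (md T)", simplified, symmetric] show ?thesis
      using zT(2)[of "ob (md S) x"] by simp
  qed
  show ?thesis
    unfolding adjoint_triple_def using 1 2 3 is_triple_comp[OF S' T'] by simp
qed

end

context nakayama
begin

text \<open>
  Here \<open>\<gamma>\<close> is the transpose of \<open>\<alpha>\<close> and \<open>\<kappa>\<close> the transpose of \<open>\<gamma>\<close>, just as the morphisms \<open>f\<^sup>\<or>\<close> and \<open>f\<^sup>\<or>\<^sup>\<or>\<close>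
  and the monoidal structure of the double dual are defined by transposition.
\<close>

lemma tau_mate:
  assumes S: "is_triple C S" and T: "adjoint_triple T E" and \<alpha>: "nat_tr C (rt S) (rt T) \<alpha>"
    and \<gamma>: "\<And>m. m \<in> Obj C \<Longrightarrow> \<gamma> m = E (ob (md S) m) \<star> mp (md T) (\<alpha> (ob (md S) m)) \<star> mp (md T) (cou S m)"
    and \<kappa>: "\<And>m. m \<in> Obj C \<Longrightarrow> \<kappa> m = eva S (ob (lf T) m) \<star> mp (lf S) (\<gamma> (ob (lf T) m)) \<star> mp (lf S) (uni T m)"
    and x: "x \<in> Obj C"
  shows "Nak (\<alpha> x) \<star> tau S x = tau T x \<star> \<kappa> (No x)"
proof -
  have T': "is_triple C T" and E: "nat_tr C (endo_comp (md T) (rt T)) endo_id E"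
    and zT: "\<And>x. x \<in> Obj C \<Longrightarrow> mp (rt T) (E x) \<star> cou T (ob (rt T) x) = idt C (ob (rt T) x)"
      "\<And>x. x \<in> Obj C \<Longrightarrow> mp (md T) (eva T x) \<star> uni T (ob (md T) x) = idt C (ob (md T) x)"
    using T by (auto simp: adjoint_triple_def)
  note [simp] = S T' nat_trD(2-4)[OF E, simplified] nat_trD(2-4)[OF \<alpha>]
  define \<gamma>' where "\<gamma>' m = E (ob (md S) m) \<star> mp (md T) (\<alpha> (ob (md S) m) \<star> cou S m)" for m
  have \<gamma>_eq: "\<gamma> m = \<gamma>' m" if "m \<in> Obj C" for m
    using \<gamma>[OF that] that by (simp add: \<gamma>'_def)
  have "nat_tr C endo_id (endo_comp (rt T) (md S)) (\<lambda>m. \<alpha> (ob (md S) m) \<star> cou S m)"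
    by (rule nat_tr_cmp[OF is_tripleD(4)[OF S] nat_tr_whisker_right[OF \<alpha>]]) simp_all
  then have "nat_tr C (endo_comp (md T) endo_id) (endo_comp (md T) (endo_comp (rt T) (md S)))
      (\<lambda>m. mp (md T) (\<alpha> (ob (md S) m) \<star> cou S m))"
    by (rule nat_tr_whisker_left) simp_all
  moreover have "nat_tr C (endo_comp (endo_comp (md T) (rt T)) (md S)) (endo_comp endo_id (md S)) (\<lambda>m. E (ob (md S) m))"
    by (rule nat_tr_whisker_right[OF E]) simp
  ultimately have \<gamma>': "nat_tr C (md T) (md S) \<gamma>'"
    unfolding \<gamma>'_def by (intro nat_tr_cmp[of "md T" "endo_comp (md T) (endo_comp (rt T) (md S))" _ "md S"])
      (simp_all add: endo_comp_assoc)
  note [simp] = nat_trD(2-4)[OF \<gamma>']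
  \<comment> \<open>\<open>p\<close> is the transpose of \<gamma> along \<open>S\<close>, and
    \<kappa> is the transpose of \<open>p\<close> along \<open>T\<close>. The condition on
    \<open>eva\<close> therefore says that transposing \<open>p\<close> along \<open>T\<close> and
    back gives \<open>p\<close>.\<close>
  define p where "p m = eva S m \<star> mp (lf S) (\<gamma>' m)" for m
  have p: "nat_tr C (endo_comp (lf S) (md T)) endo_id p"
    unfolding p_def by (rule nat_tr_cmp[OF nat_tr_whisker_left[OF \<gamma>'] is_tripleD(5)[OF S]]) simp_all
  note [simp] = nat_trD(2-4)[OF p, simplified]
  define \<kappa>' where "\<kappa>' m = p (ob (lf T) m) \<star> mp (lf S) (uni T m)" for m
  have \<kappa>_eq: "\<kappa> m = \<kappa>' m" if "m \<in> Obj C" for m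
    using \<kappa>[OF that] that \<gamma>_eq[of "ob (lf T) m"] by (simp add: \<kappa>'_def p_def)
  have "nat_tr C (endo_comp (endo_comp (lf S) (md T)) (lf T)) (endo_comp endo_id (lf T)) (\<lambda>m. p (ob (lf T) m))"
    by (rule nat_tr_whisker_right[OF p]) simp
  moreover have "nat_tr C (endo_comp (lf S) endo_id) (endo_comp (lf S) (endo_comp (md T) (lf T))) (\<lambda>m. mp (lf S) (uni T m))"
    by (rule nat_tr_whisker_left[OF is_tripleD(6)[OF T']]) simp_all
  ultimately have \<kappa>': "nat_tr C (lf S) (lf T) \<kappa>'"
    unfolding \<kappa>'_def by (intro nat_tr_cmp[of "lf S" "endo_comp (lf S) (endo_comp (md T) (lf T))" _ "lf T"])
      (simp_all add: endo_comp_assoc)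
  have "Nak (\<alpha> x) \<star> tau S x = tau T x \<star> \<kappa>' (No x)"
  proof (rule tau_transform[OF S T' \<alpha> \<gamma>' \<kappa>' _ _ x])
    fix m assume m [simp]: "m \<in> Obj C"
    show "\<alpha> (ob (md S) m) \<star> cou S m = mp (rt T) (\<gamma>' m) \<star> cou T m"
      unfolding \<gamma>'_def
      by (rule transpose_left[symmetric, of "md T" "rt T" E "cou T"])
        (use E is_tripleD(4)[OF T'] zT in simp_all)
    have "eva T m \<star> p (ob (lf T) (ob (md T) m)) \<star> mp (lf S) (uni T (ob (md T) m)) = p m"
      by (rule transpose_right[of "md T" "lf T" "lf S" "eva T" "uni T"])
        (use p is_tripleD(5,6)[OF T'] zT in simp_all)
    then show "eva T m \<star> \<kappa>' (ob (md T) m) = eva S m \<star> mp (lf S) (\<gamma>' m)"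
      by (simp add: \<kappa>'_def p_def)
  qed
  then show ?thesis using \<kappa>_eq[of "No x"] x by simp
qed

end

section \<open>The triples attached to the objects of a rigid category\<close>

locale rigid_lmod = lmod A C acto actm lass lun
  for A :: "('a, 'f::ab_group_add, 'k::field, 'z) rigidcat_scheme"
    and C :: "('o, 'm::ab_group_add, 'k, 'y) lincat_scheme" (structure)
    and acto actm lass lun +
  assumes right_dual: "c \<in> Obj A \<Longrightarrow> dual_pair A c (rdual A c) (rev A c) (rcoev A c)"
begin

abbreviation D :: "'a \<Rightarrow> 'a" where "D \<equiv> rdual A"

definition "Ev c = Arr (D c \<otimes>\<^sub>o\<^bsub>A\<^esub> c) (rev A c) (Unit A)"
definition "Cv c = Arr (Unit A) (rcoev A c) (c \<otimes>\<^sub>o\<^bsub>A\<^esub> D c)"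

abbreviation "ev c \<equiv> evm (D c) c (Ev c)"
abbreviation "cv c \<equiv> coevm c (D c) (Cv c)"

lemma dual: "c \<in> Obj A \<Longrightarrow> A.dual_arrows c (D c) (Ev c) (Cv c)"
  unfolding Ev_def Cv_def by (rule A.dual_pair_arrows[OF right_dual])

lemma dual_simps [simp]:
  assumes "c \<in> Obj A"
  shows "D c \<in> Obj A" "arr A (Ev c)" "src (Ev c) = D c \<otimes>\<^sub>o\<^bsub>A\<^esub> c" "tgt (Ev c) = Unit A"
    "arr A (Cv c)" "src (Cv c) = Unit A" "tgt (Cv c) = c \<otimes>\<^sub>o\<^bsub>A\<^esub> D c"
    "mor (Ev c) = rev A c" "mor (Cv c) = rcoev A c"
  using A.dual_arrowsD[OF dual[OF assms]] by (simp_all add: Ev_def Cv_def)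

definition L :: "'a \<Rightarrow> ('o, 'm) endo" where
  "L a = Endo (acto a) (wl a)"

lemma L_simps [simp]: "ob (L a) x = acto a x" "mp (L a) h = wl a h"
  by (simp_all add: L_def)

lemma endofunctor_L: "a \<in> Obj A \<Longrightarrow> endofunctor C (L a)"
  by (auto simp: endofunctor_def homs_def)

definition Tr :: "'a \<Rightarrow> ('o, 'm) triple" where
  "Tr a = Triple (L (D (D a))) (L (D a)) (L a) (cv a) (ev (D a))
     (cv (D a))"

lemma Tr_simps [simp]:
  "lf (Tr a) = L (D (D a))" "md (Tr a) = L (D a)" "rt (Tr a) = L a"
  "cou (Tr a) = cv a" "eva (Tr a) = ev (D a)"
  "uni (Tr a) = cv (D a)"
  by (simp_all add: Tr_def)

lemma nat_tr_evm: "c \<in> Obj A \<Longrightarrow> nat_tr C (endo_comp (L (D c)) (L c)) endo_id (ev c)"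
  by (auto simp: nat_tr_def homs_def evm_natural)

lemma nat_tr_coevm: "c \<in> Obj A \<Longrightarrow> nat_tr C endo_id (endo_comp (L c) (L (D c))) (cv c)"
  by (auto simp: nat_tr_def homs_def coevm_natural)

lemma is_triple_Tr [simp]: "a \<in> Obj A \<Longrightarrow> is_triple C (Tr a)"
  unfolding is_triple_def
  using zigzag(2)[OF dual[of "D a"]] by (auto simp: endofunctor_L nat_tr_evm nat_tr_coevm)

lemma adjoint_triple_Tr: "a \<in> Obj A \<Longrightarrow> adjoint_triple (Tr a) (ev a)"
  unfolding adjoint_triple_def
  using zigzag(1)[OF dual[of a]] zigzag(1)[OF dual[of "D a"]] by (auto simp: nat_tr_evm)

text \<open>The triple of the dual object continues the chain of adjoints by one step.\<close>

lemma is_chain_Tr: "a \<in> Obj A \<Longrightarrow> is_chain C (Tr a) (Tr (D a)) (ev a)"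
  unfolding is_chain_def
  using zigzag[OF dual[of a]] zigzag(1)[OF dual[of "D a"]] zigzag(1)[OF dual[of "D (D a)"]]
  by (auto simp: nat_tr_evm)

end

section \<open>Rigid actions\<close>

context linear_category
begin

lemma mor_cmp_zero:
  assumes "arr C f" "arr C g" "src g = tgt f" "mor f = 0 \<or> mor g = 0"
  shows "mor (g \<star> f) = 0"
proof -
  have "mor g \<cdot> (mor f + mor f) = mor g \<cdot> mor f + mor g \<cdot> mor f"
    "(mor g + mor g) \<cdot> mor f = mor g \<cdot> mor f + mor g \<cdot> mor f"
    using assms comp_add_right[of "src f" "tgt f" "tgt g" "mor f" "mor f" "mor g"]
      comp_add_left[of "src f" "tgt f" "tgt g" "mor f" "mor g" "mor g"] arr_mor[of C f] arr_mor[of C g] by auto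
  then show ?thesis using assms by (auto simp: mor_cmp)
qed

end

context weak_monoidal
begin

lemma mor_ten_zero:
  assumes "arr A f" "arr A g" "mor f = 0 \<or> mor g = 0"
  shows "mor (ten f g) = 0"
proof -
  note add = tensor_bilinear[unfolded bilinear_functor_def, THEN conjunct2, THEN conjunct2, THEN conjunct2, THEN conjunct2]
  have "(mor f + mor f) \<otimes>\<^sub>m mor g = mor f \<otimes>\<^sub>m mor g + mor f \<otimes>\<^sub>m mor g"
    by (rule add[THEN conjunct1, rule_format, OF arr_src[OF assms(1)] arr_tgt[OF assms(1)] arr_mor[OF assms(1)]
        arr_mor[OF assms(1)] arr_src[OF assms(2)] arr_tgt[OF assms(2)] arr_mor[OF assms(2)]])
  moreover have "mor f \<otimes>\<^sub>m (mor g + mor g) = mor f \<otimes>\<^sub>m mor g + mor f \<otimes>\<^sub>m mor g"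
    by (rule add[THEN conjunct2, THEN conjunct1, rule_format, OF arr_src[OF assms(1)] arr_tgt[OF assms(1)] arr_mor[OF assms(1)]
        arr_src[OF assms(2)] arr_tgt[OF assms(2)] arr_mor[OF assms(2)] arr_mor[OF assms(2)]])
  ultimately show ?thesis using assms(3) by auto
qed

text \<open>Lets \<open>mor_dm\<close> treat the zero morphism, whose ends are not
  determined.\<close>

lemma mor_mate_zero:
  assumes [simp]: "c \<in> Obj A" "d \<in> Obj A" "X \<in> Obj A" "Y \<in> Obj A" "arr A e" "src e = Y \<otimes>\<^sub>o d" "tgt e = Unit A"
    "arr A h" "tgt h = c \<otimes>\<^sub>o X" "src h = Unit A" "arr A f" "src f = c" "tgt f = d" and zero: "mor f = 0"
  shows "mor (mate d X Y e h f) = 0"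
proof -
  have "mor (ten (idt A Y) (ten f (idt A X))) = 0"
    using mor_ten_zero[of f "idt A X"] mor_ten_zero[of "idt A Y" "ten f (idt A X)"] zero by simp
  then have "mor (ten (idt A Y) (ten f (idt A X)) \<star> ten (idt A Y) h \<star> rui Y) = 0"
    by (intro mor_cmp_zero disjI2) simp_all
  then have "mor (assi Y d X \<star> ten (idt A Y) (ten f (idt A X)) \<star> ten (idt A Y) h \<star> rui Y) = 0"
    by (rule mor_cmp_zero[OF _ _ _ disjI1, rotated 3]) simp_all
  then have "mor (ten e (idt A X) \<star> assi Y d X \<star> ten (idt A Y) (ten f (idt A X)) \<star> ten (idt A Y) h \<star> rui Y) = 0"
    by (rule mor_cmp_zero[OF _ _ _ disjI1, rotated 3]) simp_all
  then show ?thesis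
    unfolding mate_def by (rule mor_cmp_zero[OF _ _ _ disjI1, rotated 3]) simp_all
qed

end

section \<open>Dual morphisms and comparisons of duals, seen through the action\<close>

context rigid_lmod
begin

definition dm :: "('a, 'f) arrow \<Rightarrow> ('a, 'f) arrow" where
  "dm f = A.mate (tgt f) (D (src f)) (D (tgt f)) (Ev (tgt f)) (Cv (src f)) f"

lemma dm_simps [simp]:
  assumes "arr A f"
  shows "arr A (dm f)" "src (dm f) = D (tgt f)" "tgt (dm f) = D (src f)"
  using A.mate_simps(1)[of "src f" "tgt f" "D (src f)" "D (tgt f)" "Ev (tgt f)" "Cv (src f)" f] assms
  by (auto simp: homs_def dm_def)

text \<open>\<open>rdualm\<close> is described through arbitrary ends of its argument. A nonzero
  morphism determines them by disjointness of the hom-spaces; for the zero morphism every choice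
  yields zero.\<close>

lemma mor_dm:
  assumes f: "arr A f"
  shows "mor (dm f) = rdualm A (mor f)"
  unfolding rdualm_def
proof (rule the_equality[symmetric])
  have eq: "mor (dm g) = rmate A (tgt g) (D (src g)) (D (tgt g)) (rev A (tgt g)) (rcoev A (src g)) (mor g)"
    if "arr A g" for g
    using A.mate_simps(2)[of "src g" "tgt g" "D (src g)" "D (tgt g)" "Ev (tgt g)" "Cv (src g)" g] that
    by (auto simp: homs_def dm_def)
  show "\<exists>c\<in>Obj A. \<exists>d\<in>Obj A. mor f \<in> Hom A c d \<and> mor (dm f) = rmate A d (D c) (D d) (rev A d) (rcoev A c) (mor f)"
    using eq[OF f] f arr_mor[OF f] by (intro bexI[of _ "src f"] bexI[of _ "tgt f"]) auto
  fix g assume "\<exists>c\<in>Obj A. \<exists>d\<in>Obj A. mor f \<in> Hom A c d \<and> g = rmate A d (D c) (D d) (rev A d) (rcoev A c) (mor f)"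
  then obtain c d where cd: "c \<in> Obj A" "d \<in> Obj A" "mor f \<in> Hom A c d"
    and g: "g = rmate A d (D c) (D d) (rev A d) (rcoev A c) (mor f)" by blast
  have g': "g = mor (dm (Arr c (mor f) d))"
    using eq[of "Arr c (mor f) d"] cd g by simp
  have zero: "mor (dm k) = 0" if "arr A k" "mor k = 0" for k
    unfolding dm_def by (rule A.mor_mate_zero[of "src k"]) (use that in auto)
  show "g = mor (dm f)"
  proof (cases "mor f = 0")
    case True
    then show ?thesis using zero[of f] zero[of "Arr c (mor f) d"] f cd g' by simp
  next
    case False
    then have "src f = c" "tgt f = d"
      using A.hom_disjoint[of c d "src f" "tgt f" "mor f"] cd arr_mor[OF f] f by auto
    then show ?thesis using g' arr_collapse[OF f] by simp
  qed
qed

lemma wr_dm: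
  assumes "arr A f" "m \<in> Obj C"
  shows "wr (dm f) m = ev (tgt f) (acto (D (src f)) m)
     \<star> wl (D (tgt f)) (wr f (acto (D (src f)) m)) \<star> wl (D (tgt f)) (cv (src f) m)"
  unfolding dm_def by (rule wr_mate) (use assms in auto)

text \<open>Records the type and the action of an evaluation for \<open>a \<otimes> b\<close>. Both
  bracketings satisfy this, so one coherence proof covers the left action and the reversed right
  action; the next three predicates serve the same purpose.\<close>

definition tens_ev_arrow :: "'a \<Rightarrow> 'a \<Rightarrow> ('a, 'f) arrow \<Rightarrow> bool" where
  "tens_ev_arrow a b e \<longleftrightarrow> e \<in> homs A ((D b \<otimes>\<^sub>o\<^bsub>A\<^esub> D a) \<otimes>\<^sub>o\<^bsub>A\<^esub> (a \<otimes>\<^sub>o\<^bsub>A\<^esub> b)) (Unit A) \<and>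
     (\<forall>m\<in>Obj C. evm (D b \<otimes>\<^sub>o\<^bsub>A\<^esub> D a) (a \<otimes>\<^sub>o\<^bsub>A\<^esub> b) e m = ev b m \<star> wl (D b) (ev a (acto b m))
        \<star> wl (D b) (wl (D a) (la a b m)) \<star> la (D b) (D a) (acto (a \<otimes>\<^sub>o\<^bsub>A\<^esub> b) m))"

definition tens_coev_arrow :: "'a \<Rightarrow> 'a \<Rightarrow> ('a, 'f) arrow \<Rightarrow> bool" where
  "tens_coev_arrow a b h \<longleftrightarrow> h \<in> homs A (Unit A) ((a \<otimes>\<^sub>o\<^bsub>A\<^esub> b) \<otimes>\<^sub>o\<^bsub>A\<^esub> (D b \<otimes>\<^sub>o\<^bsub>A\<^esub> D a)) \<and>
     (\<forall>m\<in>Obj C. coevm (a \<otimes>\<^sub>o\<^bsub>A\<^esub> b) (D b \<otimes>\<^sub>o\<^bsub>A\<^esub> D a) h m = lai a b (acto (D b \<otimes>\<^sub>o\<^bsub>A\<^esub> D a) m)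
        \<star> wl a (wl b (lai (D b) (D a) m)) \<star> wl a (cv b (acto (D a) m)) \<star> cv a m)"

definition unit_ev_arrow :: "('a, 'f) arrow \<Rightarrow> bool" where
  "unit_ev_arrow e \<longleftrightarrow> e \<in> homs A (Unit A \<otimes>\<^sub>o\<^bsub>A\<^esub> Unit A) (Unit A) \<and>
     (\<forall>m\<in>Obj C. evm (Unit A) (Unit A) e m = lnt m \<star> lnt (acto (Unit A) m))"

definition unit_coev_arrow :: "('a, 'f) arrow \<Rightarrow> bool" where
  "unit_coev_arrow h \<longleftrightarrow> h \<in> homs A (Unit A) (Unit A \<otimes>\<^sub>o\<^bsub>A\<^esub> Unit A) \<and>
     (\<forall>m\<in>Obj C. coevm (Unit A) (Unit A) h m = lnti (acto (Unit A) m) \<star> lnti m)"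

text \<open>\<open>dt\<close>, \<open>ddt\<close>, \<open>du\<close> and \<open>ddu\<close> are
  arrow versions of \<open>rdual_tens\<close>, \<open>rr_tens\<close>, \<open>rdual_unit\<close> and
  \<open>rr_unit\<close> with the evaluation \<open>e\<close> and the coevaluation \<open>h\<close>
  left as parameters.\<close>

definition "dt e a b = A.mate (a \<otimes>\<^sub>o\<^bsub>A\<^esub> b) (D (a \<otimes>\<^sub>o\<^bsub>A\<^esub> b)) (D b \<otimes>\<^sub>o\<^bsub>A\<^esub> D a) e (Cv (a \<otimes>\<^sub>o\<^bsub>A\<^esub> b)) (idt A (a \<otimes>\<^sub>o\<^bsub>A\<^esub> b))"
definition "ddt e h a b = A.mate (D (a \<otimes>\<^sub>o\<^bsub>A\<^esub> b)) (D (D a) \<otimes>\<^sub>o\<^bsub>A\<^esub> D (D b)) (D (D (a \<otimes>\<^sub>o\<^bsub>A\<^esub> b)))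
   (Ev (D (a \<otimes>\<^sub>o\<^bsub>A\<^esub> b))) h (dt e a b)"
definition "du e = A.mate (Unit A) (D (Unit A)) (Unit A) e (Cv (Unit A)) (idt A (Unit A))"
definition "ddu e h = A.mate (D (Unit A)) (Unit A) (D (D (Unit A))) (Ev (D (Unit A))) h (du e)"

end

section \<open>Coherence of \<open>tau\<close> for one action\<close>

locale nakayama_rigid = rigid_lmod A C acto actm lass lun + nakayama C cpo cpb No Nm \<pi>
  for A :: "('a, 'f::ab_group_add, 'k::field, 'z) rigidcat_scheme"
    and C :: "('o, 'm::ab_group_add, 'k, 'y) lincat_scheme" (structure)
    and acto actm lass lun cpo cpb No Nm \<pi>
begin

text \<open>By \<open>wr_dm\<close> the action of \<open>dm f\<close> is the transpose of the action
  of \<open>f\<close>; used twice, this is the situation of \<open>tau_mate\<close>.\<close>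

lemma tau_dm:
  assumes f: "arr A f" and x: "x \<in> Obj C"
  shows "Nak (wr f x) \<star> tau (Tr (src f)) x = tau (Tr (tgt f)) x \<star> wr (dm (dm f)) (No x)"
proof (rule tau_mate[OF is_triple_Tr adjoint_triple_Tr _ _ _ x, where \<gamma> = "wr (dm f)"])
  show "nat_tr C (rt (Tr (src f))) (rt (Tr (tgt f))) (wr f)"
    using f by (auto simp: nat_tr_def homs_def interchange)
qed (use f in \<open>auto simp: wr_dm\<close>)

text \<open>\<open>tau_mate\<close> compares \<open>Tr (a \<otimes> b)\<close> with
  \<open>Tr a\<close> after \<open>Tr b\<close> along \<open>la a b\<close>. What has to be shown is
  that the prescribed morphism \<open>ddt\<close>, acting and followed by \<open>la\<close>, is the
  double transpose of \<open>la a b\<close>.\<close>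

lemma tau_la:
  assumes [simp]: "a \<in> Obj A" "b \<in> Obj A" "x \<in> Obj C"
    and e: "tens_ev_arrow a b e" and h: "tens_coev_arrow (D b) (D a) h"
  shows "Nak (la a b x) \<star> tau (Tr (a \<otimes>\<^sub>o\<^bsub>A\<^esub> b)) x = tau (Tr a) (acto b x) \<star> wl (D (D a)) (tau (Tr b) x)
      \<star> la (D (D a)) (D (D b)) (No x) \<star> wr (ddt e h a b) (No x)"
proof -
  let ?c = "a \<otimes>\<^sub>o\<^bsub>A\<^esub> b" and ?T = "triple_comp C (Tr a) (Tr b)"
  let ?DD = "D (D a) \<otimes>\<^sub>o\<^bsub>A\<^esub> D (D b)"
  have [simp]: "arr A e" "src e = (D b \<otimes>\<^sub>o\<^bsub>A\<^esub> D a) \<otimes>\<^sub>o\<^bsub>A\<^esub> (a \<otimes>\<^sub>o\<^bsub>A\<^esub> b)" "tgt e = Unit A"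
    "arr A h" "src h = Unit A" "tgt h = (D b \<otimes>\<^sub>o\<^bsub>A\<^esub> D a) \<otimes>\<^sub>o\<^bsub>A\<^esub> ?DD"
    using e h by (auto simp: tens_ev_arrow_def tens_coev_arrow_def homs_def)
  have evm_e: "evm (D b \<otimes>\<^sub>o\<^bsub>A\<^esub> D a) ?c e m = ev b m \<star> wl (D b) (ev a (acto b m))
        \<star> wl (D b) (wl (D a) (la a b m)) \<star> la (D b) (D a) (acto ?c m)" if "m \<in> Obj C" for m
    using e that by (simp add: tens_ev_arrow_def)
  have coevm_h: "coevm (D b \<otimes>\<^sub>o\<^bsub>A\<^esub> D a) ?DD h m = lai (D b) (D a) (acto ?DD m)
        \<star> wl (D b) (wl (D a) (lai (D (D a)) (D (D b)) m)) \<star> wl (D b) (cv (D a) (acto (D (D b)) m))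
        \<star> cv (D b) m" if "m \<in> Obj C" for m
    using h that by (simp add: tens_coev_arrow_def)
  let ?j = "dt e a b"
  have [simp]: "arr A ?j" "src ?j = D b \<otimes>\<^sub>o\<^bsub>A\<^esub> D a" "tgt ?j = D ?c"
    using A.mate_simps(1)[of ?c ?c "D ?c" "D b \<otimes>\<^sub>o\<^bsub>A\<^esub> D a" e "Cv ?c" "idt A ?c"] by (auto simp: dt_def homs_def)
  have wr_j: "wr ?j m = evm (D b \<otimes>\<^sub>o\<^bsub>A\<^esub> D a) ?c e (acto (D ?c) m) \<star> wl (D b \<otimes>\<^sub>o\<^bsub>A\<^esub> D a) (cv ?c m)"
    if "m \<in> Obj C" for m
    unfolding dt_def using wr_mate[of ?c ?c "D ?c" "D b \<otimes>\<^sub>o\<^bsub>A\<^esub> D a" e "Cv ?c" "idt A ?c" m] that by simp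
  let ?r = "ddt e h a b"
  have wr_r: "wr ?r m = ev (D ?c) (acto ?DD m) \<star> wl (D (D ?c)) (wr ?j (acto ?DD m))
      \<star> wl (D (D ?c)) (coevm (D b \<otimes>\<^sub>o\<^bsub>A\<^esub> D a) ?DD h m)" if "m \<in> Obj C" for m
    unfolding ddt_def by (rule wr_mate) (use that in simp_all)
  \<comment> \<open>The single transpose of \<open>la a b\<close> is the action of the comparison
    \<open>?j\<close> of duals, corrected by \<open>lai\<close> because \<open>md ?T\<close> acts by
    \<open>D a\<close> and \<open>D b\<close> in succession.\<close>
  have "Nak (la a b x) \<star> tau (Tr ?c) x = tau ?T x \<star> (la (D (D a)) (D (D b)) (No x) \<star> wr ?r (No x))"
  proof (rule tau_mate[OF is_triple_Tr adjoint_triple_comp[OF adjoint_triple_Tr adjoint_triple_Tr], where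
        \<gamma> = "\<lambda>m. wr ?j m \<star> lai (D b) (D a) m"])
    show "nat_tr C (rt (Tr ?c)) (rt ?T) (la a b)"
      by (auto simp: nat_tr_def homs_def la_natural)
    fix m assume m [simp]: "m \<in> Obj C"
    show "wr ?j m \<star> lai (D b) (D a) m = (ev b (ob (md (Tr ?c)) m)
        \<star> mp (md (Tr b)) (ev a (ob (rt (Tr b)) (ob (md (Tr ?c)) m))))
        \<star> mp (md ?T) (la a b (ob (md (Tr ?c)) m)) \<star> mp (md ?T) (cou (Tr ?c) m)"
      by (simp add: wr_j evm_e lai_natural)
    let ?Y = "acto (D (D a)) (acto (D (D b)) m)" and ?l = "lai (D (D a)) (D (D b)) m"
    \<comment> \<open>\<open>coevm_h\<close> brings \<open>?l\<close> into the inner variable.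
      Naturality of \<open>lai\<close>, of the action of \<open>?j\<close> and of the evaluation
      moves it to the front, where \<open>la\<close> cancels it.\<close>
    have "wr ?j (acto ?DD m) \<star> lai (D b) (D a) (acto ?DD m) \<star> wl (D b) (wl (D a) ?l)
        = (wr ?j (acto ?DD m) \<star> wl (D b \<otimes>\<^sub>o\<^bsub>A\<^esub> D a) ?l) \<star> lai (D b) (D a) ?Y"
      by (simp add: lai_natural)
    also have "wr ?j (acto ?DD m) \<star> wl (D b \<otimes>\<^sub>o\<^bsub>A\<^esub> D a) ?l = wl (D ?c) ?l \<star> wr ?j ?Y"
      by (rule interchange) simp_all
    finally have 1: "wr ?j (acto ?DD m) \<star> lai (D b) (D a) (acto ?DD m) \<star> wl (D b) (wl (D a) ?l)
        = wl (D ?c) ?l \<star> wr ?j ?Y \<star> lai (D b) (D a) ?Y" by simp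
    have 2: "ev (D ?c) (acto ?DD m) \<star> wl (D (D ?c)) (wl (D ?c) ?l)
        = ?l \<star> ev (D ?c) ?Y"
      by (rule evm_natural) simp_all
    have "wr ?r m = ev (D ?c) (acto ?DD m)
        \<star> wl (D (D ?c)) (wr ?j (acto ?DD m) \<star> lai (D b) (D a) (acto ?DD m) \<star> wl (D b) (wl (D a) ?l))
        \<star> wl (D (D ?c)) (uni ?T m)"
      by (simp add: wr_r coevm_h)
    also have "\<dots> = (ev (D ?c) (acto ?DD m) \<star> wl (D (D ?c)) (wl (D ?c) ?l))
        \<star> wl (D (D ?c)) (wr ?j ?Y \<star> lai (D b) (D a) ?Y) \<star> wl (D (D ?c)) (uni ?T m)"
      unfolding 1 by simp
    also have "\<dots> = ?l \<star> ev (D ?c) ?Y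
        \<star> wl (D (D ?c)) (wr ?j ?Y \<star> lai (D b) (D a) ?Y) \<star> wl (D (D ?c)) (uni ?T m)"
      unfolding 2 by simp
    finally show "la (D (D a)) (D (D b)) m \<star> wr ?r m = eva (Tr ?c) (ob (lf ?T) m)
       \<star> mp (lf (Tr ?c)) (wr ?j (ob (lf ?T) m) \<star> lai (D b) (D a) (ob (lf ?T) m)) \<star> mp (lf (Tr ?c)) (uni ?T m)"
      by simp
  qed simp_all
  then show ?thesis
    by (simp add: tau_comp)
qed

text \<open>The unit analogue: \<alpha> is \<open>lnt\<close>, with the identity triple as target,
  and \<open>?\<gamma>\<close> is its transpose. In the action of \<open>du\<close>, naturality
  moves the inner \<open>lnt\<close> to the right, which exposes \<open>?\<gamma>\<close>.\<close>

lemma tau_lnt: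
  assumes [simp]: "x \<in> Obj C" and e: "unit_ev_arrow e" and h: "unit_coev_arrow h"
  shows "Nak (lnt x) \<star> tau (Tr (Unit A)) x = lnt (No x) \<star> wr (ddu e h) (No x)"
proof -
  let ?I = "Unit A" and ?D = "D (Unit A)"
  have [simp]: "arr A e" "src e = ?I \<otimes>\<^sub>o\<^bsub>A\<^esub> ?I" "tgt e = ?I" "arr A h" "src h = ?I" "tgt h = ?I \<otimes>\<^sub>o\<^bsub>A\<^esub> ?I"
    using e h by (auto simp: unit_ev_arrow_def unit_coev_arrow_def homs_def)
  have evm_e: "evm ?I ?I e m = lnt m \<star> lnt (acto ?I m)" and coevm_h: "coevm ?I ?I h m = lnti (acto ?I m) \<star> lnti m"
    if "m \<in> Obj C" for m
    using e h that by (simp_all add: unit_ev_arrow_def unit_coev_arrow_def)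
  have [simp]: "arr A (du e)" "src (du e) = ?I" "tgt (du e) = ?D"
    using A.mate_simps(1)[of ?I ?I ?D ?I e "Cv ?I" "idt A ?I"] by (auto simp: du_def homs_def)
  let ?\<gamma> = "\<lambda>m. lnt (acto ?D m) \<star> coevm ?I ?D (Cv ?I) m"
  have wr_du: "wr (du e) m = ?\<gamma> m \<star> lnt m" if [simp]: "m \<in> Obj C" for m
  proof -
    have "wr (du e) m = lnt (acto ?D m) \<star> lnt (acto ?I (acto ?D m)) \<star> wl ?I (coevm ?I ?D (Cv ?I) m)"
      unfolding du_def using wr_mate[of ?I ?I ?D ?I e "Cv ?I" "idt A ?I" m] by (simp add: evm_e)
    then show ?thesis by (simp add: lnt_natural)
  qed
  have "Nak (lnt x) \<star> tau (Tr ?I) x = tau (triple_id C) x \<star> (lnt (No x) \<star> wr (ddu e h) (No x))"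
  proof (rule tau_mate[OF is_triple_Tr adjoint_triple_id, where \<gamma> = ?\<gamma>])
    show "nat_tr C (rt (Tr ?I)) (rt (triple_id C)) lnt"
      by (auto simp: nat_tr_def homs_def lnt_natural)
    fix m assume m [simp]: "m \<in> Obj C"
    have "wr (ddu e h) m = ev ?D (acto ?I m) \<star> wl (D ?D) (wr (du e) (acto ?I m))
        \<star> wl (D ?D) (coevm ?I ?I h m)"
      unfolding ddu_def by (rule wr_mate) simp_all
    also have "\<dots> = ev ?D (acto ?I m) \<star> wl (D ?D) (wr (du e) (acto ?I m) \<star> coevm ?I ?I h m)"
      by simp
    also have "wr (du e) (acto ?I m) \<star> coevm ?I ?I h m = ?\<gamma> (acto ?I m) \<star> lnti m"
      by (simp add: wr_du coevm_h)
    also have "\<dots> = wl ?D (lnti m) \<star> ?\<gamma> m"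
      using lnt_natural[of "wl ?D (lnti m)", THEN cmp_reassoc] by (simp add: coevm_natural)
    also have "ev ?D (acto ?I m) \<star> wl (D ?D) (wl ?D (lnti m) \<star> ?\<gamma> m)
       = (ev ?D (acto ?I m) \<star> wl (D ?D) (wl ?D (lnti m))) \<star> wl (D ?D) (?\<gamma> m)"
      by simp
    also have "ev ?D (acto ?I m) \<star> wl (D ?D) (wl ?D (lnti m)) = lnti m \<star> ev ?D m"
      by (rule evm_natural) simp_all
    finally show "lnt m \<star> wr (ddu e h) m = eva (Tr ?I) (ob (lf (triple_id C)) m)
      \<star> mp (lf (Tr ?I)) (?\<gamma> (ob (lf (triple_id C)) m)) \<star> mp (lf (Tr ?I)) (uni (triple_id C) m)"
      by simp
  qed simp_all
  then show ?thesis
    using A.mate_simps(1)[of ?I ?D ?I "D ?D" "Ev ?D" h "du e"]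
    by (simp add: tau_id ddu_def homs_def)
qed

end

context linear_category
begin

text \<open>Inverting two opposite sides of a commuting square; this converts identities for
  \<open>tau\<close> into identities for \<open>sl\<close>.\<close>

lemma inverse_square:
  assumes "t \<in> homs C x y" "s \<in> homs C y x" "t \<star> s = idt C y"
    and "s' \<in> homs C y' x'" "t' \<in> homs C x' y'" "s' \<star> t' = idt C x'"
    and "q \<in> homs C y y'" "r \<in> homs C x x'" and sq: "q \<star> t = t' \<star> r"
  shows "s' \<star> q = r \<star> s"
proof -
  have "s' \<star> q = s' \<star> (q \<star> t) \<star> s"
    using assms(1-8) by (simp add: homs_def)
  also have "\<dots> = (s' \<star> t') \<star> r \<star> s"
    unfolding sq by simp
  also have "\<dots> = r \<star> s"
    unfolding assms(6) using assms(1-8) by (simp add: homs_def)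
  finally show ?thesis .
qed

end

context lmod
begin

lemma actm_id: "a \<in> Obj A \<Longrightarrow> m \<in> Obj C \<Longrightarrow> actm (Idn A a) (Idn C m) = Idn C (acto a m)"
  using act_bilinear by (simp add: bilinear_functor_def)

end

context rigid_lmod
begin

lemma dm_idt [simp]: "c \<in> Obj A \<Longrightarrow> dm (idt A c) = idt A (D c)"
  using dual[of c] by (simp add: dm_def A.mate_def A.dual_arrows_def)

end

section \<open>The inverse of \<open>tau\<close> as a module functor structure\<close>

context nakayama_rigid
begin

definition sl :: "'a \<Rightarrow> 'o \<Rightarrow> ('o, 'm) arrow" where
  "sl a x = tau_inv (Tr a) (Tr (D a)) (ev a) x"

lemma sl_simps [simp]:
  assumes "a \<in> Obj A" "x \<in> Obj C"
  shows "arr C (sl a x)" "src (sl a x) = No (acto a x)" "tgt (sl a x) = acto (D (D a)) (No x)"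
    "sl a x \<star> tau (Tr a) x = idt C (acto (D (D a)) (No x))"
    "tau (Tr a) x \<star> sl a x = idt C (No (acto a x))"
  using tau_inverse[OF is_chain_Tr[OF assms(1)] assms(2)] by (simp_all add: sl_def homs_def)

lemma sl_tau2 [simp]:
  assumes "a \<in> Obj A" "x \<in> Obj C" "arr C z"
  shows "tgt z = acto (D (D a)) (No x) \<Longrightarrow> sl a x \<star> tau (Tr a) x \<star> z = z"
    "tgt z = No (acto a x) \<Longrightarrow> tau (Tr a) x \<star> sl a x \<star> z = z"
  using sl_simps(4,5)[OF assms(1,2), THEN cmp_reassoc] assms by simp_all

text \<open>Split \<open>act f h\<close> into whiskerings: the part with \<open>h\<close> is
  \<open>tau_natural\<close>, the part with \<open>f\<close> is \<open>tau_dm\<close>.\<close>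

lemma sl_natural:
  assumes f: "arr A f" "src f = a" "tgt f = a'" and h: "arr C h" "src h = m" "tgt h = m'"
  shows "sl a' m' \<star> Nak (act f h) = act (dm (dm f)) (Nak h) \<star> sl a m"
proof -
  note [simp] = f h
  have [simp]: "a \<in> Obj A" "a' \<in> Obj A" "m \<in> Obj C" "m' \<in> Obj C"
    using f h arr_src arr_tgt by metis+
  have "Nak (act f h) \<star> tau (Tr a) m = Nak (wr f m') \<star> Nak (mp (rt (Tr a)) h) \<star> tau (Tr a) m"
    by (simp add: act_wr_wl(1))
  also have "\<dots> = (Nak (wr f m') \<star> tau (Tr a) m') \<star> mp (lf (Tr a)) (Nak h)"
    by (subst tau_natural[of "Tr a" h m m']) simp_all
  also have "Nak (wr f m') \<star> tau (Tr a) m' = tau (Tr a') m' \<star> wr (dm (dm f)) (No m')"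
    using tau_dm[of f m'] by simp
  finally have sq: "Nak (act f h) \<star> tau (Tr a) m = tau (Tr a') m' \<star> act (dm (dm f)) (Nak h)"
    by (simp add: act_wr_wl(1))
  show ?thesis
    by (rule inverse_square[OF _ _ _ _ _ _ _ _ sq]) (auto simp: homs_def act_simps)
qed

lemma mate_tens_simps [simp]:
  assumes "a \<in> Obj A" "b \<in> Obj A" "tens_ev_arrow a b e" "tens_coev_arrow (D b) (D a) h"
  shows "arr A (ddt e h a b)" "src (ddt e h a b) = D (D (a \<otimes>\<^sub>o\<^bsub>A\<^esub> b))" "tgt (ddt e h a b) = D (D a) \<otimes>\<^sub>o\<^bsub>A\<^esub> D (D b)"
    "mor (ddt e h a b) = rmate A (D (a \<otimes>\<^sub>o\<^bsub>A\<^esub> b)) (D (D a) \<otimes>\<^sub>o\<^bsub>A\<^esub> D (D b)) (D (D (a \<otimes>\<^sub>o\<^bsub>A\<^esub> b)))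
       (rev A (D (a \<otimes>\<^sub>o\<^bsub>A\<^esub> b))) (mor h)
       (rmate A (a \<otimes>\<^sub>o\<^bsub>A\<^esub> b) (D (a \<otimes>\<^sub>o\<^bsub>A\<^esub> b)) (D b \<otimes>\<^sub>o\<^bsub>A\<^esub> D a) (mor e) (rcoev A (a \<otimes>\<^sub>o\<^bsub>A\<^esub> b)) (Idn A (a \<otimes>\<^sub>o\<^bsub>A\<^esub> b)))"
proof -
  let ?c = "a \<otimes>\<^sub>o\<^bsub>A\<^esub> b"
  have e: "e \<in> homs A ((D b \<otimes>\<^sub>o\<^bsub>A\<^esub> D a) \<otimes>\<^sub>o\<^bsub>A\<^esub> ?c) (Unit A)"
    and h: "h \<in> homs A (Unit A) ((D b \<otimes>\<^sub>o\<^bsub>A\<^esub> D a) \<otimes>\<^sub>o\<^bsub>A\<^esub> (D (D a) \<otimes>\<^sub>o\<^bsub>A\<^esub> D (D b)))"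
    using assms by (auto simp: tens_ev_arrow_def tens_coev_arrow_def)
  have j: "dt e a b \<in> homs A (D b \<otimes>\<^sub>o\<^bsub>A\<^esub> D a) (D ?c)"
      "mor (dt e a b) = rmate A ?c (D ?c) (D b \<otimes>\<^sub>o\<^bsub>A\<^esub> D a) (mor e) (rcoev A ?c) (Idn A ?c)"
    using A.mate_simps[of ?c ?c "D ?c" "D b \<otimes>\<^sub>o\<^bsub>A\<^esub> D a" e "Cv ?c" "idt A ?c"] e assms(1,2)
    by (auto simp: dt_def homs_def)
  show "arr A (ddt e h a b)" "src (ddt e h a b) = D (D (a \<otimes>\<^sub>o\<^bsub>A\<^esub> b))" "tgt (ddt e h a b) = D (D a) \<otimes>\<^sub>o\<^bsub>A\<^esub> D (D b)"
    "mor (ddt e h a b) = rmate A (D (a \<otimes>\<^sub>o\<^bsub>A\<^esub> b)) (D (D a) \<otimes>\<^sub>o\<^bsub>A\<^esub> D (D b)) (D (D (a \<otimes>\<^sub>o\<^bsub>A\<^esub> b)))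
       (rev A (D (a \<otimes>\<^sub>o\<^bsub>A\<^esub> b))) (mor h)
       (rmate A (a \<otimes>\<^sub>o\<^bsub>A\<^esub> b) (D (a \<otimes>\<^sub>o\<^bsub>A\<^esub> b)) (D b \<otimes>\<^sub>o\<^bsub>A\<^esub> D a) (mor e) (rcoev A (a \<otimes>\<^sub>o\<^bsub>A\<^esub> b)) (Idn A (a \<otimes>\<^sub>o\<^bsub>A\<^esub> b)))"
    using A.mate_simps[of "D b \<otimes>\<^sub>o\<^bsub>A\<^esub> D a" "D ?c" "D (D a) \<otimes>\<^sub>o\<^bsub>A\<^esub> D (D b)" "D (D ?c)" "Ev (D ?c)" h "dt e a b"]
      h j assms(1,2)
    by (auto simp: ddt_def homs_def)
qed

lemma sl_assoc:
  assumes [simp]: "a \<in> Obj A" "b \<in> Obj A" "x \<in> Obj C"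
    and eh [simp]: "tens_ev_arrow a b e" "tens_coev_arrow (D b) (D a) h"
  shows "wl (D (D a)) (sl b x) \<star> sl a (acto b x) \<star> Nak (la a b x)
    = la (D (D a)) (D (D b)) (No x) \<star> wr (ddt e h a b) (No x) \<star> sl (a \<otimes>\<^sub>o\<^bsub>A\<^esub> b) x"
proof -
  have sq: "Nak (la a b x) \<star> tau (Tr (a \<otimes>\<^sub>o\<^bsub>A\<^esub> b)) x = (tau (Tr a) (acto b x) \<star> wl (D (D a)) (tau (Tr b) x))
      \<star> (la (D (D a)) (D (D b)) (No x) \<star> wr (ddt e h a b) (No x))"
    using tau_la[OF assms] by simp
  have "(wl (D (D a)) (sl b x) \<star> sl a (acto b x)) \<star> Nak (la a b x)
    = (la (D (D a)) (D (D b)) (No x) \<star> wr (ddt e h a b) (No x)) \<star> sl (a \<otimes>\<^sub>o\<^bsub>A\<^esub> b) x"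
    by (rule inverse_square[OF _ _ _ _ _ _ _ _ sq]) (auto simp: homs_def)
  then show ?thesis by simp
qed

lemma mate_unit_simps [simp]:
  assumes "unit_ev_arrow e" "unit_coev_arrow h"
  shows "arr A (ddu e h)" "src (ddu e h) = D (D (Unit A))" "tgt (ddu e h) = Unit A"
    "mor (ddu e h) = rmate A (D (Unit A)) (Unit A) (D (D (Unit A))) (rev A (D (Unit A))) (mor h)
       (rmate A (Unit A) (D (Unit A)) (Unit A) (mor e) (rcoev A (Unit A)) (Idn A (Unit A)))"
proof -
  let ?I = "Unit A"
  have e: "e \<in> homs A (?I \<otimes>\<^sub>o\<^bsub>A\<^esub> ?I) ?I" and h: "h \<in> homs A ?I (?I \<otimes>\<^sub>o\<^bsub>A\<^esub> ?I)"
    using assms by (auto simp: unit_ev_arrow_def unit_coev_arrow_def)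
  have j: "du e \<in> homs A ?I (D ?I)" "mor (du e) = rmate A ?I (D ?I) ?I (mor e) (rcoev A ?I) (Idn A ?I)"
    using A.mate_simps[of ?I ?I "D ?I" ?I e "Cv ?I" "idt A ?I"] e by (auto simp: du_def homs_def)
  show "arr A (ddu e h)" "src (ddu e h) = D (D (Unit A))" "tgt (ddu e h) = Unit A"
    "mor (ddu e h) = rmate A (D (Unit A)) (Unit A) (D (D (Unit A))) (rev A (D (Unit A))) (mor h)
       (rmate A (Unit A) (D (Unit A)) (Unit A) (mor e) (rcoev A (Unit A)) (Idn A (Unit A)))"
    using A.mate_simps[of ?I "D ?I" ?I "D (D ?I)" "Ev (D ?I)" h "du e"] h j by (auto simp: ddu_def homs_def)
qed

lemma sl_unit:
  assumes [simp]: "x \<in> Obj C" and eh [simp]: "unit_ev_arrow e" "unit_coev_arrow h"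
  shows "lnt (No x) \<star> wr (ddu e h) (No x) \<star> sl (Unit A) x = Nak (lnt x)"
proof -
  have "Nak (lnt x) = (Nak (lnt x) \<star> tau (Tr (Unit A)) x) \<star> sl (Unit A) x" by simp
  also have "\<dots> = (lnt (No x) \<star> wr (ddu e h) (No x)) \<star> sl (Unit A) x"
    unfolding tau_lnt[OF assms] by simp
  finally show ?thesis by simp
qed

end

text \<open>\<open>B\<close> stands here for the reversal of the category that acts from the right,
  so both actions are left actions: \<open>racto\<close> takes the acting object first, and the
  objects in \<open>rassoc\<close> appear in reversed order.\<close>

locale nakayama_bimodule = L: nakayama_rigid A C lacto lactm lassoc lunitor cpo cpb No Nm \<pi>
    + R: nakayama_rigid B C racto ractm rassoc runitor cpo cpb No Nm \<pi>
  for A :: "('a, 'f::ab_group_add, 'k::field, 'z) rigidcat_scheme"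
    and B :: "('b, 'g::ab_group_add, 'k, 'x) rigidcat_scheme"
    and C :: "('o, 'm::ab_group_add, 'k, 'y) lincat_scheme" (structure)
    and lacto lactm lassoc lunitor racto ractm rassoc runitor cpo cpb No Nm \<pi> +
  fixes middle :: "'a \<Rightarrow> 'o \<Rightarrow> 'b \<Rightarrow> 'm"
  assumes middle_iso: "\<lbrakk>a \<in> Obj A; m \<in> Obj C; b \<in> Obj B\<rbrakk>
          \<Longrightarrow> is_iso C (racto b (lacto a m)) (lacto a (racto b m)) (middle a m b)"
    and middle_natural: "\<lbrakk>a \<in> Obj A; m \<in> Obj C; b \<in> Obj B; a' \<in> Obj A; m' \<in> Obj C; b' \<in> Obj B;
          f \<in> Hom A a a'; h \<in> Hom C m m'; g \<in> Hom B b b'\<rbrakk>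
          \<Longrightarrow> middle a' m' b' \<cdot> ractm g (lactm f h) = lactm f (ractm g h) \<cdot> middle a m b"
    and middle_pentagon_left: "\<lbrakk>a \<in> Obj A; a' \<in> Obj A; m \<in> Obj C; b \<in> Obj B\<rbrakk>
          \<Longrightarrow> lactm (Idn A a) (middle a' m b) \<cdot> middle a (lacto a' m) b \<cdot> ractm (Idn B b) (lassoc a a' m)
            = lassoc a a' (racto b m) \<cdot> middle (a \<otimes>\<^sub>o\<^bsub>A\<^esub> a') m b"
    and middle_pentagon_right: "\<lbrakk>a \<in> Obj A; m \<in> Obj C; b \<in> Obj B; b' \<in> Obj B\<rbrakk>
          \<Longrightarrow> middle a (racto b m) b' \<cdot> ractm (Idn B b') (middle a m b) \<cdot> rassoc b' b (lacto a m)
            = lactm (Idn A a) (rassoc b' b m) \<cdot> middle a m (b' \<otimes>\<^sub>o\<^bsub>B\<^esub> b)"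
    and middle_unit_left: "\<lbrakk>m \<in> Obj C; b \<in> Obj B\<rbrakk>
          \<Longrightarrow> lunitor (racto b m) \<cdot> middle (Unit A) m b = ractm (Idn B b) (lunitor m)"
    and middle_unit_right: "\<lbrakk>a \<in> Obj A; m \<in> Obj C\<rbrakk>
          \<Longrightarrow> lactm (Idn A a) (runitor m) \<cdot> middle a m (Unit B) = runitor (lacto a m)"
begin

definition "mi a m b = Arr (racto b (lacto a m)) (middle a m b) (lacto a (racto b m))"
definition "mii a m b = Arr (lacto a (racto b m)) (inv_mor C (middle a m b)) (racto b (lacto a m))"

lemma mi_simps [simp]:
  assumes "a \<in> Obj A" "m \<in> Obj C" "b \<in> Obj B"
  shows "arr C (mi a m b)" "arr C (mii a m b)"
    "mii a m b \<star> mi a m b = idt C (racto b (lacto a m))" "mi a m b \<star> mii a m b = idt C (lacto a (racto b m))"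
  using assms L.iso_arrows[OF middle_iso[OF assms]] by (simp_all add: mi_def mii_def)

lemma mi_src_tgt [simp]:
  "src (mi a m b) = racto b (lacto a m)" "tgt (mi a m b) = lacto a (racto b m)" "mor (mi a m b) = middle a m b"
  "src (mii a m b) = lacto a (racto b m)" "tgt (mii a m b) = racto b (lacto a m)"
  by (simp_all add: mi_def mii_def)

lemma mi_cancel [simp]:
  assumes "a \<in> Obj A" "m \<in> Obj C" "b \<in> Obj B" "arr C z"
  shows "tgt z = racto b (lacto a m) \<Longrightarrow> mii a m b \<star> mi a m b \<star> z = z"
    "tgt z = lacto a (racto b m) \<Longrightarrow> mi a m b \<star> mii a m b \<star> z = z"
  using mi_simps(3,4)[OF assms(1-3), THEN L.cmp_reassoc] assms by simp_all

lemmas mors = L.mor_cmp L.wl_def L.wr_def R.wl_def R.wr_def L.act_simps R.act_simps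

lemma mi_natural:
  assumes "a \<in> Obj A" "b \<in> Obj B" "arr C h" "src h = m" "tgt h = n"
  shows "mi a n b \<star> R.wl b (L.wl a h) = L.wl a (R.wl b h) \<star> mi a m b"
proof -
  have "m \<in> Obj C" "n \<in> Obj C" using assms by auto
  then show ?thesis
    using assms middle_natural[of a m b a n b "Idn A a" "mor h" "Idn B b"] arr_mor[of C h]
    by (intro arr_eqI[of C]) (auto simp: mors L.A.id_hom R.A.id_hom)
qed

lemma mi_natural_left:
  assumes "m \<in> Obj C" "b \<in> Obj B" "arr A f" "src f = a" "tgt f = a'"
  shows "mi a' m b \<star> R.wl b (L.wr f m) = L.wr f (racto b m) \<star> mi a m b"
proof -
  have "a \<in> Obj A" "a' \<in> Obj A" using assms by auto
  then show ?thesis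
    using assms middle_natural[of a m b a' m b "mor f" "Idn C m" "Idn B b"] arr_mor[of A f]
    by (intro arr_eqI[of C]) (auto simp: mors L.id_hom R.A.id_hom R.actm_id)
qed

lemma mi_natural_right:
  assumes "m \<in> Obj C" "a \<in> Obj A" "arr B g" "src g = b" "tgt g = b'"
  shows "mi a m b' \<star> R.wr g (lacto a m) = L.wl a (R.wr g m) \<star> mi a m b"
proof -
  have "b \<in> Obj B" "b' \<in> Obj B" using assms by auto
  then show ?thesis
    using assms middle_natural[of a m b a m b' "Idn A a" "Idn C m" "mor g"] arr_mor[of B g]
    by (intro arr_eqI[of C]) (auto simp: mors L.id_hom L.A.id_hom L.actm_id)
qed

lemma mi_pentagon_left:
  assumes "a \<in> Obj A" "a' \<in> Obj A" "m \<in> Obj C" "b \<in> Obj B"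
  shows "L.wl a (mi a' m b) \<star> mi a (lacto a' m) b \<star> R.wl b (L.la a a' m) = L.la a a' (racto b m) \<star> mi (a \<otimes>\<^sub>o\<^bsub>A\<^esub> a') m b"
  using middle_pentagon_left[OF assms] assms by (intro arr_eqI[of C]) (auto simp: mors)

lemma mi_pentagon_right:
  assumes "a \<in> Obj A" "m \<in> Obj C" "b \<in> Obj B" "b' \<in> Obj B"
  shows "mi a (racto b m) b' \<star> R.wl b' (mi a m b) \<star> R.la b' b (lacto a m)
    = L.wl a (R.la b' b m) \<star> mi a m (b' \<otimes>\<^sub>o\<^bsub>B\<^esub> b)"
  using middle_pentagon_right[OF assms] assms by (intro arr_eqI[of C]) (auto simp: mors)

lemma mi_unit_left:
  assumes "m \<in> Obj C" "b \<in> Obj B"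
  shows "L.lnt (racto b m) \<star> mi (Unit A) m b = R.wl b (L.lnt m)"
  using middle_unit_left[OF assms] assms by (intro arr_eqI[of C]) (auto simp: mors)

lemma mi_unit_right:
  assumes "a \<in> Obj A" "m \<in> Obj C"
  shows "L.wl a (R.lnt m) \<star> mi a m (Unit B) = R.lnt (lacto a m)"
  using middle_unit_right[OF assms] assms by (intro arr_eqI[of C]) (auto simp: mors)

end

section \<open>Two commuting actions\<close>

context nakayama_bimodule
begin

lemma mi_lai:
  assumes [simp]: "a \<in> Obj A" "a' \<in> Obj A" "m \<in> Obj C" "b \<in> Obj B"
  shows "L.lai a a' (racto b m) \<star> L.wl a (mi a' m b) \<star> mi a (lacto a' m) b = mi (a \<otimes>\<^sub>o\<^bsub>A\<^esub> a') m b \<star> R.wl b (L.lai a a' m)"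
proof -
  have "L.lai a a' (racto b m) \<star> L.wl a (mi a' m b) \<star> mi a (lacto a' m) b
      = L.lai a a' (racto b m) \<star> (L.wl a (mi a' m b) \<star> mi a (lacto a' m) b \<star> R.wl b (L.la a a' m)) \<star> R.wl b (L.lai a a' m)"
    by simp
  also have "\<dots> = mi (a \<otimes>\<^sub>o\<^bsub>A\<^esub> a') m b \<star> R.wl b (L.lai a a' m)"
    unfolding mi_pentagon_left[OF assms] by simp
  finally show ?thesis .
qed

lemma mi_lai_right:
  assumes [simp]: "a \<in> Obj A" "m \<in> Obj C" "b \<in> Obj B" "b' \<in> Obj B"
  shows "L.wl a (R.lai b' b m) \<star> mi a (racto b m) b' \<star> R.wl b' (mi a m b) = mi a m (b' \<otimes>\<^sub>o\<^bsub>B\<^esub> b) \<star> R.lai b' b (lacto a m)"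
proof -
  have "L.wl a (R.lai b' b m) \<star> mi a (racto b m) b' \<star> R.wl b' (mi a m b)
      = L.wl a (R.lai b' b m) \<star> (mi a (racto b m) b' \<star> R.wl b' (mi a m b) \<star> R.la b' b (lacto a m)) \<star> R.lai b' b (lacto a m)"
    by simp
  also have "\<dots> = mi a m (b' \<otimes>\<^sub>o\<^bsub>B\<^esub> b) \<star> R.lai b' b (lacto a m)"
    unfolding mi_pentagon_right[OF assms] by simp
  finally show ?thesis .
qed

text \<open>Pentagon, naturality and unit axiom of \<open>mi\<close>, one for each factor of
  \<open>evm\<close>. The three lemmas that follow are the analogues for coevaluations and for the
  other action.\<close>

lemma evm_left:
  assumes [simp]: "a \<in> Obj A" "X \<in> Obj A" "arr A e" "src e = X \<otimes>\<^sub>o\<^bsub>A\<^esub> a" "tgt e = Unit A" "m \<in> Obj C" "b \<in> Obj B"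
  shows "L.evm X a e (racto b m) \<star> L.wl X (mi a m b) \<star> mi X (lacto a m) b = R.wl b (L.evm X a e m)"
proof -
  have "L.evm X a e (racto b m) \<star> L.wl X (mi a m b) \<star> mi X (lacto a m) b
      = L.lnt (racto b m) \<star> (L.wr e (racto b m) \<star> mi (X \<otimes>\<^sub>o\<^bsub>A\<^esub> a) m b) \<star> R.wl b (L.lai X a m)"
    by (simp add: L.evm_def mi_lai)
  also have "L.wr e (racto b m) \<star> mi (X \<otimes>\<^sub>o\<^bsub>A\<^esub> a) m b = mi (Unit A) m b \<star> R.wl b (L.wr e m)"
    by (rule mi_natural_left[symmetric]) simp_all
  finally show ?thesis
    using mi_unit_left[of m b, THEN L.cmp_reassoc] by (simp add: L.evm_def)
qed

lemma coevm_left: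
  assumes [simp]: "a \<in> Obj A" "X \<in> Obj A" "arr A h" "src h = Unit A" "tgt h = a \<otimes>\<^sub>o\<^bsub>A\<^esub> X" "m \<in> Obj C" "b \<in> Obj B"
  shows "L.wl a (mi X m b) \<star> mi a (lacto X m) b \<star> R.wl b (L.coevm a X h m) = L.coevm a X h (racto b m)"
proof -
  have "L.wl a (mi X m b) \<star> mi a (lacto X m) b \<star> R.wl b (L.coevm a X h m)
      = (L.wl a (mi X m b) \<star> mi a (lacto X m) b \<star> R.wl b (L.la a X m)) \<star> R.wl b (L.wr h m) \<star> R.wl b (L.lnti m)"
    by (simp add: L.coevm_def)
  also have "\<dots> = L.la a X (racto b m) \<star> (mi (a \<otimes>\<^sub>o\<^bsub>A\<^esub> X) m b \<star> R.wl b (L.wr h m)) \<star> R.wl b (L.lnti m)"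
    by (subst mi_pentagon_left) simp_all
  also have "mi (a \<otimes>\<^sub>o\<^bsub>A\<^esub> X) m b \<star> R.wl b (L.wr h m) = L.wr h (racto b m) \<star> mi (Unit A) m b"
    by (rule mi_natural_left) simp_all
  also have "L.la a X (racto b m) \<star> (L.wr h (racto b m) \<star> mi (Unit A) m b) \<star> R.wl b (L.lnti m)
      = L.la a X (racto b m) \<star> L.wr h (racto b m) \<star> L.lnti (racto b m)
         \<star> (L.lnt (racto b m) \<star> mi (Unit A) m b) \<star> R.wl b (L.lnti m)"
    by simp
  also have "\<dots> = L.coevm a X h (racto b m)"
    unfolding mi_unit_left[OF assms(6,7)] by (simp add: L.coevm_def)
  finally show ?thesis .
qed

lemma evm_right:
  assumes [simp]: "b \<in> Obj B" "Y \<in> Obj B" "arr B e" "src e = Y \<otimes>\<^sub>o\<^bsub>B\<^esub> b" "tgt e = Unit B" "m \<in> Obj C" "a \<in> Obj A"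
  shows "L.wl a (R.evm Y b e m) \<star> mi a (racto b m) Y \<star> R.wl Y (mi a m b) = R.evm Y b e (lacto a m)"
proof -
  have "L.wl a (R.evm Y b e m) \<star> mi a (racto b m) Y \<star> R.wl Y (mi a m b)
     = L.wl a (R.lnt m) \<star> (L.wl a (R.wr e m) \<star> mi a m (Y \<otimes>\<^sub>o\<^bsub>B\<^esub> b)) \<star> R.lai Y b (lacto a m)"
    by (simp add: R.evm_def mi_lai_right)
  also have "L.wl a (R.wr e m) \<star> mi a m (Y \<otimes>\<^sub>o\<^bsub>B\<^esub> b) = mi a m (Unit B) \<star> R.wr e (lacto a m)"
    by (rule mi_natural_right[symmetric]) simp_all
  finally show ?thesis
    using mi_unit_right[of a m, THEN L.cmp_reassoc] by (simp add: R.evm_def)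
qed

lemma coevm_right:
  assumes [simp]: "b \<in> Obj B" "Y \<in> Obj B" "arr B h" "src h = Unit B" "tgt h = b \<otimes>\<^sub>o\<^bsub>B\<^esub> Y" "m \<in> Obj C" "a \<in> Obj A"
  shows "mi a (racto Y m) b \<star> R.wl b (mi a m Y) \<star> R.coevm b Y h (lacto a m) = L.wl a (R.coevm b Y h m)"
proof -
  have "mi a (racto Y m) b \<star> R.wl b (mi a m Y) \<star> R.coevm b Y h (lacto a m)
      = (mi a (racto Y m) b \<star> R.wl b (mi a m Y) \<star> R.la b Y (lacto a m)) \<star> R.wr h (lacto a m) \<star> R.lnti (lacto a m)"
    by (simp add: R.coevm_def)
  also have "\<dots> = L.wl a (R.la b Y m) \<star> (mi a m (b \<otimes>\<^sub>o\<^bsub>B\<^esub> Y) \<star> R.wr h (lacto a m)) \<star> R.lnti (lacto a m)"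
    by (subst mi_pentagon_right) simp_all
  also have "mi a m (b \<otimes>\<^sub>o\<^bsub>B\<^esub> Y) \<star> R.wr h (lacto a m) = L.wl a (R.wr h m) \<star> mi a m (Unit B)"
    by (rule mi_natural_right) simp_all
  also have "L.wl a (R.la b Y m) \<star> (L.wl a (R.wr h m) \<star> mi a m (Unit B)) \<star> R.lnti (lacto a m)
      = L.wl a (R.la b Y m) \<star> L.wl a (R.wr h m) \<star> L.wl a (R.lnti m)
         \<star> (L.wl a (R.lnt m) \<star> mi a m (Unit B)) \<star> R.lnti (lacto a m)"
    by simp
  also have "\<dots> = L.wl a (R.coevm b Y h m)"
    unfolding mi_unit_right[OF assms(7,6)] by (simp add: R.coevm_def)
  finally show ?thesis .
qed

text \<open>\<alpha>, \<gamma> and \<kappa> are all given by \<open>mi\<close>: for \<open>a\<close>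
  and \<open>b\<close>, for their duals and for their double duals. So \<open>tau_transform\<close>
  applies directly to the two orders of composing the triples, and no transposes have to be
  computed.\<close>

lemma tau_middle:
  assumes a [simp]: "a \<in> Obj A" and b [simp]: "b \<in> Obj B" and x [simp]: "x \<in> Obj C"
  shows "L.Nak (mi a x b) \<star> L.tau (R.Tr b) (lacto a x) \<star> R.wl (R.D (R.D b)) (L.tau (L.Tr a) x)
    = L.tau (L.Tr a) (racto b x) \<star> L.wl (L.D (L.D a)) (L.tau (R.Tr b) x) \<star> mi (L.D (L.D a)) (No x) (R.D (R.D b))"
proof -
  let ?S = "triple_comp C (R.Tr b) (L.Tr a)" and ?T = "triple_comp C (L.Tr a) (R.Tr b)"
  let ?Da = "L.D a" and ?DDa = "L.D (L.D a)" and ?Db = "R.D b" and ?DDb = "R.D (R.D b)"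
  have mi_nat: "nat_tr C (endo_comp (R.L q) (L.L p)) (endo_comp (L.L p) (R.L q)) (\<lambda>m. mi p m q)"
    if "p \<in> Obj A" "q \<in> Obj B" for p q
    using that by (auto simp: nat_tr_def homs_def mi_natural)
  have "L.Nak (mi a x b) \<star> L.tau ?S x = L.tau ?T x \<star> mi ?DDa (No x) ?DDb"
  proof (rule L.tau_transform[of _ _ "\<lambda>x. mi a x b" "\<lambda>x. mi ?Da x ?Db" "\<lambda>x. mi ?DDa x ?DDb"])
    fix m assume m [simp]: "m \<in> Obj C"
    let ?e = "L.Cv a" and ?h = "R.Cv b"
    \<comment> \<open>Compatibility with the units: \<open>coevm_right\<close> and
      \<open>coevm_left\<close> slide \<open>mi\<close> through the nested coevaluations.\<close>
    have "R.wl b (mi ?Da m ?Db) \<star> R.coevm b ?Db ?h (lacto ?Da m)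
        = mii ?Da (racto ?Db m) b \<star> (mi ?Da (racto ?Db m) b \<star> R.wl b (mi ?Da m ?Db) \<star> R.coevm b ?Db ?h (lacto ?Da m))"
      by simp
    also have "\<dots> = mii ?Da (racto ?Db m) b \<star> L.wl ?Da (R.coevm b ?Db ?h m)"
      by (subst coevm_right) simp_all
    finally have 1: "R.wl b (mi ?Da m ?Db) \<star> R.coevm b ?Db ?h (lacto ?Da m)
        = mii ?Da (racto ?Db m) b \<star> L.wl ?Da (R.coevm b ?Db ?h m)" .
    have "L.wl a (R.wl b (mi ?Da m ?Db)) \<star> L.wl a (R.coevm b ?Db ?h (lacto ?Da m)) \<star> L.coevm a ?Da ?e m
        = L.wl a (R.wl b (mi ?Da m ?Db) \<star> R.coevm b ?Db ?h (lacto ?Da m)) \<star> L.coevm a ?Da ?e m"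
      by simp
    also have "\<dots> = L.wl a (mii ?Da (racto ?Db m) b) \<star> L.coevm a ?Da ?e (racto b (racto ?Db m)) \<star> R.coevm b ?Db ?h m"
      unfolding 1 by (simp add: L.coevm_natural)
    also have "L.coevm a ?Da ?e (racto b (racto ?Db m))
        = L.wl a (mi ?Da (racto ?Db m) b) \<star> mi a (lacto ?Da (racto ?Db m)) b \<star> R.wl b (L.coevm a ?Da ?e (racto ?Db m))"
      by (rule coevm_left[symmetric]) simp_all
    finally show "mi a (ob (md ?S) m) b \<star> cou ?S m = mp (rt ?T) (mi ?Da m ?Db) \<star> cou ?T m"
      by simp
    let ?E = "L.evm ?DDa ?Da (L.Ev ?Da)" and ?F = "R.evm ?DDb ?Db (R.Ev ?Db)"
    \<comment> \<open>Compatibility with the counits: expand \<open>?F\<close> at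
      \<open>lacto ?Da m\<close> by \<open>evm_right\<close>, exchange the two evaluations by
      naturality, and contract by \<open>evm_left\<close>.\<close>
    have "?E m \<star> L.wl ?DDa (?F (lacto ?Da m)) \<star> mi ?DDa (racto ?Db (lacto ?Da m)) ?DDb
        = ?E m \<star> L.wl ?DDa (L.wl ?Da (?F m) \<star> mi ?Da (racto ?Db m) ?DDb \<star> R.wl ?DDb (mi ?Da m ?Db))
          \<star> mi ?DDa (racto ?Db (lacto ?Da m)) ?DDb"
      by (subst evm_right) simp_all
    also have "\<dots> = (?E m \<star> L.wl ?DDa (L.wl ?Da (?F m))) \<star> L.wl ?DDa (mi ?Da (racto ?Db m) ?DDb)
        \<star> L.wl ?DDa (R.wl ?DDb (mi ?Da m ?Db)) \<star> mi ?DDa (racto ?Db (lacto ?Da m)) ?DDb"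
      by simp
    also have "L.wl ?DDa (R.wl ?DDb (mi ?Da m ?Db)) \<star> mi ?DDa (racto ?Db (lacto ?Da m)) ?DDb
        = mi ?DDa (lacto ?Da (racto ?Db m)) ?DDb \<star> R.wl ?DDb (L.wl ?DDa (mi ?Da m ?Db))"
      by (rule mi_natural[symmetric]) simp_all
    also have "?E m \<star> L.wl ?DDa (L.wl ?Da (?F m)) = ?F m \<star> ?E (racto ?DDb (racto ?Db m))"
      by (rule L.evm_natural) simp_all
    also have "(?F m \<star> ?E (racto ?DDb (racto ?Db m))) \<star> L.wl ?DDa (mi ?Da (racto ?Db m) ?DDb)
        \<star> mi ?DDa (lacto ?Da (racto ?Db m)) ?DDb \<star> R.wl ?DDb (L.wl ?DDa (mi ?Da m ?Db))
      = ?F m \<star> (?E (racto ?DDb (racto ?Db m)) \<star> L.wl ?DDa (mi ?Da (racto ?Db m) ?DDb)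
        \<star> mi ?DDa (lacto ?Da (racto ?Db m)) ?DDb) \<star> R.wl ?DDb (L.wl ?DDa (mi ?Da m ?Db))"
      by simp
    also have "?E (racto ?DDb (racto ?Db m)) \<star> L.wl ?DDa (mi ?Da (racto ?Db m) ?DDb)
        \<star> mi ?DDa (lacto ?Da (racto ?Db m)) ?DDb = R.wl ?DDb (?E (racto ?Db m))"
      by (rule evm_left) simp_all
    finally show "eva ?T m \<star> mi ?DDa (ob (md ?T) m) ?DDb = eva ?S m \<star> mp (lf ?S) (mi ?Da m ?Db)"
      by simp
  qed (simp_all add: mi_nat L.is_triple_comp)
  then show ?thesis
    by (simp add: L.tau_comp)
qed

lemma sl_middle:
  assumes a [simp]: "a \<in> Obj A" and b [simp]: "b \<in> Obj B" and x [simp]: "x \<in> Obj C"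
  shows "L.wl (L.D (L.D a)) (R.sl b x) \<star> L.sl a (racto b x) \<star> L.Nak (mi a x b)
    = mi (L.D (L.D a)) (No x) (R.D (R.D b)) \<star> R.wl (R.D (R.D b)) (L.sl a x) \<star> R.sl b (lacto a x)"
proof -
  let ?DDa = "L.D (L.D a)" and ?DDb = "R.D (R.D b)"
  have sq: "L.Nak (mi a x b) \<star> (L.tau (R.Tr b) (lacto a x) \<star> R.wl ?DDb (L.tau (L.Tr a) x))
    = (L.tau (L.Tr a) (racto b x) \<star> L.wl ?DDa (L.tau (R.Tr b) x)) \<star> mi ?DDa (No x) ?DDb"
    using tau_middle[OF assms] by simp
  have 1: "R.wl ?DDb (L.tau (L.Tr a) x) \<star> R.wl ?DDb (L.sl a x) = idt C (racto ?DDb (No (lacto a x)))"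
    by (rule R.wl_inverse(1)) simp_all
  have 2: "L.wl ?DDa (R.sl b x) \<star> L.wl ?DDa (L.tau (R.Tr b) x) = idt C (lacto ?DDa (racto ?DDb (No x)))"
    by (rule L.wl_inverse(1)) simp_all
  have "(L.wl ?DDa (R.sl b x) \<star> L.sl a (racto b x)) \<star> L.Nak (mi a x b)
    = mi ?DDa (No x) ?DDb \<star> (R.wl ?DDb (L.sl a x) \<star> R.sl b (lacto a x))"
    by (rule L.inverse_square[OF _ _ _ _ _ _ _ _ sq])
      (auto simp: homs_def 2 1[THEN L.cmp_reassoc])
  then show ?thesis by simp
qed

end

section \<open>The reversed monoidal category\<close>

context linear_category
begin

text \<open>Meant for the reversed category: its associator is an inverse, and the inverse of that
  must be recognised as the original associator.\<close>

lemma inv_mor_inverse: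
  assumes iso: "is_iso C x y f" and xy: "x \<in> Obj C" "y \<in> Obj C"
  shows "is_iso C y x (inv_mor C f)" and "inv_mor C (inv_mor C f) = f"
proof -
  have inv: "is_inverse C y x (inv_mor C f) f"
    using is_inverse_inv_mor[OF xy iso] by (auto simp: is_inverse_def)
  then show iso': "is_iso C y x (inv_mor C f)" by (auto simp: is_iso_def)
  note i1 = is_inverseD[OF inv xy(2,1)]
    and i2 = is_inverseD[OF is_inverse_inv_mor[OF xy(2,1) iso'] xy(2,1)]
  show "inv_mor C (inv_mor C f) = f"
    using inverse_unique[OF i1(1) i2(2) i1(2) i2(3) i1(4)] by simp
qed

end

context lmod
begin

lemma mor_w: "mor (wl a h) = actm (Idn A a) (mor h)" "mor (wr f m) = actm (mor f) (Idn C m)"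
  by (simp_all add: wl_def wr_def act_simps)

end

section \<open>The structure isomorphisms as bare morphisms\<close>

context nakayama_rigid
begin

lemma sl_iso:
  assumes "a \<in> Obj A" "m \<in> Obj C"
  shows "is_iso C (No (acto a m)) (acto (D (D a)) (No m)) (mor (sl a m))"
  by (rule is_isoI[of _ _ _ "tau (Tr a) m"]) (use assms in \<open>auto simp: homs_def\<close>)

lemma sl_natural_mor:
  assumes "a \<in> Obj A" "a' \<in> Obj A" "f \<in> Hom A a a'" "m \<in> Obj C" "m' \<in> Obj C" "h \<in> Hom C m m'"
  shows "mor (sl a' m') \<cdot> Nm (actm f h) = actm (rdualm A (rdualm A f)) (Nm h) \<cdot> mor (sl a m)"
proof -
  let ?f = "Arr a f a'" and ?h = "Arr m h m'"
  have "sl a' m' \<star> Nak (act ?f ?h) = act (dm (dm ?f)) (Nak ?h) \<star> sl a m"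
    by (rule sl_natural) (use assms in simp_all)
  from arg_cong[OF this, of mor] show ?thesis
    using assms by (simp add: mor_cmp act_simps mor_Nak mor_dm)
qed

lemma rdualm_idn: "c \<in> Obj A \<Longrightarrow> rdualm A (Idn A c) = Idn A (D c)"
  using mor_dm[of "idt A c"] by simp

lemma sl_assoc_mor:
  assumes "a \<in> Obj A" "b \<in> Obj A" "m \<in> Obj C" "tens_ev_arrow a b e" "tens_coev_arrow (D b) (D a) h"
  shows "actm (Idn A (D (D a))) (mor (sl b m)) \<cdot> mor (sl a (acto b m)) \<cdot> Nm (lass a b m)
    = (lass (D (D a)) (D (D b)) (No m) \<cdot> actm (mor (ddt e h a b)) (Idn C (No m))) \<cdot> mor (sl (a \<otimes>\<^sub>o\<^bsub>A\<^esub> b) m)"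
proof -
  have "wl (D (D a)) (sl b m) \<star> sl a (acto b m) \<star> Nak (la a b m)
    = (la (D (D a)) (D (D b)) (No m) \<star> wr (ddt e h a b) (No m)) \<star> sl (a \<otimes>\<^sub>o\<^bsub>A\<^esub> b) m"
    using sl_assoc[OF assms] by simp
  from arg_cong[OF this, of mor] show ?thesis
    using assms by (simp add: mor_cmp mor_w mor_Nak del: cmp_assoc mate_tens_simps(4))
qed

lemma sl_unit_mor:
  assumes "m \<in> Obj C" "unit_ev_arrow e" "unit_coev_arrow h"
  shows "(lun (No m) \<cdot> actm (mor (ddu e h)) (Idn C (No m))) \<cdot> mor (sl (Unit A) m) = Nm (lun m)"
proof -
  have "(lnt (No m) \<star> wr (ddu e h) (No m)) \<star> sl (Unit A) m = Nak (lnt m)"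
    using sl_unit[OF assms] by simp
  from arg_cong[OF this, of mor] show ?thesis
    using assms by (simp add: mor_cmp mor_w mor_Nak del: cmp_assoc mate_unit_simps(4))
qed

end

context nakayama_bimodule
begin

lemma sl_middle_mor:
  assumes "a \<in> Obj A" "b \<in> Obj B" "x \<in> Obj C"
  shows "middle (L.D (L.D a)) (No x) (R.D (R.D b)) \<cdot> ractm (Idn B (R.D (R.D b))) (mor (L.sl a x)) \<cdot> mor (R.sl b (lacto a x))
    = lactm (Idn A (L.D (L.D a))) (mor (R.sl b x)) \<cdot> mor (L.sl a (racto b x)) \<cdot> Nm (middle a x b)"
  using arg_cong[OF sl_middle[OF assms], of mor] assms
  by (simp add: L.mor_cmp L.mor_w R.mor_w L.mor_Nak)

text \<open>The inverse is \<open>tau\<close> for \<open>b\<close> after the action of the double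
  dual of \<open>b\<close> on \<open>tau\<close> for \<open>a\<close>.\<close>

lemma sl_sr_iso:
  assumes [simp]: "a \<in> Obj A" "b \<in> Obj B" "x \<in> Obj C"
  shows "is_iso C (No (racto b (lacto a x))) (racto (R.D (R.D b)) (lacto (L.D (L.D a)) (No x)))
    (ractm (Idn B (R.D (R.D b))) (mor (L.sl a x)) \<cdot> mor (R.sl b (lacto a x)))"
proof -
  let ?s = "R.wl (R.D (R.D b)) (L.sl a x)" and ?t = "R.wl (R.D (R.D b)) (L.tau (L.Tr a) x)"
  have 1: "?t \<star> ?s = idt C (racto (R.D (R.D b)) (No (lacto a x)))"
    "?s \<star> ?t = idt C (racto (R.D (R.D b)) (lacto (L.D (L.D a)) (No x)))"
    by (rule R.wl_inverse(1); simp)+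
  have "is_iso C (No (racto b (lacto a x))) (racto (R.D (R.D b)) (lacto (L.D (L.D a)) (No x)))
      (mor (?s \<star> R.sl b (lacto a x)))"
    by (rule L.is_isoI[of _ _ _ "L.tau (R.Tr b) (lacto a x) \<star> ?t"])
      (auto simp: homs_def 1 1[THEN L.cmp_reassoc])
  then show ?thesis by (simp add: L.mor_cmp R.mor_w)
qed

end

lemma (in nakayama) linear_functor_Nm: "linear_functor C C No Nm"
proof -
  have *: "Nm f = mor (Nak (Arr x f y))" for x f y by (simp add: mor_Nak)
  show ?thesis
    unfolding linear_functor_def
  proof (intro conjI ballI allI)
    show "No x \<in> Obj C" if "x \<in> Obj C" for x using that by simp
    show "Nm (Idn C x) = Idn C (No x)" if "x \<in> Obj C" for x
      using arg_cong[OF Nak_functor(5)[OF that], of mor] by (simp add: mor_Nak)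
    fix x y f assume xy [simp]: "x \<in> Obj C" "y \<in> Obj C" and f [simp]: "f \<in> Hom C x y"
    show "Nm f \<in> Hom C (No x) (No y)" by (rule Nm_raw[OF xy f])
    show "Nm (Scale C r f) = Scale C r (Nm f)" for r
      using arg_cong[OF Nak_functor(8)[of "Arr x f y" r], of mor] by (simp add: mor_Nak mor_scale)
    show "Nm (f + f') = Nm f + Nm f'" if "f' \<in> Hom C x y" for f'
      using arg_cong[OF Nak_functor(7)[of "Arr x f y" "Arr x f' y"], of mor] that by (simp add: mor_Nak mor_plus)
    fix z g assume [simp]: "z \<in> Obj C" "g \<in> Hom C y z"
    show "Nm (g \<cdot> f) = Nm g \<cdot> Nm f"
      using arg_cong[OF Nak_functor(6)[of "Arr x f y" "Arr y g z"], of mor]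
      by (simp add: mor_Nak mor_cmp del: Nak_functor)
  qed
qed

text \<open>Reversing the tensor factors inverts the associator and exchanges the unit constraints.
  The evaluation of a left dual has the shape of a right evaluation in the reversed category, so
  left duals become its \<open>rdual\<close>, and double left duals become double right
  duals.\<close>

definition revc :: "('b, 'g::ab_group_add, 'k, 'z) rigidcat_scheme \<Rightarrow> ('b, 'g, 'k, 'z) rigidcat_scheme" where
  "revc B = B \<lparr> tenso := (\<lambda>a b. tenso B b a), tensm := (\<lambda>f g. tensm B g f),
     assoc := (\<lambda>a b c. inv_mor B (assoc B c b a)), lunit := runit B, runit := lunit B,
     rdual := ldual B, rev := lev B, rcoev := lcoev B \<rparr>"

lemma revc_simps [simp]:
  "Obj (revc B) = Obj B" "Hom (revc B) = Hom B" "Idn (revc B) = Idn B" "Comp (revc B) = Comp B"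
  "Scale (revc B) = Scale B" "tenso (revc B) a b = tenso B b a" "tensm (revc B) f g = tensm B g f"
  "Unit (revc B) = Unit B" "assoc (revc B) a b c = inv_mor B (assoc B c b a)" "lunit (revc B) = runit B"
  "runit (revc B) = lunit B" "rdual (revc B) = ldual B" "rev (revc B) = lev B" "rcoev (revc B) = lcoev B"
  by (simp_all add: revc_def)

lemma revc_inv [simp]: "is_inverse (revc B) = is_inverse B" "is_iso (revc B) = is_iso B" "inv_mor (revc B) = inv_mor B"
  by (simp_all add: fun_eq_iff is_inverse_def is_iso_def inv_mor_def)

lemma bilinear_functor_swap:
  assumes "bilinear_functor C D E Fo Fm"
  shows "bilinear_functor D C E (\<lambda>x y. Fo y x) (\<lambda>f g. Fm g f)"
proof -
  note parts = assms[unfolded bilinear_functor_def]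
  note p1 = parts[THEN conjunct1, rule_format]
  note p2 = parts[THEN conjunct2, THEN conjunct1, rule_format]
  note p3 = parts[THEN conjunct2, THEN conjunct2, THEN conjunct1, rule_format]
  note p4 = parts[THEN conjunct2, THEN conjunct2, THEN conjunct2, THEN conjunct1, rule_format]
  note p5 = parts[THEN conjunct2, THEN conjunct2, THEN conjunct2, THEN conjunct2, THEN conjunct1, rule_format]
  note p6 = parts[THEN conjunct2, THEN conjunct2, THEN conjunct2, THEN conjunct2, THEN conjunct2, THEN conjunct1, rule_format]
  note p7 = parts[THEN conjunct2, THEN conjunct2, THEN conjunct2, THEN conjunct2, THEN conjunct2, THEN conjunct2, rule_format]
  show ?thesis
    unfolding bilinear_functor_def
    by (intro conjI ballI allI) (simp_all add: p1 p2 p3 p4 p5 p6 p7)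
qed

lemma bilinear_functor_revc_left: "bilinear_functor (revc B) D E Fo Fm = bilinear_functor B D E Fo Fm"
  by (simp add: bilinear_functor_def)

context finite_tensor_category
begin

lemma weak_monoidal: "weak_monoidal A"
  by unfold_locales (use tensor_bilinear unit_obj assoc_iso lunit_iso runit_iso triangle in auto)

lemma tens_obj [simp]: "a \<in> Obj A \<Longrightarrow> b \<in> Obj A \<Longrightarrow> a \<otimes>\<^sub>o b \<in> Obj A"
  by (rule weak_monoidal.tenso_obj[OF weak_monoidal])

lemma inv_inv_assoc [simp]:
  "a \<in> Obj A \<Longrightarrow> b \<in> Obj A \<Longrightarrow> c \<in> Obj A \<Longrightarrow> inv_mor A (inv_mor A (assoc A a b c)) = assoc A a b c"
  by (rule inv_mor_inverse(2)[OF assoc_iso]) auto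

lemma linear_category_revc: "linear_category (revc A)"
  using linear_category_axioms by (simp add: linear_category_def)

lemma weak_monoidal_revc: "weak_monoidal (revc A)"
proof -
  interpret W: weak_monoidal A by (rule weak_monoidal)
  interpret R: linear_category "revc A" by (rule linear_category_revc)
  show ?thesis
  proof unfold_locales
    show "bilinear_functor (revc A) (revc A) (revc A) (tenso (revc A)) (tensm (revc A))"
      using bilinear_functor_swap[OF tensor_bilinear] by (simp add: bilinear_functor_def)
    fix a b c assume ob [simp]: "a \<in> Obj (revc A)" "b \<in> Obj (revc A)"
    then have [simp]: "a \<in> Obj A" "b \<in> Obj A" by simp_all
    show "is_iso (revc A) (tenso (revc A) (Unit (revc A)) a) a (lunit (revc A) a)"
      "is_iso (revc A) (tenso (revc A) a (Unit (revc A))) a (runit (revc A) a)"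
      using lunit_iso[of a] runit_iso[of a] by simp_all
    \<comment> \<open>The triangle axiom solved for the inverse associator; read in reversed order
      it is the triangle axiom of \<open>revc A\<close>.\<close>
    have "W.ten (idt A b) (W.lu a) = W.ten (W.ru b) (idt A a) \<star> W.assi b (Unit A) a"
      by (simp flip: W.triangle_arr)
    from arg_cong[OF this, of mor]
    show "tensm (revc A) (Idn (revc A) a) (lunit (revc A) b) \<cdot>\<^bsub>revc A\<^esub> assoc (revc A) a (Unit (revc A)) b
        = tensm (revc A) (runit (revc A) a) (Idn (revc A) b)"
      by (simp add: mor_cmp)
    assume "c \<in> Obj (revc A)"
    then show "is_iso (revc A) (tenso (revc A) (tenso (revc A) a b) c) (tenso (revc A) a (tenso (revc A) b c))
        (assoc (revc A) a b c)"
      using inv_mor_inverse(1)[OF assoc_iso[of c b a]] by simp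
  qed (simp add: unit_obj)
qed

lemma dual_obj [simp]: "c \<in> Obj A \<Longrightarrow> ldual A c \<in> Obj A" "c \<in> Obj A \<Longrightarrow> rdual A c \<in> Obj A"
  using left_dual[of c] right_dual[of c] by (auto simp: dual_pair_def)

text \<open>Reversal exchanges the two kinds of transpose. The inverse associator of the reversed
  category is an inverse of an inverse, which \<open>inv_inv_assoc\<close> removes.\<close>

lemma rmate_revc:
  assumes "d \<in> Obj A" "X \<in> Obj A" "Y \<in> Obj A"
  shows "rmate (revc A) d X Y e h f = lmate A d X Y e h f"
  using assms by (simp add: rmate_def lmate_def)

lemma dual_pair_revc: "c \<in> Obj A \<Longrightarrow> dual_pair (revc A) c (ldual A c) (lev A c) (lcoev A c)"
  using left_dual[of c] by (simp add: dual_pair_def)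

lemma rdualm_revc: "rdualm (revc A) f = ldualm A f"
  unfolding rdualm_def ldualm_def
  by (rule arg_cong[of _ _ The]) (auto simp: fun_eq_iff rmate_revc)

end

section \<open>Bimodule categories\<close>

context rigid_lmod
begin

lemma tens_arrows:
  assumes "a \<in> Obj A" "b \<in> Obj A"
  shows "tens_ev_arrow a b (A.TE a b (D a) (D b) (Ev a) (Ev b))"
    "tens_ev_arrow a b (A.TE' a b (D a) (D b) (Ev a) (Ev b))"
    "tens_coev_arrow a b (A.TH a b (D a) (D b) (Cv a) (Cv b))"
    "tens_coev_arrow a b (A.TH' a b (D a) (D b) (Cv a) (Cv b))"
  using assms A.tens_simps[of a b "D a" "D b" "Ev a" "Ev b" "Cv a" "Cv b"]
  unfolding tens_ev_arrow_def tens_coev_arrow_def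
  by (simp_all add: homs_def evm_TE coevm_TH)

lemma unit_arrows:
  "unit_ev_arrow (A.lu (Unit A))" "unit_ev_arrow (A.ru (Unit A))"
  "unit_coev_arrow (A.lui (Unit A))" "unit_coev_arrow (A.rui (Unit A))"
  by (simp_all add: unit_ev_arrow_def unit_coev_arrow_def homs_def evm_unit coevm_unit)

end

section \<open>Both actions as left actions of rigid categories\<close>

lemma (in left_module_category) rigid_lmod: "rigid_lmod A M (lacto M) (lactm M) (lassoc M) (lunitor M)"
proof -
  interpret W: weak_monoidal A by (rule A.weak_monoidal)
  show ?thesis
    by unfold_locales (fact lact_bilinear lassoc_iso lassoc_natural lunitor_iso lunitor_natural
        lact_pentagon lact_triangle A.right_dual)+
qed

text \<open>Apart from the pentagon, the action axioms are those of the right action with arguments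
  renamed. In the pentagon the associator occurs inverted and has to be moved to the other side of
  the equation.\<close>

lemma (in right_module_category) rigid_lmod_revc:
  "rigid_lmod (revc B) M (\<lambda>b m. racto M m b) (\<lambda>g h. ractm M h g) (\<lambda>a b m. rassoc M m b a) (runitor M)"
proof -
  interpret W: weak_monoidal "revc B" by (rule B.weak_monoidal_revc)
  interpret V: weak_monoidal B by (rule B.weak_monoidal)
  have ob: "m \<lhd>\<^sub>o b \<in> Obj M" if "m \<in> Obj M" "b \<in> Obj B" for m b
    using ract_bilinear that by (simp add: bilinear_functor_def)
  have hom: "h \<lhd>\<^sub>m g \<in> Hom M (m \<lhd>\<^sub>o b) (m' \<lhd>\<^sub>o b')"
    if "m \<in> Obj M" "m' \<in> Obj M" "h \<in> Hom M m m'" "b \<in> Obj B" "b' \<in> Obj B" "g \<in> Hom B b b'" for m m' h b b' g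
    by (rule ract_bilinear[unfolded bilinear_functor_def, THEN conjunct2, THEN conjunct1, rule_format, OF that])
  show ?thesis
  proof unfold_locales
    show "bilinear_functor (revc B) M M (\<lambda>b m. m \<lhd>\<^sub>o b) (\<lambda>g h. h \<lhd>\<^sub>m g)"
      using bilinear_functor_swap[OF ract_bilinear] by (simp add: bilinear_functor_revc_left)
    fix m assume m: "m \<in> Obj M"
    show "is_iso M (m \<lhd>\<^sub>o Unit (revc B)) m (runitor M m)"
      using runitor_iso[OF m] by simp
    show "runitor M n \<cdot> (h \<lhd>\<^sub>m Idn (revc B) (Unit (revc B))) = h \<cdot> runitor M m"
      if "n \<in> Obj M" "h \<in> Hom M m n" for n h
      using runitor_natural[OF m that] by simp
    fix a assume "a \<in> Obj (revc B)"
    then have a: "a \<in> Obj B" by simp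
    show "runitor M m \<lhd>\<^sub>m Idn (revc B) a \<cdot> rassoc M m (Unit (revc B)) a = Idn M m \<lhd>\<^sub>m runit (revc B) a"
      using ract_triangle[OF m a] by simp
    fix b assume "b \<in> Obj (revc B)"
    then have b: "b \<in> Obj B" by simp
    show "is_iso M (m \<lhd>\<^sub>o tenso (revc B) a b) ((m \<lhd>\<^sub>o b) \<lhd>\<^sub>o a) (rassoc M m b a)"
      using rassoc_iso[OF m b a] by simp
    show "rassoc M n c' c \<cdot> (h \<lhd>\<^sub>m tensm (revc B) f f') = ((h \<lhd>\<^sub>m f') \<lhd>\<^sub>m f) \<cdot> rassoc M m b a"
      if "c \<in> Obj (revc B)" "c' \<in> Obj (revc B)" "n \<in> Obj M" "f \<in> Hom (revc B) a c" "f' \<in> Hom (revc B) b c'" "h \<in> Hom M m n"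
      for c c' n f f' h
      using rassoc_natural[OF m b a that(3)] that by simp
    fix c assume "c \<in> Obj (revc B)"
    then have c: "c \<in> Obj B" by simp
    have assoc: "assoc B c b a \<in> Hom B ((c \<otimes>\<^sub>o\<^bsub>B\<^esub> b) \<otimes>\<^sub>o\<^bsub>B\<^esub> a) (c \<otimes>\<^sub>o\<^bsub>B\<^esub> (b \<otimes>\<^sub>o\<^bsub>B\<^esub> a))"
      "inv_mor B (assoc B c b a) \<in> Hom B (c \<otimes>\<^sub>o\<^bsub>B\<^esub> (b \<otimes>\<^sub>o\<^bsub>B\<^esub> a)) ((c \<otimes>\<^sub>o\<^bsub>B\<^esub> b) \<otimes>\<^sub>o\<^bsub>B\<^esub> a)"
      "assoc B c b a \<cdot>\<^bsub>B\<^esub> inv_mor B (assoc B c b a) = Idn B (c \<otimes>\<^sub>o\<^bsub>B\<^esub> (b \<otimes>\<^sub>o\<^bsub>B\<^esub> a))"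
      using B.is_inverse_inv_mor[OF _ _ B.assoc_iso[OF c b a]] a b c by (simp_all add: is_inverse_def)
    \<comment> \<open>\<open>P\<close> and \<open>Q\<close> are the actions on \<open>m\<close> of
      the associator of \<open>B\<close> and of its inverse; \<open>R\<close> and \<open>W\<close>
      provide the remaining edges of the pentagon as arrows, so that the pentagon can be composed
      with \<open>Q\<close> and \<open>P \<star> Q\<close> cancelled.\<close>
    define P where "P = Arr (m \<lhd>\<^sub>o ((c \<otimes>\<^sub>o\<^bsub>B\<^esub> b) \<otimes>\<^sub>o\<^bsub>B\<^esub> a)) (Idn M m \<lhd>\<^sub>m assoc B c b a) (m \<lhd>\<^sub>o (c \<otimes>\<^sub>o\<^bsub>B\<^esub> (b \<otimes>\<^sub>o\<^bsub>B\<^esub> a)))"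
    define Q where "Q = Arr (m \<lhd>\<^sub>o (c \<otimes>\<^sub>o\<^bsub>B\<^esub> (b \<otimes>\<^sub>o\<^bsub>B\<^esub> a))) (Idn M m \<lhd>\<^sub>m inv_mor B (assoc B c b a)) (m \<lhd>\<^sub>o ((c \<otimes>\<^sub>o\<^bsub>B\<^esub> b) \<otimes>\<^sub>o\<^bsub>B\<^esub> a))"
    define R where "R m x y = Arr (m \<lhd>\<^sub>o (x \<otimes>\<^sub>o\<^bsub>B\<^esub> y)) (rassoc M m x y) ((m \<lhd>\<^sub>o x) \<lhd>\<^sub>o y)" for m x y
    define W where "W = Arr ((m \<lhd>\<^sub>o (c \<otimes>\<^sub>o\<^bsub>B\<^esub> b)) \<lhd>\<^sub>o a) (rassoc M m c b \<lhd>\<^sub>m Idn B a) (((m \<lhd>\<^sub>o c) \<lhd>\<^sub>o b) \<lhd>\<^sub>o a)"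
    have Rm: "rassoc M m' x y \<in> Hom M (m' \<lhd>\<^sub>o (x \<otimes>\<^sub>o\<^bsub>B\<^esub> y)) ((m' \<lhd>\<^sub>o x) \<lhd>\<^sub>o y)"
      if "m' \<in> Obj M" "x \<in> Obj B" "y \<in> Obj B" for m' x y
      using rassoc_iso[OF that] by (auto simp: is_iso_def is_inverse_def)
    have [simp]: "arr M P" "arr M Q" "arr M W"
      using m a b c assoc Rm by (auto simp: P_def Q_def W_def ob intro!: hom id_hom B.id_hom)
    have [simp]: "src P = m \<lhd>\<^sub>o ((c \<otimes>\<^sub>o\<^bsub>B\<^esub> b) \<otimes>\<^sub>o\<^bsub>B\<^esub> a)" "tgt P = m \<lhd>\<^sub>o (c \<otimes>\<^sub>o\<^bsub>B\<^esub> (b \<otimes>\<^sub>o\<^bsub>B\<^esub> a))"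
      "src Q = tgt P" "tgt Q = src P" "src W = (m \<lhd>\<^sub>o (c \<otimes>\<^sub>o\<^bsub>B\<^esub> b)) \<lhd>\<^sub>o a" "tgt W = ((m \<lhd>\<^sub>o c) \<lhd>\<^sub>o b) \<lhd>\<^sub>o a"
      "mor P = Idn M m \<lhd>\<^sub>m assoc B c b a" "mor Q = Idn M m \<lhd>\<^sub>m inv_mor B (assoc B c b a)"
      "mor W = rassoc M m c b \<lhd>\<^sub>m Idn B a"
      by (simp_all add: P_def Q_def W_def)
    have [simp]: "arr M (R m' x y)" if "m' \<in> Obj M" "x \<in> Obj B" "y \<in> Obj B" for m' x y
      using that Rm by (simp add: R_def ob)
    have [simp]: "src (R m' x y) = m' \<lhd>\<^sub>o (x \<otimes>\<^sub>o\<^bsub>B\<^esub> y)" "tgt (R m' x y) = (m' \<lhd>\<^sub>o x) \<lhd>\<^sub>o y"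
      "mor (R m' x y) = rassoc M m' x y" for m' x y
      by (simp_all add: R_def)
    have "mor P \<cdot> mor Q = Idn M (tgt P)"
    proof -
      have "(Idn M m \<cdot> Idn M m) \<lhd>\<^sub>m (assoc B c b a \<cdot>\<^bsub>B\<^esub> inv_mor B (assoc B c b a))
          = (Idn M m \<lhd>\<^sub>m assoc B c b a) \<cdot> (Idn M m \<lhd>\<^sub>m inv_mor B (assoc B c b a))"
        by (rule ract_bilinear[unfolded bilinear_functor_def, THEN conjunct2, THEN conjunct2, THEN conjunct2,
              THEN conjunct1, rule_format, OF m m m _ _ _ _ _ assoc(2,1)])
          (use m a b c in \<open>auto simp: id_hom\<close>)
      moreover have "Idn M m \<lhd>\<^sub>m Idn B (c \<otimes>\<^sub>o\<^bsub>B\<^esub> (b \<otimes>\<^sub>o\<^bsub>B\<^esub> a)) = Idn M (m \<lhd>\<^sub>o (c \<otimes>\<^sub>o\<^bsub>B\<^esub> (b \<otimes>\<^sub>o\<^bsub>B\<^esub> a)))"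
        using ract_bilinear m a b c by (simp add: bilinear_functor_def)
      ultimately show ?thesis
        using assoc(3) m comp_id_left[OF m m id_hom[OF m]] by simp
    qed
    then have PQ: "P \<star> Q = idt M (tgt P)"
      using m a b c by (intro arr_eqI[of M]) (auto simp: mor_cmp ob)
    have "R (m \<lhd>\<^sub>o c) b a \<star> R m c (b \<otimes>\<^sub>o\<^bsub>B\<^esub> a) \<star> P = W \<star> R m (c \<otimes>\<^sub>o\<^bsub>B\<^esub> b) a"
      using ract_pentagon[OF m c b a] m a b c by (intro arr_eqI[of M]) (auto simp: mor_cmp ob)
    then have "W \<star> R m (c \<otimes>\<^sub>o\<^bsub>B\<^esub> b) a \<star> Q = R (m \<lhd>\<^sub>o c) b a \<star> R m c (b \<otimes>\<^sub>o\<^bsub>B\<^esub> a) \<star> (P \<star> Q)"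
      by (metis cmp_assoc)
    then have "W \<star> R m (c \<otimes>\<^sub>o\<^bsub>B\<^esub> b) a \<star> Q = R (m \<lhd>\<^sub>o c) b a \<star> R m c (b \<otimes>\<^sub>o\<^bsub>B\<^esub> a)"
      unfolding PQ using m a b c by (simp add: ob)
    from arg_cong[OF this, of mor]
    show "(rassoc M m c b \<lhd>\<^sub>m Idn (revc B) a) \<cdot> rassoc M m (tenso (revc B) b c) a \<cdot> (Idn M m \<lhd>\<^sub>m assoc (revc B) a b c)
        = rassoc M (m \<lhd>\<^sub>o c) b a \<cdot> rassoc M m c (tenso (revc B) a b)"
      using m a b c by (simp add: mor_cmp ob)
  qed (simp add: B.dual_pair_revc)
qed

text \<open>Reversal lets objects and their duals change places and turns the bracketing around, so
  the primed formulas are the ones that match \<open>tens_ev\<close> and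
  \<open>tens_coev\<close>.\<close>

lemma (in finite_tensor_category) tens_revc:
  assumes ob: "a \<in> Obj A" "b \<in> Obj A" "X \<in> Obj A" "Y \<in> Obj A"
    and e: "eX \<in> homs (revc A) (a \<otimes>\<^sub>o X) (Unit A)" "eY \<in> homs (revc A) (b \<otimes>\<^sub>o Y) (Unit A)"
    and h: "hX \<in> homs (revc A) (Unit A) (X \<otimes>\<^sub>o a)" "hY \<in> homs (revc A) (Unit A) (Y \<otimes>\<^sub>o b)"
  shows "mor (weak_monoidal.TE' (revc A) a b X Y eX eY) = tens_ev A X Y a b (mor eX) (mor eY)"
    and "mor (weak_monoidal.TH' (revc A) a b X Y hX hY) = tens_coev A X Y a b (mor hX) (mor hY)"
proof -
  interpret W: weak_monoidal "revc A" by (rule weak_monoidal_revc)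
  show "mor (W.TE' a b X Y eX eY) = tens_ev A X Y a b (mor eX) (mor eY)"
    "mor (W.TH' a b X Y hX hY) = tens_coev A X Y a b (mor hX) (mor hY)"
    using ob e h by (auto simp: W.TE'_def W.TH'_def tens_ev_def tens_coev_def W.mor_cmp homs_def)
qed

section \<open>The twisted bimodule category and the theorem\<close>

lemma rr_ll_simps [simp]:
  "Obj (rr_ll A B M) = Obj M" "Hom (rr_ll A B M) = Hom M" "Idn (rr_ll A B M) = Idn M"
  "Comp (rr_ll A B M) = Comp M" "Scale (rr_ll A B M) = Scale M"
  "lacto (rr_ll A B M) a m = lacto M (rdual A (rdual A a)) m"
  "lactm (rr_ll A B M) f h = lactm M (rdualm A (rdualm A f)) h"
  "lassoc (rr_ll A B M) a a' m = lassoc M (rdual A (rdual A a)) (rdual A (rdual A a')) m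
     \<cdot>\<^bsub>M\<^esub> lactm M (rr_tens A a a') (Idn M m)"
  "lunitor (rr_ll A B M) m = lunitor M m \<cdot>\<^bsub>M\<^esub> lactm M (rr_unit A) (Idn M m)"
  "racto (rr_ll A B M) m b = racto M m (ldual B (ldual B b))"
  "ractm (rr_ll A B M) h g = ractm M h (ldualm B (ldualm B g))"
  "rassoc (rr_ll A B M) m b b' = rassoc M m (ldual B (ldual B b)) (ldual B (ldual B b'))
     \<cdot>\<^bsub>M\<^esub> ractm M (Idn M m) (ll_tens B b b')"
  "runitor (rr_ll A B M) m = runitor M m \<cdot>\<^bsub>M\<^esub> ractm M (Idn M m) (ll_unit B)"
  "middle (rr_ll A B M) a m b = middle M (rdual A (rdual A a)) m (ldual B (ldual B b))"
  "is_iso (rr_ll A B M) = is_iso M"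
  "linear_functor C (rr_ll A B M) = linear_functor C M"
  by (simp_all add: rr_ll_def fun_eq_iff is_iso_def is_inverse_def linear_functor_def)

theorem theorem4p4:
  fixes A :: "('a, 'f::ab_group_add, 'k::alg_closed_field) rigidcat"
    and B :: "('b, 'g::ab_group_add, 'k) rigidcat"
    and M :: "('o, 'm::ab_group_add, 'k, 'a, 'f, 'b, 'g) bimodcat"
    and cpo :: "'m set \<Rightarrow> 'o \<Rightarrow> 'o" and cpb :: "'m set \<Rightarrow> 'o \<Rightarrow> 'm \<Rightarrow> 'm \<Rightarrow> 'm"
    and No :: "'o \<Rightarrow> 'o" and Nm :: "'m \<Rightarrow> 'm" and \<pi> :: "'o \<Rightarrow> 'o \<Rightarrow> 'm"
  assumes "finite_tensor_category A"
    and "finite_tensor_category B"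
    and "bimodule_category A B M"
    and "copower_choice M cpo cpb"
    and "is_left_nakayama M cpo cpb No Nm \<pi>"
  shows "\<exists>sl sr. bimodule_functor A B M (rr_ll A B M) No Nm sl sr \<and>
    (\<forall>a\<in>Obj A. \<forall>m\<in>Obj M. \<forall>b\<in>Obj B.
       is_iso M (No ((a \<rhd>\<^sub>o\<^bsub>M\<^esub> m) \<lhd>\<^sub>o\<^bsub>M\<^esub> b))
         ((rdual A (rdual A a) \<rhd>\<^sub>o\<^bsub>M\<^esub> No m) \<lhd>\<^sub>o\<^bsub>M\<^esub> ldual B (ldual B b))
         ((sl a m \<lhd>\<^sub>m\<^bsub>M\<^esub> Idn B (ldual B (ldual B b))) \<cdot>\<^bsub>M\<^esub> sr (a \<rhd>\<^sub>o\<^bsub>M\<^esub> m) b))"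
proof -
  interpret bimodule_category A B M by fact
  interpret N: nakayama M cpo cpb No Nm \<pi>
    using assms(4,5) linear_category_axioms by (simp add: nakayama_def nakayama_axioms_def)
  interpret L: rigid_lmod A M "lacto M" "lactm M" "lassoc M" "lunitor M" by (rule rigid_lmod)
  interpret R: rigid_lmod "revc B" M "\<lambda>b m. racto M m b" "\<lambda>g h. ractm M h g" "\<lambda>a b m. rassoc M m b a" "runitor M"
    by (rule rigid_lmod_revc)
  \<comment> \<open>The middle constraint keeps its direction under the reversal of
    \<open>B\<close>; the axioms change only in the order of arguments.\<close>
  interpret nakayama_bimodule A "revc B" M "lacto M" "lactm M" "lassoc M" "lunitor M"
    "\<lambda>b m. racto M m b" "\<lambda>g h. ractm M h g" "\<lambda>a b m. rassoc M m b a" "runitor M" cpo cpb No Nm \<pi> "middle M"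
    by unfold_locales
      (auto simp: middle_iso middle_pentagon_left middle_pentagon_right middle_unit_left middle_unit_right
        intro: middle_natural)
  \<comment> \<open>With \<open>TE\<close> and \<open>TH\<close> as evaluation and coevaluation, the
    comparison arrow is the morphism prescribed in \<open>rr_ll\<close>.\<close>
  have rr_tens: "mor (L.ddt (L.A.TE a b (L.D a) (L.D b) (L.Ev a) (L.Ev b))
      (L.A.TH (L.D b) (L.D a) (L.D (L.D b)) (L.D (L.D a)) (L.Cv (L.D b)) (L.Cv (L.D a))) a b) = rr_tens A a b"
    if "a \<in> Obj A" "b \<in> Obj A" for a b
    using that L.mate_tens_simps(4)[OF that L.tens_arrows(1)[OF that] L.tens_arrows(3)[of "L.D b" "L.D a"]]
      L.A.tens_simps(5)[of a b "L.D a" "L.D b" "L.Ev a" "L.Ev b" "L.Cv a" "L.Cv b"]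
      L.A.tens_simps(6)[of "L.D b" "L.D a" "L.D (L.D b)" "L.D (L.D a)" "L.Ev (L.D b)" "L.Ev (L.D a)" "L.Cv (L.D b)" "L.Cv (L.D a)"]
    by (simp add: rr_tens_def rdual_tens_def homs_def)
  have rr_unit: "mor (L.ddu (L.A.lu (Unit A)) (L.A.lui (Unit A))) = rr_unit A"
    using L.mate_unit_simps(4)[OF L.unit_arrows(1,3)] by (simp add: rr_unit_def rdual_unit_def)
  \<comment> \<open>In the reversed category the primed versions are the right choice, and the
    arguments come out swapped because its tensor product of \<open>a\<close> and \<open>b\<close>
    is that of \<open>b\<close> and \<open>a\<close> in \<open>B\<close>.\<close>
  have ll_tens: "mor (R.ddt (R.A.TE' a b (R.D a) (R.D b) (R.Ev a) (R.Ev b))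
      (R.A.TH' (R.D b) (R.D a) (R.D (R.D b)) (R.D (R.D a)) (R.Cv (R.D b)) (R.Cv (R.D a))) a b) = ll_tens B b a"
    if "a \<in> Obj B" "b \<in> Obj B" for a b
  proof -
    have ab: "a \<in> Obj (revc B)" "b \<in> Obj (revc B)" using that by simp_all
    note D = R.dual_simps(1)[OF ab(1)] R.dual_simps(1)[OF ab(2)]
    show ?thesis
      using that R.mate_tens_simps(4)[OF ab R.tens_arrows(2)[OF ab] R.tens_arrows(4)[OF D(2,1)]]
        B.tens_revc(1)[of a b "R.D a" "R.D b" "R.Ev a" "R.Ev b" "R.Cv a" "R.Cv b"]
        B.tens_revc(2)[of "R.D b" "R.D a" "R.D (R.D b)" "R.D (R.D a)" "R.Ev (R.D b)" "R.Ev (R.D a)"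
          "R.Cv (R.D b)" "R.Cv (R.D a)"]
        R.dual_simps[of a] R.dual_simps[of b] R.dual_simps[of "R.D a"] R.dual_simps[of "R.D b"]
      by (simp add: ll_tens_def ldual_tens_def homs_def B.rmate_revc)
  qed
  have ll_unit: "mor (R.ddu (R.A.ru (Unit B)) (R.A.rui (Unit B))) = ll_unit B"
    using R.mate_unit_simps(4)[of "R.A.ru (Unit B)" "R.A.rui (Unit B)"] R.unit_arrows(2,4)
    by (simp add: ll_unit_def ldual_unit_def B.rmate_revc B.unit_obj)
  \<comment> \<open>In \<open>rr_ll\<close> an identity acts through two applications of
    \<open>rdualm\<close>, whereas the coherence lemmas contain the identity of the double
    dual.\<close>
  have rdualm_idn: "rdualm A (rdualm A (Idn A a)) = Idn A (rdual A (rdual A a))" if "a \<in> Obj A" for a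
    using that by (simp add: L.rdualm_idn)
  have ldualm_idn: "ldualm B (ldualm B (Idn B b)) = Idn B (ldual B (ldual B b))" if "b \<in> Obj B" for b
    using that R.rdualm_idn[of b] R.rdualm_idn[of "ldual B b"] by (simp add: B.rdualm_revc)
  let ?sl = "\<lambda>a m. mor (L.sl a m)" and ?sr = "\<lambda>m b. mor (R.sl b m)"
  let ?N = "rr_ll A B M"
  have "bimodule_functor A B M (rr_ll A B M) No Nm ?sl ?sr"
    unfolding bimodule_functor_def
  proof (intro conjI ballI)
    show "linear_functor M ?N No Nm"
      using N.linear_functor_Nm by simp
    fix m assume m: "m \<in> Obj M"
    show "lunitor ?N (No m) \<cdot>\<^bsub>?N\<^esub> ?sl (Unit A) m = Nm (lunitor M m)"
      using L.sl_unit_mor[OF m L.unit_arrows(1,3)] by (simp add: rr_unit)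
    show "runitor ?N (No m) \<cdot>\<^bsub>?N\<^esub> ?sr m (Unit B) = Nm (runitor M m)"
      using R.sl_unit_mor[OF m R.unit_arrows(2,4)] by (simp add: ll_unit)
    show "?sr m' b' \<cdot>\<^bsub>?N\<^esub> Nm (h \<lhd>\<^sub>m\<^bsub>M\<^esub> g) = (Nm h \<lhd>\<^sub>m\<^bsub>?N\<^esub> g) \<cdot>\<^bsub>?N\<^esub> ?sr m b"
      if "m' \<in> Obj M" "h \<in> Hom M m m'" "b \<in> Obj B" "b' \<in> Obj B" "g \<in> Hom B b b'" for m' h b b' g
      using R.sl_natural_mor[of b b' g m m' h] that m by (simp add: B.rdualm_revc)
    fix b assume b: "b \<in> Obj B"
    show "is_iso ?N (No (m \<lhd>\<^sub>o\<^bsub>M\<^esub> b)) (No m \<lhd>\<^sub>o\<^bsub>?N\<^esub> b) (?sr m b)"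
      using R.sl_iso[of b m] b m by simp
    show "(?sr m b \<lhd>\<^sub>m\<^bsub>?N\<^esub> Idn B b') \<cdot>\<^bsub>?N\<^esub> ?sr (m \<lhd>\<^sub>o\<^bsub>M\<^esub> b) b' \<cdot>\<^bsub>?N\<^esub> Nm (rassoc M m b b')
        = rassoc ?N (No m) b b' \<cdot>\<^bsub>?N\<^esub> ?sr m (b \<otimes>\<^sub>o\<^bsub>B\<^esub> b')" if b': "b' \<in> Obj B" for b'
      using R.sl_assoc_mor[of b' b m "R.A.TE' b' b (R.D b') (R.D b) (R.Ev b') (R.Ev b)"
          "R.A.TH' (R.D b) (R.D b') (R.D (R.D b)) (R.D (R.D b')) (R.Cv (R.D b)) (R.Cv (R.D b'))"]
        R.tens_arrows(2)[of b' b] R.tens_arrows(4)[of "R.D b" "R.D b'"] R.dual_simps(1)[of b] R.dual_simps(1)[of b'] ll_tens[OF b' b] b b' m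
      by (simp add: ldualm_idn del: R.mate_tens_simps(4))
  next
    fix a assume a: "a \<in> Obj A"
    fix m assume m: "m \<in> Obj M"
    show "is_iso ?N (No (a \<rhd>\<^sub>o\<^bsub>M\<^esub> m)) (a \<rhd>\<^sub>o\<^bsub>?N\<^esub> No m) (?sl a m)"
      using L.sl_iso[of a m] a m by simp
    show "(Idn A a \<rhd>\<^sub>m\<^bsub>?N\<^esub> ?sl a' m) \<cdot>\<^bsub>?N\<^esub> ?sl a (a' \<rhd>\<^sub>o\<^bsub>M\<^esub> m) \<cdot>\<^bsub>?N\<^esub> Nm (lassoc M a a' m)
          = lassoc ?N a a' (No m) \<cdot>\<^bsub>?N\<^esub> ?sl (a \<otimes>\<^sub>o\<^bsub>A\<^esub> a') m" if a': "a' \<in> Obj A" for a'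
      using L.sl_assoc_mor[OF a a' m L.tens_arrows(1)[OF a a'] L.tens_arrows(3)[of "L.D a'" "L.D a"]] a a'
      by (simp add: rr_tens rdualm_idn del: L.mate_tens_simps(4))
    fix b assume b: "b \<in> Obj B"
    show "middle ?N a (No m) b \<cdot>\<^bsub>?N\<^esub> (?sl a m \<lhd>\<^sub>m\<^bsub>?N\<^esub> Idn B b) \<cdot>\<^bsub>?N\<^esub> ?sr (a \<rhd>\<^sub>o\<^bsub>M\<^esub> m) b
          = (Idn A a \<rhd>\<^sub>m\<^bsub>?N\<^esub> ?sr m b) \<cdot>\<^bsub>?N\<^esub> ?sl a (m \<lhd>\<^sub>o\<^bsub>M\<^esub> b) \<cdot>\<^bsub>?N\<^esub> Nm (middle M a m b)"
      using sl_middle_mor[of a b m] a b m by (simp add: rdualm_idn ldualm_idn)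
  next
    fix a a' f m m' h
    assume "a \<in> Obj A" "a' \<in> Obj A" "f \<in> Hom A a a'" "m \<in> Obj M" "m' \<in> Obj M" "h \<in> Hom M m m'"
    then show "?sl a' m' \<cdot>\<^bsub>?N\<^esub> Nm (f \<rhd>\<^sub>m\<^bsub>M\<^esub> h) = (f \<rhd>\<^sub>m\<^bsub>?N\<^esub> Nm h) \<cdot>\<^bsub>?N\<^esub> ?sl a m"
      using L.sl_natural_mor[of a a' f m m' h] by simp
  qed
  moreover have "is_iso M (No ((a \<rhd>\<^sub>o\<^bsub>M\<^esub> m) \<lhd>\<^sub>o\<^bsub>M\<^esub> b))
         ((rdual A (rdual A a) \<rhd>\<^sub>o\<^bsub>M\<^esub> No m) \<lhd>\<^sub>o\<^bsub>M\<^esub> ldual B (ldual B b))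
         ((?sl a m \<lhd>\<^sub>m\<^bsub>M\<^esub> Idn B (ldual B (ldual B b))) \<cdot>\<^bsub>M\<^esub> ?sr (a \<rhd>\<^sub>o\<^bsub>M\<^esub> m) b)"
    if "a \<in> Obj A" "m \<in> Obj M" "b \<in> Obj B" for a m b
    using sl_sr_iso[of a b m] that by simp
  ultimately show ?thesis by blast
qed

end
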